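(* For $|q|<1$, $$\frac{J_6^2}{J_{12}}\mathscr{F}_{24,-1}(q)=\sum_{k=-\infty}^{\infty}\frac{(-1)^{k-1}(12k-1)q^{6k^2}}{1+q^{12k-1}}+\sum_{k=-\infty}^{\infty}\frac{(-1)^{k-1}(12k-7)q^{6k^2-2}}{1+q^{12k-7}}+\frac{2qJ_{12}^2J_3^2J_2^6}{J_6^2J_4J_1^3}.$$
   Context: $J_k:=(q^k;q^k)_\infty=\prod_{m\ge1}(1-q^{km})$. For a nonnegative integer $N$, the Hurwitz class number $H(N)$ is: $0$ if $N\equiv1,2\pmod 4$; $-1/12$ if $N=0$; and for $N>0$, $N\equiv 0,3\pmod 4$, the number of classes of positive definite binary quadratic forms of discriminant $-N$, with classes containing a multiple of $x^2+y^2$ (resp. $x^2+xy+y^2$) weighted $1/2$ (resp. $1/3$). Here $\mathscr{F}_{24,-1}(q)=\sum_{n\ge1}H(24n-1)q^n$. *)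

theory Defs
  imports "HOL-Complex_Analysis.Complex_Analysis"
begin

(* The triple (a, b, c) stands for the integral form a x^2 + b x y + c y^2; it need not be primitive. *)
type_synonym bqf = "int \<times> int \<times> int"

fun bqf_eval :: "bqf \<Rightarrow> int \<Rightarrow> int \<Rightarrow> int" where
  "bqf_eval (a, b, c) x y = a * x\<^sup>2 + b * x * y + c * y\<^sup>2"

fun bqf_disc :: "bqf \<Rightarrow> int" where
  "bqf_disc (a, b, c) = b\<^sup>2 - 4 * a * c"

definition bqf_pos_def :: "bqf \<Rightarrow> bool" where
  "bqf_pos_def f \<longleftrightarrow> (\<forall>x y. (x, y) \<noteq> (0, 0) \<longrightarrow> bqf_eval f x y > 0)"

definition pos_def_forms :: "int \<Rightarrow> bqf set" where
  "pos_def_forms D = {f. bqf_pos_def f \<and> bqf_disc f = D}"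

(* Proper equivalence: only substitutions of determinant +1 are allowed. *)
definition bqf_equiv :: "bqf rel" where
  "bqf_equiv = {(f, g). \<exists>p r s t. p * t - r * s = 1 \<and>
     (\<forall>x y. bqf_eval g x y = bqf_eval f (p * x + r * y) (s * x + t * y))}"

definition form_classes :: "int \<Rightarrow> bqf set set" where
  "form_classes D = pos_def_forms D // (bqf_equiv \<inter> pos_def_forms D \<times> pos_def_forms D)"

definition class_weight :: "bqf set \<Rightarrow> real" where
  "class_weight C = (if \<exists>m. (m, 0, m) \<in> C then 1 / 2
                     else if \<exists>m. (m, m, m) \<in> C then 1 / 3
                     else 1)"

definition hurwitz_class_number :: "nat \<Rightarrow> real" where
  "hurwitz_class_number N =
     (if N = 0 then - 1 / 12
      else if N mod 4 = 1 \<or> N mod 4 = 2 then 0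
      else (\<Sum>C\<in>form_classes (- int N). class_weight C))"

definition J :: "nat \<Rightarrow> complex \<Rightarrow> complex" where
  "J k q = (\<Prod>m. 1 - q ^ (k * Suc m))"

(* n ranges over n >= 1, so the truncated subtraction 24 * n - 1 is exact. *)
definition F_term :: "complex \<Rightarrow> nat \<Rightarrow> complex" where
  "F_term q n = of_real (hurwitz_class_number (24 * n - 1)) * q ^ n"

definition F_24_m1 :: "complex \<Rightarrow> complex" where
  "F_24_m1 q = (\<Sum>\<^sub>\<infinity>n\<in>{1..}. F_term q n)"

(* Summands of the two bilateral series.  They involve negative powers of q, but q = 0 is a
   removable singularity of each of them; remove_sings gives them their limit (namely 0) at
   q = 0, where 0 powi (-1) = 0 would yield a wrong value.  For 0 < |q| < 1 they are
   literally the quotients inside, see the lemmas below. *)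
definition lambert_term1 :: "complex \<Rightarrow> int \<Rightarrow> complex" where
  "lambert_term1 q k = remove_sings
     (\<lambda>z. (-1) powi (k - 1) * of_int (12 * k - 1) * z powi (6 * k\<^sup>2)
            / (1 + z powi (12 * k - 1))) q"

definition lambert_term2 :: "complex \<Rightarrow> int \<Rightarrow> complex" where
  "lambert_term2 q k = remove_sings
     (\<lambda>z. (-1) powi (k - 1) * of_int (12 * k - 7) * z powi (6 * k\<^sup>2 - 2)
            / (1 + z powi (12 * k - 7))) q"

lemma one_plus_powi_nonzero:
  fixes q :: complex and m :: int
  assumes "norm q < 1" "q \<noteq> 0" "m \<noteq> 0"
  shows "1 + q powi m \<noteq> 0"
proof
  assume "1 + q powi m = 0"
  hence "q powi m = -1" by (simp add: eq_neg_iff_add_eq_0 add.commute)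
  hence "norm q powi m = 1" by (metis norm_minus_cancel norm_one norm_power_int)
  hence "norm q ^ nat \<bar>m\<bar> = 1"
    by (auto simp: power_int_def abs_if power_inverse split: if_splits)
  moreover have "norm q ^ nat \<bar>m\<bar> < 1"
    using assms by (intro power_less_one_iff[THEN iffD2]) auto
  ultimately show False by simp
qed

lemma lambert_term1_eq:
  assumes "norm q < 1" "q \<noteq> 0"
  shows "lambert_term1 q k = (-1) powi (k - 1) * of_int (12 * k - 1) * q powi (6 * k\<^sup>2)
            / (1 + q powi (12 * k - 1))"
  unfolding lambert_term1_def
proof (rule remove_sings_at_analytic)
  have "12 * k - 1 \<noteq> 0" by presburger
  from one_plus_powi_nonzero[OF assms this] assms(2)
  show "(\<lambda>z. (-1) powi (k - 1) * of_int (12 * k - 1) * z powi (6 * k\<^sup>2)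
            / (1 + z powi (12 * k - 1))) analytic_on {q}"
    by (intro analytic_intros) auto
qed

lemma lambert_term2_eq:
  assumes "norm q < 1" "q \<noteq> 0"
  shows "lambert_term2 q k = (-1) powi (k - 1) * of_int (12 * k - 7) * q powi (6 * k\<^sup>2 - 2)
            / (1 + q powi (12 * k - 7))"
  unfolding lambert_term2_def
proof (rule remove_sings_at_analytic)
  have "12 * k - 7 \<noteq> 0" by presburger
  from one_plus_powi_nonzero[OF assms this] assms(2)
  show "(\<lambda>z. (-1) powi (k - 1) * of_int (12 * k - 7) * z powi (6 * k\<^sup>2 - 2)
            / (1 + z powi (12 * k - 7))) analytic_on {q}"
    by (intro analytic_intros) auto
qed

lemma powi_quotient_tendsto_0:
  fixes e m :: int and c :: complex
  assumes "e > 0 \<and> m > 0 \<or> e > m \<and> m < 0"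
  shows "(\<lambda>z. c * z powi e / (1 + z powi m)) \<midarrow>0\<rightarrow> 0"
  using assms
proof
  assume A: "e > 0 \<and> m > 0"
  have "((\<lambda>z. c * z ^ nat e / (1 + z ^ nat m)) \<longlongrightarrow> c * 0 ^ nat e / (1 + 0 ^ nat m)) (at 0)"
    by (intro tendsto_intros) (use A in \<open>auto simp: zero_power\<close>)
  thus ?thesis using A by (simp add: power_int_def zero_power)
next
  assume A: "e > m \<and> m < 0"
  have "((\<lambda>z. c * z ^ nat (e - m) / (z ^ nat (- m) + 1)) \<longlongrightarrow>
          c * 0 ^ nat (e - m) / (0 ^ nat (- m) + 1)) (at 0)"
    by (intro tendsto_intros) (use A in \<open>auto simp: zero_power\<close>)
  hence "((\<lambda>z. c * z ^ nat (e - m) / (z ^ nat (- m) + 1)) \<longlongrightarrow> 0) (at 0)"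
    using A by (simp add: zero_power)
  moreover have "\<forall>\<^sub>F z in at 0. c * z ^ nat (e - m) / (z ^ nat (- m) + 1)
                    = c * z powi e / (1 + z powi m)"
    unfolding eventually_at_filter
  proof (intro always_eventually allI impI)
    fix z :: complex assume z: "z \<noteq> 0"
    have "z ^ nat (e - m) = z powi e * z powi (- m)"
    proof -
      have "z ^ nat (e - m) = z powi (e + - m)" using A by (simp add: power_int_def)
      also have "\<dots> = z powi e * z powi (- m)" by (rule power_int_add) (use z in auto)
      finally show ?thesis .
    qed
    moreover have "z ^ nat (- m) = z powi (- m)" using A by (simp add: power_int_def)
    moreover have "z powi (- m) + 1 = (1 + z powi m) * z powi (- m)"
      using z by (simp add: algebra_simps flip: power_int_add)
    ultimately show "c * z ^ nat (e - m) / (z ^ nat (- m) + 1) = c * z powi e / (1 + z powi m)"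
      using z by simp
  qed
  ultimately show ?thesis by (rule Lim_transform_eventually)
qed

lemma lambert_term1_0: "lambert_term1 0 k = 0"
  unfolding lambert_term1_def
proof (rule remove_sings_eqI, rule powi_quotient_tendsto_0)
  have "6 * k\<^sup>2 \<ge> 0" "k = 0 \<Longrightarrow> k\<^sup>2 = 0" "k \<noteq> 0 \<Longrightarrow> k\<^sup>2 > 0" by auto
  moreover have "k \<le> 0 \<or> k \<ge> 1" by linarith
  ultimately show "6 * k\<^sup>2 > 0 \<and> 12 * k - 1 > 0 \<or> 6 * k\<^sup>2 > 12 * k - 1 \<and> 12 * k - 1 < 0"
    by (cases "k = 0"; linarith)
qed

lemma lambert_term2_0: "lambert_term2 0 k = 0"
  unfolding lambert_term2_def
proof (rule remove_sings_eqI, rule powi_quotient_tendsto_0)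
  have "k\<^sup>2 \<ge> 0" "k \<noteq> 0 \<Longrightarrow> k\<^sup>2 \<ge> 1" by (auto simp: int_one_le_iff_zero_less)
  moreover have "k \<le> 0 \<or> k \<ge> 1" by linarith
  ultimately show "6 * k\<^sup>2 - 2 > 0 \<and> 12 * k - 7 > 0 \<or> 6 * k\<^sup>2 - 2 > 12 * k - 7 \<and> 12 * k - 7 < 0"
    by (cases "k = 0"; linarith)
qed

end

theory Submission
  imports Defs
begin

text \<open>
Every class of forms of discriminant \<open>1 - 8n\<close> contains exactly one form \<open>(2A, -(2i+1), 2C)\<close> with
\<open>0 \<le> i < 2 min(A, C)\<close>, and has weight 1; so \<open>H(8n-1)\<close> counts the triples \<open>(A, C, i)\<close> with
\<open>2AC - i(i+1)/2 = n\<close> in this range. The generating function of these numbers is the member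
\<open>h\<^sub>0\<close> of a family \<open>h\<^sub>t\<close> of Appell-type sums, and telescoping with Abel summation gives \<open>h\<^sub>t - h\<^sub>0\<close>
as an explicit finite sum. Now evaluate \<open>\<Sum>\<^sub>t (-1)\<^sup>t q\<^bsup>18t\<^sup>2\<^esup> h\<^bsub>3|t|\<^esub>\<close> twice. Inserting that formula gives
\<open>J\<^sub>1\<^sub>8\<^sup>2/J\<^sub>3\<^sub>6\<close> times \<open>h\<^sub>0\<close> plus a sum over pairs \<open>(m, i)\<close>; summing over \<open>t\<close> first factors the sum
into two pieces, which the Jacobi triple product and Kronecker's identity turn into infinite
products. Averaging the resulting identity over \<open>q, \<omega>q, \<omega>\<^sup>2q\<close> with \<open>\<omega>\<^sup>3 = 1\<close> retains the exponents
divisible by 3. In the variable \<open>q\<^sup>3\<close> these yield the numbers \<open>H(24n-1)\<close>, the geometric expansions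
of the two Lambert series, and the product term.
\<close>

section \<open>Infinite products and the Jacobi triple product\<close>

text \<open>Only the members \<open>h (3 * t)\<close> enter because, with step 3 and sign (-1)^t,
  the sums \<open>Z s\<close> of \<open>cc s (3 * t)\<close> over t are odd in s and change sign
  under s -> s + 3. So they are proportional to w^s - w^(-s) for a primitive sixth root of unity w,
  and the double sum factors. The weight q^(18t^2) cancels the factor q^(-2(3t)^2) in
  \<open>h\<close>. The same step 3 turns the coefficients of the finite sum into 12m - 2i - 1 with
  i < 6m, which for i = 0, 5 and i = 2, 3 modulo 6 become plus or minus 12k - 1 and 12k - 7.
  Exponents divisible by 3 are selected because 24n - 1 = 8(3n) - 1; hence the identity is proved at
  a cube root of the given q. The obstacle to exchanging sums is that \<open>pp s\<close> grows like
  q^(-2s^2): only q^(2s^2) \<open>pp s\<close> is small, and the kernel has to decay in t without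
  spoiling this. The infinite product is not trisected directly: it is a fixed product times a
  quotient of two theta series, and the numerator of the average collapses to one product only
  through a product formula for the sum of two squared theta series.\<close>

definition qp :: "complex \<Rightarrow> complex \<Rightarrow> complex" where
  "qp a q = (\<Prod>m. 1 - a * q ^ m)"

lemma summable_qp: "norm q < 1 \<Longrightarrow> summable (\<lambda>m. norm ((1 - a * q ^ m) - 1 :: complex))"
  by (simp add: norm_mult norm_power)

lemma convergent_qp: "norm q < 1 \<Longrightarrow> convergent_prod (\<lambda>m. 1 - a * q ^ m :: complex)"
  by (intro abs_convergent_prod_imp_convergent_prod summable_imp_abs_convergent_prod summable_qp)

lemma qp_LIMSEQ:
  assumes "norm q < 1"
  shows "(\<lambda>n. \<Prod>m<n. 1 - a * q ^ m) \<longlonglongrightarrow> qp a q"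
  using convergent_prod_LIMSEQ[OF convergent_qp[OF assms], of a]
  by (simp add: qp_def flip: LIMSEQ_lessThan_iff_atMost)

lemma qp_nonzero:
  assumes "norm q < 1" "\<And>m. a * q ^ m \<noteq> 1"
  shows "qp a q \<noteq> 0"
  unfolding qp_def by (intro prodinf_nonzero convergent_qp assms) (use assms(2) in force)

lemma power_neq_1:
  fixes q :: complex
  assumes "norm q < 1" "n > 0"
  shows "q ^ n \<noteq> 1"
proof
  assume "q ^ n = 1"
  hence "norm q ^ n = 1" by (metis norm_one norm_power)
  moreover have "norm q ^ n < 1" using assms by (simp add: power_less_one_iff)
  ultimately show False by simp
qed

lemma powi_neq_1:
  fixes q :: complex
  assumes "norm q < 1" "q \<noteq> 0" "m \<noteq> 0"
  shows "q powi m \<noteq> 1"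
  using assms power_neq_1[of q "nat m"] power_neq_1[of q "nat (-m)"]
  by (cases "m > 0") (auto simp: power_int_def power_inverse)

lemma J_qp: "J k q = qp (q ^ k) (q ^ k)"
  by (simp add: J_def qp_def power_add power_mult)

lemma J_nonzero: "norm q < 1 \<Longrightarrow> k > 0 \<Longrightarrow> J k q \<noteq> 0"
proof -
  assume *: "norm q < 1" "k > 0"
  hence "norm (q ^ k) < 1" by (simp add: norm_power power_less_one_iff)
  thus ?thesis unfolding J_qp
    by (rule qp_nonzero) (use * power_neq_1[of q "k * Suc m" for m] in \<open>simp add: power_add power_mult\<close>)
qed

lemma qp_self_nonzero: "norm q < 1 \<Longrightarrow> qp q q \<noteq> 0"
  using J_nonzero[of q 1] by (simp add: J_qp)

lemma qp_Suc:
  assumes "norm q < 1"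
  shows "qp a q = (1 - a) * qp (a * q) q"
proof -
  have "(\<lambda>n. (1 - a) * (\<Prod>m<n. 1 - (a * q) * q ^ m)) \<longlonglongrightarrow> (1 - a) * qp (a * q) q"
    by (intro tendsto_intros qp_LIMSEQ assms)
  also have "(\<lambda>n. (1 - a) * (\<Prod>m<n. 1 - (a * q) * q ^ m)) = (\<lambda>n. \<Prod>m<Suc n. 1 - a * q ^ m)"
    by (simp add: prod.lessThan_Suc_shift mult_ac del: prod.lessThan_Suc)
  finally have "(\<lambda>n. \<Prod>m<n. 1 - a * q ^ m) \<longlonglongrightarrow> (1 - a) * qp (a * q) q"
    by (rule LIMSEQ_imp_Suc)
  thus ?thesis using qp_LIMSEQ[OF assms] LIMSEQ_unique by blast
qed

text \<open>The factors are sorted by the residue of their index modulo k; the limit is taken along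
  multiples of k.\<close>

lemma qp_split:
  assumes q: "norm q < 1" and k: "k > 0"
  shows "qp a q = (\<Prod>j<k. qp (a * q ^ j) (q ^ k))"
proof -
  have qk: "norm (q ^ k) < 1" using assms by (simp add: norm_power power_less_one_iff)
  have "(\<lambda>n. \<Prod>m<k * n. 1 - a * q ^ m) \<longlonglongrightarrow> qp a q"
    using k by (intro filterlim_compose[OF qp_LIMSEQ[OF q]] filterlim_at_top_mono[OF filterlim_ident])
       (auto simp: eventually_sequentially intro!: exI[of _ 0])
  moreover have "(\<Prod>m<k * n. 1 - a * q ^ m) = (\<Prod>j<k. \<Prod>m<n. 1 - (a * q ^ j) * (q ^ k) ^ m)" for n
  proof (induction n)
    case (Suc n)
    have "(\<Prod>m<k * Suc n. 1 - a * q ^ m) = (\<Prod>m<k * n. 1 - a * q ^ m) * (\<Prod>m\<in>{k*n..<k*n+k}. 1 - a * q ^ m)"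
      by (subst prod.union_disjoint [symmetric]) (auto intro!: prod.cong simp: ivl_disj_un)
    also have "(\<Prod>m\<in>{k*n..<k*n+k}. 1 - a * q ^ m) = (\<Prod>j<k. 1 - a * q ^ (k * n + j))"
      using prod.shift_bounds_nat_ivl[of "\<lambda>m. 1 - a * q ^ m" 0 "k*n" k]
      by (simp add: atLeast0LessThan add.commute)
    finally show ?case using Suc by (simp add: prod.distrib power_add power_mult mult_ac)
  qed simp
  moreover have "(\<lambda>n. \<Prod>j<k. \<Prod>m<n. 1 - (a * q ^ j) * (q ^ k) ^ m) \<longlonglongrightarrow> (\<Prod>j<k. qp (a * q ^ j) (q ^ k))"
    by (intro tendsto_intros qp_LIMSEQ qk)
  ultimately show ?thesis by (metis (no_types, lifting) LIMSEQ_unique ext)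
qed

lemma qp_square:
  assumes "norm q < 1"
  shows "qp a q * qp (- a) q = qp (a\<^sup>2) (q\<^sup>2)"
proof -
  have *: "norm (q\<^sup>2) < 1" using assms by (simp add: norm_power power_less_one_iff)
  have "(\<lambda>n. (\<Prod>m<n. 1 - a * q ^ m) * (\<Prod>m<n. 1 - (-a) * q ^ m)) \<longlonglongrightarrow> qp a q * qp (-a) q"
    by (intro tendsto_intros qp_LIMSEQ assms)
  moreover have "(\<Prod>m<n. 1 - a * q ^ m) * (\<Prod>m<n. 1 - (-a) * q ^ m) = (\<Prod>m<n. 1 - a\<^sup>2 * (q\<^sup>2) ^ m)" for n
    by (simp add: power2_eq_square power_mult_distrib algebra_simps flip: prod.distrib)
  ultimately show ?thesis using qp_LIMSEQ[OF *, of "a\<^sup>2"] LIMSEQ_unique by auto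
qed

lemma cube_root_of_unity:
  fixes w :: complex assumes "w\<^sup>2 + w + 1 = 0"
  shows "w ^ 3 = 1" "w \<noteq> 0" "w \<noteq> 1"
proof -
  have "w ^ 3 - 1 = (w - 1) * (w\<^sup>2 + w + 1)" by (simp add: algebra_simps power2_eq_square power3_eq_cube)
  thus "w ^ 3 = 1" using assms by simp
  show "w \<noteq> 0" "w \<noteq> 1" using assms by auto
qed

lemma cube_factor:
  fixes w z :: complex assumes "w\<^sup>2 + w + 1 = 0"
  shows "(1 - z) * (1 - w * z) * (1 - w\<^sup>2 * z) = 1 - z ^ 3"
proof -
  have w: "w\<^sup>2 = - w - 1" using assms by (simp add: eq_neg_iff_add_eq_0 algebra_simps)
  have "(1 - z) * (1 - w * z) * (1 - w\<^sup>2 * z)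
      = 1 - z * (1 + w + w\<^sup>2) + z\<^sup>2 * (w + w\<^sup>2 + w ^ 3) - z ^ 3 * w ^ 3"
    by (simp add: algebra_simps power2_eq_square power3_eq_cube)
  thus ?thesis using cube_root_of_unity(1)[OF assms] by (simp add: w)
qed

lemma qp_cube:
  assumes "norm q < 1" "w\<^sup>2 + w + 1 = 0"
  shows "qp a q * qp (w * a) q * qp (w\<^sup>2 * a) q = qp (a ^ 3) (q ^ 3)"
proof -
  have *: "norm (q ^ 3) < 1" using assms by (simp add: norm_power power_less_one_iff)
  have "(\<lambda>n. (\<Prod>m<n. 1 - a * q ^ m) * (\<Prod>m<n. 1 - (w*a) * q ^ m) * (\<Prod>m<n. 1 - (w\<^sup>2*a) * q ^ m)) \<longlonglongrightarrow> qp a q * qp (w * a) q * qp (w\<^sup>2 * a) q"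
    by (intro tendsto_intros qp_LIMSEQ assms)
  moreover have "(\<Prod>m<n. 1 - a * q ^ m) * (\<Prod>m<n. 1 - (w*a) * q ^ m) * (\<Prod>m<n. 1 - (w\<^sup>2*a) * q ^ m) = (\<Prod>m<n. 1 - a^3 * (q^3) ^ m)" for n
    using cube_factor[OF assms(2), of "a * q ^ m" for m]
    by (simp add: power_mult_distrib mult.assoc flip: prod.distrib power_mult) (simp add: mult.commute)
  ultimately show ?thesis using qp_LIMSEQ[OF *, of "a^3"] LIMSEQ_unique by auto
qed

text \<open>Dominated convergence for unordered sums: the majorant makes the finite partial sums
  converge uniformly in n (M-test), so the two limits may be exchanged.\<close>

lemma tannery_infsum:
  fixes f :: "nat \<Rightarrow> 'a \<Rightarrow> complex"
  assumes lim: "\<And>k. k \<in> A \<Longrightarrow> (\<lambda>n. f n k) \<longlonglongrightarrow> g k"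
    and bound: "\<And>n k. k \<in> A \<Longrightarrow> norm (f n k) \<le> M k"
    and M: "M summable_on A"
  shows "g summable_on A" "(\<lambda>n. infsum (f n) A) \<longlonglongrightarrow> infsum g A"
proof -
  have "norm (g k) \<le> M k" if "k \<in> A" for k
    using tendsto_norm[OF lim[OF that]] by (rule LIMSEQ_le_const2) (use bound that in auto)
  hence "(\<lambda>k. norm (g k)) summable_on A"
    using Infinite_Sum.abs_summable_on_comparison_test'[OF M] by blast
  thus g: "g summable_on A" by (rule abs_summable_summable)
  have "uniform_limit UNIV (\<lambda>X n. \<Sum>k\<in>X. f n k) (\<lambda>n. infsum (f n) A) (finite_subsets_at_top A)"
    by (rule Weierstrass_m_test_general[OF _ M]) (use bound in auto)
  moreover have "\<forall>\<^sub>F X in finite_subsets_at_top A. (\<lambda>n. \<Sum>k\<in>X. f n k) \<longlonglongrightarrow> (\<Sum>k\<in>X. g k)"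
    unfolding eventually_finite_subsets_at_top
    by (rule exI[of _ "{}"]) (auto intro!: tendsto_sum lim)
  ultimately show "(\<lambda>n. infsum (f n) A) \<longlonglongrightarrow> infsum g A"
    by (intro swap_uniform_limit'[OF _ infsum_tendsto[OF g]]) auto
qed

section \<open>Bilateral series with triangular exponents\<close>

lemma summable_on_int:
  fixes f :: "int \<Rightarrow> 'a :: {uniform_topological_group_add, topological_comm_monoid_add, ab_group_add, complete_uniform_space}"
  assumes "(\<lambda>n. f (int n)) summable_on UNIV" "(\<lambda>n. f (- int n)) summable_on UNIV"
  shows "f summable_on UNIV"
proof -
  have "f summable_on (range int)" "f summable_on (range (\<lambda>n. - int n))"
    using assms by (auto simp: summable_on_reindex inj_def o_def)
  hence "f summable_on (range int \<union> range (\<lambda>n. - int n))" by (rule summable_on_union)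
  also have "range int \<union> range (\<lambda>n. - int n) = UNIV"
  proof (intro equalityI subsetI UNIV_I)
    fix k :: int
    show "k \<in> range int \<union> range (\<lambda>n. - int n)" by (cases k rule: int_cases3) auto
  qed
  finally show ?thesis .
qed

text \<open>The exponent in Jacobi's triple product, on all integers. The numbers i(i+1)/2 of the
  class number count appear as \<open>tri (i + 1)\<close>.\<close>

definition tri :: "int \<Rightarrow> int" where "tri k = k * (k - 1) div 2"

lemma two_tri: "2 * tri k = k * (k - 1)"
proof -
  have "even (k * (k - 1))" by simp
  thus ?thesis unfolding tri_def by simp
qed

lemma tri_add: "tri (a + b) = tri a + tri b + a * b"
proof -
  have "2 * tri (a + b) = 2 * (tri a + tri b + a * b)"
    using two_tri[of "a + b"] two_tri[of a] two_tri[of b] by (simp add: algebra_simps)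
  thus ?thesis by simp
qed

lemma tri_minus: "tri (- k) = tri k + k"
proof -
  have "2 * tri (- k) = 2 * (tri k + k)"
    using two_tri[of k] two_tri[of "- k"] by (simp add: algebra_simps)
  thus ?thesis by simp
qed

lemma tri_simps [simp]: "tri 0 = 0" "tri 1 = 0" "tri 2 = 1" "tri (-1) = 1" by (simp_all add: tri_def)

lemma tri_nonneg: "tri k \<ge> 0"
proof -
  have "k * (k - 1) \<ge> 0" by (cases "k \<le> 0") (auto intro: mult_nonneg_nonneg mult_nonpos_nonpos)
  thus ?thesis using two_tri[of k] by linarith
qed

lemma tri_Suc: "tri (k + 1) = tri k + k" by (simp add: tri_add)

lemma tri_mono: "0 \<le> a \<Longrightarrow> a \<le> b \<Longrightarrow> tri a \<le> tri b"
  using tri_add[of a "b - a"] tri_nonneg[of "b - a"] by simp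

text \<open>k(k-1) is symmetric about 1/2. This symmetry later pairs residue classes of a theta
  series and reorders the terms of \<open>pp\<close>.\<close>

lemma tri_reflect: "tri (1 - x) = tri x"
  using tri_Suc[of "- x"] by (simp add: tri_minus)

text \<open>Consecutive terms have ratio r^n y, which tends to 0 however large y is.\<close>

lemma summable_tri_nat:
  fixes r y :: real
  assumes "0 < r" "r < 1" "0 < y"
  shows "(\<lambda>n. r powi tri (int n) * y ^ n) summable_on UNIV"
proof -
  have "(\<lambda>n. r ^ n * y) \<longlonglongrightarrow> 0 * y" by (intro tendsto_intros LIMSEQ_realpow_zero) (use assms in auto)
  hence "\<forall>\<^sub>F n in sequentially. r ^ n * y < 1/2" by (rule order_tendstoD) auto
  then obtain N where N: "\<And>n. n \<ge> N \<Longrightarrow> r ^ n * y < 1/2" by (auto simp: eventually_sequentially)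
  have "summable (\<lambda>n. r powi tri (int n) * y ^ n)"
  proof (rule summable_ratio_test[of "1/2" N])
    fix n assume n: "N \<le> n"
    have "r powi tri (int (Suc n)) * y ^ Suc n = (r ^ n * y) * (r powi tri (int n) * y ^ n)"
      using assms tri_Suc[of "int n"] by (simp add: power_int_add add.commute[of 1])
    also have "\<dots> \<le> 1/2 * (r powi tri (int n) * y ^ n)"
      using N[OF n] assms by (intro mult_right_mono) auto
    finally show "norm (r powi tri (int (Suc n)) * y ^ Suc n) \<le> 1/2 * norm (r powi tri (int n) * y ^ n)"
      using assms by simp
  qed simp
  thus ?thesis using assms by (intro summable_nonneg_imp_summable_on) auto
qed

lemma summable_tri:
  fixes r y :: real
  assumes "0 < r" "r < 1" "0 < y"
  shows "(\<lambda>k. r powi tri k * y powi k) summable_on UNIV"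
proof (rule summable_on_int)
  show "(\<lambda>n. r powi tri (int n) * y powi (int n)) summable_on UNIV"
    using summable_tri_nat[OF assms] by simp
  have "(\<lambda>n. r powi tri (int n) * (r / y) ^ n) summable_on UNIV"
    by (intro summable_tri_nat) (use assms in auto)
  thus "(\<lambda>n. r powi tri (- int n) * y powi (- int n)) summable_on UNIV"
    using assms by (simp add: tri_minus power_int_add power_int_minus field_simps)
qed

text \<open>The theta function (x; p)(p/x; p)(p; p) with infinite q-Pochhammer symbols, normalised
  so that the triple product has no extra factor.\<close>

definition jt :: "complex \<Rightarrow> complex \<Rightarrow> complex" where
  "jt x p = qp x p * qp (p / x) p * qp p p"

text \<open>The value 0 at negative \<open>m\<close> is forced by the recurrence \<open>ic_rec\<close>.\<close>

definition ic :: "complex \<Rightarrow> int \<Rightarrow> complex" where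
  "ic p m = (if m < 0 then 0 else 1 / (\<Prod>i<nat m. 1 - p * p ^ i))"

lemma ic_rec:
  assumes "norm p < 1" "p \<noteq> 0"
  shows "ic p (m - 1) = (1 - p powi m) * ic p m"
proof -
  consider "m < 0" | "m = 0" | n where "m = int (Suc n)"
    by (metis int_cases3 not_less_iff_gr_or_eq not0_implies_Suc of_nat_0 zero_less_imp_eq_int)
  thus ?thesis
  proof cases
    case 3
    have "p * p ^ n \<noteq> 1" using power_neq_1[of p "Suc n"] assms by auto
    thus ?thesis using 3 by (simp add: ic_def nat_add_distrib power_int_add_1 add.commute[of 1] flip: of_nat_Suc) (simp add: power_int_def nat_add_distrib mult.commute)
  qed (auto simp: ic_def)
qed

lemma ic_LIMSEQ:
  assumes "norm p < 1"
  shows "(\<lambda>n. ic p (int n + k)) \<longlonglongrightarrow> 1 / qp p p"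
proof -
  have "filterlim (\<lambda>n. nat (int n + k)) at_top sequentially"
    unfolding filterlim_at_top eventually_sequentially
    by (rule allI, rule_tac x = "nat (int Z - k)" in exI) auto
  hence "(\<lambda>n. 1 / (\<Prod>i<nat (int n + k). 1 - p * p ^ i)) \<longlonglongrightarrow> 1 / qp p p"
    by (intro tendsto_intros filterlim_compose[OF qp_LIMSEQ] assms qp_self_nonzero)
  moreover have "\<forall>\<^sub>F n in sequentially. ic p (int n + k) = 1 / (\<Prod>i<nat (int n + k). 1 - p * p ^ i)"
    unfolding eventually_sequentially by (rule exI[of _ "nat (- k)"]) (auto simp: ic_def)
  ultimately show ?thesis by (simp add: filterlim_cong)
qed

lemma ic_bounded:
  assumes "norm p < 1"
  obtains B where "B > 0" "\<And>m. norm (ic p m) \<le> B"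
proof -
  have "Bseq (\<lambda>n. ic p (int n + 0))"
    using ic_LIMSEQ[OF assms] convergent_imp_Bseq convergentI by blast
  then obtain B where B: "B > 0" "\<And>n. norm (ic p (int n)) \<le> B" unfolding Bseq_def by auto
  have "norm (ic p m) \<le> B" for m
    using B(1) B(2)[of "nat m"] by (cases "m < 0") (auto simp: ic_def)
  thus ?thesis using B(1) that by blast
qed

lemma sum_int_shift:
  fixes f :: "int \<Rightarrow> 'a :: comm_monoid_add"
  shows "(\<Sum>k\<in>{a..b}. f (k + c)) = (\<Sum>k\<in>{a+c..b+c}. f k)"
  by (rule sum.reindex_bij_witness[of _ "\<lambda>k. k - c" "\<lambda>k. k + c"]) auto

text \<open>This is the q-binomial theorem for 2n factors in symmetric form: (p; p)_2n times the two
  \<open>ic\<close> is a Gaussian binomial coefficient. Passing to n + 1 multiplies the product by 1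
  + p^(2n+1) - x p^n - (p/x) p^n; the last two summands shift k by one, and comparing coefficients
  of x^k leaves a polynomial identity.\<close>

lemma finite_jtp:
  assumes p: "norm p < 1" "p \<noteq> 0" and x: "x \<noteq> 0"
  shows "(\<Prod>k<n. (1 - x * p ^ k) * (1 - (p / x) * p ^ k)) =
    (\<Prod>i<2*n. 1 - p * p ^ i) *
      (\<Sum>k\<in>{-int n..int n}. p powi tri k * (- x) powi k * (ic p (int n - k) * ic p (int n + k)))"
proof (induction n)
  case 0
  show ?case by (simp add: ic_def)
next
  case (Suc n)
  define c where "c = (\<lambda>k. p powi tri k * (- x) powi k)"
  define B where "B = (\<lambda>n k. c k * (ic p (n - k) * ic p (n + k)))"
  define I where "I = {- int (Suc n)..int (Suc n)}"
  define P where "P = (\<Prod>i<2*n. 1 - p * p ^ i)"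
  \<comment> \<open>Since tri k - tri (k - 1) = k - 1, shifting k costs exactly the power of p that
    also occurs in the recurrence of \<open>ic\<close>.\<close>
  have c1: "c k * p powi (int n + 1 - k) = - x * p ^ n * c (k - 1)" for k
  proof -
    have "tri k = tri (k - 1) + (k - 1)" using tri_Suc[of "k - 1"] by simp
    hence t: "tri k + (int n + 1 - k) = tri (k - 1) + int n" by simp
    moreover have "(- x) powi k = (- x) * (- x) powi (k - 1)"
      using x power_int_add_1[of "- x" "k - 1"] by simp
    moreover have "p powi tri k * p powi (int n + 1 - k) = p ^ n * p powi tri (k - 1)"
      unfolding power_int_add[OF disjI1[OF p(2)], symmetric] t
      using p power_int_add[of p "tri (k - 1)" "int n"] by simp
    ultimately show ?thesis by (simp add: c_def mult_ac)
  qed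
  have c2: "c k * p powi (int n + 1 + k) = - (p / x) * p ^ n * c (k + 1)" for k
  proof -
    have t: "tri k + (int n + 1 + k) = tri (k + 1) + int (Suc n)" by (simp add: tri_Suc)
    moreover have "(- x) powi k * (- x) = (- x) powi (k + 1)"
      using x by (simp add: power_int_add_1 del: mult_minus_right)
    hence "(- x) powi k = (- 1 / x) * (- x) powi (k + 1)"
      using x by (simp add: divide_simps) (metis mult.commute mult_minus_right add.inverse_inverse)
    moreover have "p powi tri k * p powi (int n + 1 + k) = p ^ Suc n * p powi tri (k + 1)"
      using p t power_int_add[of p "tri (k + 1)" "int (Suc n)"] power_int_add[of p "tri k" "int n + 1 + k"]
      by (simp add: mult_ac del: of_nat_Suc power_Suc)
    ultimately show ?thesis by (simp add: c_def mult_ac)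
  qed
  have step: "(1 - p * p ^ (2*n)) * (1 - p * p ^ Suc (2*n)) * B (int (Suc n)) k =
      (1 + p * p ^ (2*n)) * B (int n) k - x * p ^ n * B (int n) (k - 1) - (p / x) * p ^ n * B (int n) (k + 1)" for k
  proof -
    define X where "X = ic p (int n + 1 - k)"
    define Y where "Y = ic p (int n + 1 + k)"
    define \<alpha> where "\<alpha> = p powi (int n + 1 - k)"
    define \<beta> where "\<beta> = p powi (int n + 1 + k)"
    have \<alpha>': "p powi (int n - k) = \<alpha> / p" and \<beta>': "p powi (int n + k) = \<beta> / p"
      using p by (simp_all add: \<alpha>_def \<beta>_def power_int_add power_int_diff)
    have i1: "ic p (int n - k) = (1 - \<alpha>) * X" and i2: "ic p (int n + k) = (1 - \<beta>) * Y"
      using ic_rec[OF p, of "int n + 1 - k"] ic_rec[OF p, of "int n + 1 + k"]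
      by (simp_all add: X_def Y_def \<alpha>_def \<beta>_def algebra_simps)
    have i3: "ic p (int n - (k + 1)) = (1 - \<alpha> / p) * (1 - \<alpha>) * X"
      using ic_rec[OF p, of "int n - k"] by (simp only: i1 \<alpha>' diff_diff_eq mult.assoc)
    have i4: "ic p (int n + (k - 1)) = (1 - \<beta> / p) * (1 - \<beta>) * Y"
      using ic_rec[OF p, of "int n + k"] by (simp only: i2 \<beta>' add_diff_eq mult.assoc)
    have i5: "ic p (int n + (k + 1)) = Y" "ic p (int n - (k - 1)) = X"
      by (simp_all add: X_def Y_def algebra_simps)
    have \<alpha>\<beta>: "\<alpha> * \<beta> = p * p * p ^ (2 * n)"
    proof -
      have "\<alpha> * \<beta> = p powi (int (2 * n + 2))" unfolding \<alpha>_def \<beta>_def using p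
        by (simp add: add.commute flip: power_int_add)
      thus ?thesis by (simp only: power_int_of_nat) (simp add: power_add power2_eq_square)
    qed
    have e1: "- x * p ^ n * B (int n) (k - 1) = c k * (\<alpha> * ((1 - \<beta> / p) * (1 - \<beta>)) * (X * Y))"
    proof -
      have "- x * p ^ n * B (int n) (k - 1) = (- x * p ^ n * c (k - 1)) * ((1 - \<beta> / p) * (1 - \<beta>) * (X * Y))"
        by (simp add: B_def i4 i5 mult_ac)
      thus ?thesis unfolding c1[symmetric] \<alpha>_def by (simp only: mult_ac)
    qed
    have e2: "- (p / x) * p ^ n * B (int n) (k + 1) = c k * (\<beta> * ((1 - \<alpha> / p) * (1 - \<alpha>)) * (X * Y))"
    proof -
      have "- (p / x) * p ^ n * B (int n) (k + 1) = (- (p / x) * p ^ n * c (k + 1)) * ((1 - \<alpha> / p) * (1 - \<alpha>) * (X * Y))"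
        by (simp add: B_def i3 i5 mult_ac)
      thus ?thesis unfolding c2[symmetric] \<beta>_def by (simp only: mult_ac)
    qed
    have pn: "p * p ^ (2*n) = \<alpha> * \<beta> / p" "p * p ^ Suc (2*n) = \<alpha> * \<beta>" using \<alpha>\<beta> p by simp_all
    have "B (int (Suc n)) k = c k * (X * Y)" by (simp add: B_def X_def Y_def algebra_simps)
    moreover have "B (int n) k = c k * ((1 - \<alpha>) * (1 - \<beta>) * (X * Y))" by (simp add: B_def i1 i2 mult_ac)
    \<comment> \<open>The whole induction step reduces to this identity, in which
      \<open>\<alpha> * \<beta> / p\<close> stands for p^(2n+1).\<close>
    moreover have "(1 - \<alpha> * \<beta> / p) * (1 - \<alpha> * \<beta>) = (1 + \<alpha> * \<beta> / p) * ((1 - \<alpha>) * (1 - \<beta>)) +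
        \<alpha> * ((1 - \<beta> / p) * (1 - \<beta>)) + \<beta> * ((1 - \<alpha> / p) * (1 - \<alpha>))"
      using p by (simp add: field_simps)
    moreover have "(1 + u) * (c k * (P1 * (X * Y))) + c k * (P2 * (X * Y)) + c k * (P3 * (X * Y))
        = ((1 + u) * P1 + P2 + P3) * (c k * (X * Y))" for u P1 P2 P3
      by (simp add: algebra_simps)
    moreover have "a - x * p ^ n * b - (p / x) * p ^ n * d = a + (- x * p ^ n * b) + (- (p / x) * p ^ n * d)" for a b d
      by simp
    ultimately show ?thesis unfolding pn by (simp only: e1 e2)
  qed
  have B0: "B (int n) k = 0" if "k \<notin> {-int n..int n}" for k
    using that by (auto simp: B_def ic_def)
  have s: "(\<Sum>k\<in>I. B (int n) (k + d)) = (\<Sum>k\<in>{-int n..int n}. B (int n) k)" if "\<bar>d\<bar> \<le> 1" for d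
    unfolding I_def sum_int_shift
    by (rule sum.mono_neutral_right) (use that B0 in auto)
  have "(\<Prod>i<2*Suc n. 1 - p * p ^ i) * (\<Sum>k\<in>I. B (int (Suc n)) k) =
     P * (\<Sum>k\<in>I. (1 - p * p ^ (2*n)) * (1 - p * p ^ Suc (2*n)) * B (int (Suc n)) k)"
    unfolding sum_distrib_left[symmetric] by (simp add: P_def mult_ac)
  also have "\<dots> = P * ((1 + p * p ^ (2*n)) * (\<Sum>k\<in>I. B (int n) (k + 0))
       - x * p ^ n * (\<Sum>k\<in>I. B (int n) (k + (-1))) - (p / x) * p ^ n * (\<Sum>k\<in>I. B (int n) (k + 1)))"
    unfolding step by (simp add: sum_distrib_left sum_subtractf)
  also have "\<dots> = (P * (\<Sum>k\<in>{-int n..int n}. B (int n) k)) *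
       ((1 + p * p ^ (2*n)) - x * p ^ n - (p / x) * p ^ n)"
    by (subst (1 2 3) s) (simp_all add: algebra_simps)
  also have "(1 + p * p ^ (2*n)) - x * p ^ n - (p / x) * p ^ n = (1 - x * p ^ n) * (1 - (p / x) * p ^ n)"
    using x by (simp add: field_simps power_mult power2_eq_square power_mult_distrib mult_2 power_add)
  also have "P * (\<Sum>k\<in>{-int n..int n}. B (int n) k) = (\<Prod>k<n. (1 - x * p ^ k) * (1 - (p / x) * p ^ k))"
    using Suc by (simp add: P_def B_def c_def)
  finally show ?case by (simp add: I_def B_def c_def mult_ac)
qed

text \<open>The limit of \<open>finite_jtp\<close>: for fixed k both \<open>ic\<close> factors tend
  to 1/(p; p), they are uniformly bounded, and the series of \<open>summable_tri\<close> is the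
  majorant.\<close>

theorem jacobi_triple_product:
  assumes p: "norm p < 1" "p \<noteq> 0" and x: "x \<noteq> 0"
  shows "((\<lambda>k. p powi tri k * (- x) powi k) has_sum jt x p) UNIV"
proof -
  obtain B where B: "B > 0" "\<And>m. norm (ic p m) \<le> B" using ic_bounded[OF p(1)] by blast
  define f where "f = (\<lambda>n k. p powi tri k * (- x) powi k * (ic p (int n - k) * ic p (int n + k)))"
  define g where "g = (\<lambda>k. p powi tri k * (- x) powi k * (1 / qp p p * (1 / qp p p)))"
  define M where "M = (\<lambda>k. (norm p powi tri k * norm x powi k) * (B * B))"
  have lim: "(\<lambda>n. f n k) \<longlonglongrightarrow> g k" for k
    unfolding f_def g_def using ic_LIMSEQ[OF p(1), of "-k"] ic_LIMSEQ[OF p(1), of k]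
    by (intro tendsto_intros) simp_all
  have bound: "norm (f n k) \<le> M k" for n k
    unfolding f_def M_def norm_mult using B x
    by (intro mult_mono) (auto simp: norm_power_int intro!: mult_nonneg_nonneg zero_le_power_int)
  have M: "M summable_on UNIV"
    unfolding M_def by (intro summable_on_cmult_left summable_tri) (use p x in auto)
  have t: "g summable_on UNIV" "(\<lambda>n. infsum (f n) UNIV) \<longlonglongrightarrow> infsum g UNIV"
    using tannery_infsum[OF lim bound M] by auto
  have inf: "infsum (f n) UNIV = (\<Prod>k<n. 1 - x * p ^ k) * (\<Prod>k<n. 1 - (p / x) * p ^ k) / (\<Prod>i<2*n. 1 - p * p ^ i)" for n
  proof -
    have "infsum (f n) UNIV = infsum (f n) {-int n..int n}"
      by (rule infsum_cong_neutral) (auto simp: f_def ic_def)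
    moreover have "(\<Prod>i<2*n. 1 - p * p ^ i) \<noteq> 0"
      using power_neq_1[of p "Suc i" for i] p by auto
    ultimately show ?thesis
      using finite_jtp[OF p x, of n] by (simp add: f_def prod.distrib)
  qed
  have "(\<lambda>n. \<Prod>i<2*n. 1 - p * p ^ i) \<longlonglongrightarrow> qp p p"
    by (rule filterlim_compose[OF qp_LIMSEQ[OF p(1)]]) (auto intro!: filterlim_subseq simp: strict_mono_def)
  hence "(\<lambda>n. infsum (f n) UNIV) \<longlonglongrightarrow> qp x p * qp (p / x) p / qp p p"
    unfolding inf by (intro tendsto_intros qp_LIMSEQ p qp_self_nonzero)
  with t(2) have "infsum g UNIV = qp x p * qp (p / x) p / qp p p" using LIMSEQ_unique by blast
  with t(1) have "(g has_sum (qp x p * qp (p / x) p / qp p p)) UNIV" by (simp add: has_sum_iff)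
  hence "((\<lambda>k. g k * (qp p p * qp p p)) has_sum (qp x p * qp (p / x) p / qp p p * (qp p p * qp p p))) UNIV"
    by (rule has_sum_cmult_left)
  thus ?thesis using qp_self_nonzero[OF p(1)] by (simp add: g_def jt_def field_simps)
qed

lemma jt_nonzero:
  assumes p: "norm p < 1" "p \<noteq> 0" and x: "x \<noteq> 0" and nx: "\<And>m. x * p powi m \<noteq> 1"
  shows "jt x p \<noteq> 0"
proof -
  have "p / x * p ^ m \<noteq> 1" for m
  proof
    assume "p / x * p ^ m = 1"
    hence "x * p powi (- int (Suc m)) = 1"
      using p x by (simp add: power_int_minus divide_simps del: of_nat_Suc split: if_splits)
    with nx show False by blast
  qed
  moreover have "x * p ^ m \<noteq> 1" for m using nx[of "int m"] by simp
  ultimately have "qp x p \<noteq> 0" "qp (p / x) p \<noteq> 0" by (intro qp_nonzero p; blast)+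
  thus ?thesis unfolding jt_def using p qp_self_nonzero[of p] by simp
qed

text \<open>Quasi-periodicity of theta: multiplying x by p^n only shifts the index of its
  series.\<close>

lemma jt_shift:
  assumes p: "norm p < 1" "p \<noteq> 0" and x: "x \<noteq> 0"
  shows "jt (x * p powi n) p = p powi (- tri n) * (- x) powi (- n) * jt x p"
proof -
  have "((\<lambda>k. p powi (- tri n) * (- x) powi (- n) * (p powi tri k * (- x) powi k)) has_sum
           p powi (- tri n) * (- x) powi (- n) * jt x p) UNIV"
    by (intro has_sum_cmult_right jacobi_triple_product assms)
  also have "?this \<longleftrightarrow> ((\<lambda>k. p powi tri k * (- (x * p powi n)) powi k) has_sum
           p powi (- tri n) * (- x) powi (- n) * jt x p) UNIV"
  proof (rule has_sum_reindex_bij_witness[of _ "\<lambda>k. k + n" "\<lambda>k. k - n"])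
    fix k :: int
    have "tri k = tri (k - n) + tri n + (k - n) * n" using tri_add[of "k - n" n] by simp
    hence t: "tri (k - n) + n * (k - n) = tri k - tri n" by (simp add: algebra_simps)
    have "(- (x * p powi n)) powi (k - n) = (- x) powi (k - n) * p powi (n * (k - n))"
      by (simp add: power_int_mult flip: power_int_mult_distrib)
    hence "p powi tri (k - n) * (- (x * p powi n)) powi (k - n) = p powi (tri (k - n) + n * (k - n)) * (- x) powi (k - n)"
      using p by (simp add: power_int_add)
    also have "\<dots> = p powi (- tri n) * (- x) powi (- n) * (p powi tri k * (- x) powi k)"
      unfolding t using p x by (simp add: power_int_diff power_int_minus field_simps)
    finally show "p powi tri (k - n) * (- (x * p powi n)) powi (k - n) = p powi (- tri n) * (- x) powi (- n) * (p powi tri k * (- x) powi k)" .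
  qed auto
  finally show ?thesis using jacobi_triple_product[OF p, of "x * p powi n"] p x
    by (simp add: has_sum_iff)
qed

section \<open>Partial fractions and Kronecker's identity\<close>

text \<open>The reciprocal of the product is expanded over its simple poles y = p^(-m). In the
  induction, multiplying by the two new factors changes each fraction to the old one plus terms
  without a pole, and these sum to 0.\<close>

lemma finite_partial_fractions:
  assumes p: "norm p < 1" "p \<noteq> 0" and y: "y \<noteq> 0" and ny: "\<And>m. y * p powi m \<noteq> 1"
  shows "(\<Sum>m\<in>{-int n..int n}. (-1) powi m * p powi tri (m + 1) * (ic p (int n - m) * ic p (int n + m)) / (1 - y * p powi m))
     * ((\<Prod>k<Suc n. 1 - y * p ^ k) * (\<Prod>k<n. 1 - (p / y) * p ^ k)) = 1"
proof (induction n)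
  case 0
  show ?case using ny[of 0] by (simp add: ic_def)
next
  case (Suc n)
  define s where "s = (\<lambda>m. (-1) powi m * p powi tri (m + 1) :: complex)"
  define c where "c = (\<lambda>n m. s m * (ic p (int n - m) * ic p (int n + m)))"
  define I where "I = {- int (Suc n)..int (Suc n)}"
  define F where "F = (1 - y * p ^ Suc n) * (1 - (p / y) * p ^ n)"
  have P0: "(\<Prod>i<2*Suc n. 1 - p * p ^ i) \<noteq> 0"
    using power_neq_1[of p "Suc i" for i] p by (simp del: prod.lessThan_Suc)
  have tri1: "tri (m + 1) = tri m + m" for m by (rule tri_Suc)
  \<comment> \<open>\<open>finite_jtp\<close> at x = p has the vanishing factor 1 - p/p, so its sum
    side is 0. \<open>z2\<close> is the same at x = 1.\<close>
  have z1: "(\<Sum>m\<in>I. c (Suc n) m) = 0"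
  proof -
    have z: "(\<Prod>k<Suc n. (1 - p * p ^ k) * (1 - (p / p) * p ^ k)) = 0"
      using p by (subst prod_zero_iff) (auto intro!: bexI[of _ 0])
    hence "(\<Sum>m\<in>I. p powi tri m * (- p) powi m * (ic p (int (Suc n) - m) * ic p (int (Suc n) + m))) = 0"
      using finite_jtp[OF p p(2), of "Suc n", unfolded z, symmetric] P0
      unfolding I_def by (blast dest: mult_eq_0_iff[THEN iffD1])
    also have "(\<lambda>m. p powi tri m * (- p) powi m) = s"
    proof
      fix m
      have "(- p) powi m = (-1) powi m * p powi m" by (simp flip: power_int_mult_distrib)
      thus "p powi tri m * (- p) powi m = s m" using p by (simp add: s_def tri1 power_int_add)
    qed
    finally show ?thesis by (simp add: c_def fun_eq_iff)
  qed
  have z2: "(\<Sum>m\<in>I. c (Suc n) m * p powi (- m)) = 0"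
  proof -
    have z: "(\<Prod>k<Suc n. (1 - 1 * p ^ k) * (1 - (p / 1) * p ^ k)) = 0"
      using p by (subst prod_zero_iff) (auto intro!: bexI[of _ 0])
    hence "(\<Sum>m\<in>I. p powi tri m * (- 1) powi m * (ic p (int (Suc n) - m) * ic p (int (Suc n) + m))) = 0"
      using finite_jtp[OF p one_neq_zero, of "Suc n", unfolded z, symmetric] P0
      unfolding I_def by (blast dest: mult_eq_0_iff[THEN iffD1])
    also have "(\<lambda>m. p powi tri m * (- 1) powi m) = (\<lambda>m. s m * p powi (- m))"
      using p by (simp add: s_def fun_eq_iff tri1 power_int_add power_int_minus)
    finally show ?thesis by (simp add: c_def fun_eq_iff mult_ac)
  qed
  \<comment> \<open>The pole remains in the first summand only; summed over m, the bracket is a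
    combination of \<open>z1\<close> and \<open>z2\<close>.\<close>
  have step: "c (Suc n) m / (1 - y * p powi m) * F = c n m / (1 - y * p powi m)
       + (p ^ Suc n * (c (Suc n) m * p powi (- m)) - p ^ Suc n / y * c (Suc n) m)" for m
  proof -
    define M where "M = p powi m"
    define N where "N = p ^ Suc n"
    have M0: "M \<noteq> 0" "1 - y * M \<noteq> 0" using p ny[of m] by (auto simp: M_def)
    have a: "p powi (int (Suc n) - m) = N / M" "p powi (int (Suc n) + m) = N * M" "p powi (- m) = 1 / M"
      using p by (simp_all add: M_def N_def power_int_diff power_int_add power_int_minus field_simps del: of_nat_Suc power_Suc)
    have "ic p (int n - m) = (1 - N / M) * ic p (int (Suc n) - m)"
      using ic_rec[OF p, of "int (Suc n) - m"] unfolding a by (simp add: algebra_simps)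
    moreover have "ic p (int n + m) = (1 - N * M) * ic p (int (Suc n) + m)"
      using ic_rec[OF p, of "int (Suc n) + m"] unfolding a by (simp add: algebra_simps)
    ultimately have cn: "c n m = c (Suc n) m * ((1 - N / M) * (1 - N * M))" by (simp add: c_def mult_ac)
    have F: "F = (1 - y * N) * (1 - N / y)" by (simp add: F_def N_def)
    have "(1 - y * N) * (1 - N / y) = (1 - N / M) * (1 - N * M) + (N / M - N / y) * (1 - y * M)"
      using M0 y by (simp add: field_simps)
    hence "(1 - y * N) * (1 - N / y) / (1 - y * M) = (1 - N / M) * (1 - N * M) / (1 - y * M) + (N / M - N / y)"
      using M0 by (simp add: add_divide_distrib)
    hence "c (Suc n) m * ((1 - y * N) * (1 - N / y) / (1 - y * M))
        = c (Suc n) m * ((1 - N / M) * (1 - N * M) / (1 - y * M) + (N / M - N / y))" by simp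
    moreover have "u * P / D + (N * (u * (1 / M)) - N / y * u) = u * (P / D + (N / M - N / y))" for u P D
      by (simp add: algebra_simps)
    ultimately show ?thesis unfolding F a cn M_def[symmetric] N_def[symmetric]
      by (simp only: times_divide_eq_left times_divide_eq_right)
  qed
  have ic0: "c n m = 0" if "m \<notin> {-int n..int n}" for m using that by (auto simp: c_def ic_def)
  have "(\<Sum>m\<in>I. c (Suc n) m / (1 - y * p powi m)) * F = (\<Sum>m\<in>I. c n m / (1 - y * p powi m))
        + (p ^ Suc n * (\<Sum>m\<in>I. c (Suc n) m * p powi (- m)) - p ^ Suc n / y * (\<Sum>m\<in>I. c (Suc n) m))"
    by (simp only: sum_distrib_right step sum.distrib sum_subtractf sum_distrib_left)
  also have "\<dots> = (\<Sum>m\<in>I. c n m / (1 - y * p powi m))" unfolding z1 z2 by simp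
  also have "\<dots> = (\<Sum>m\<in>{-int n..int n}. c n m / (1 - y * p powi m))"
    by (rule sum.mono_neutral_right) (auto simp: I_def ic0)
  finally have *: "(\<Sum>m\<in>I. c (Suc n) m / (1 - y * p powi m)) * F = (\<Sum>m\<in>{-int n..int n}. c n m / (1 - y * p powi m))" .
  have "(\<Sum>m\<in>I. c (Suc n) m / (1 - y * p powi m)) * ((\<Prod>k<Suc (Suc n). 1 - y * p ^ k) * (\<Prod>k<Suc n. 1 - (p / y) * p ^ k))
     = (\<Sum>m\<in>I. c (Suc n) m / (1 - y * p powi m)) * F * ((\<Prod>k<Suc n. 1 - y * p ^ k) * (\<Prod>k<n. 1 - (p / y) * p ^ k))"
    unfolding F_def prod.lessThan_Suc[of _ "Suc n"] prod.lessThan_Suc[of "\<lambda>k. 1 - (p / y) * p ^ k" n]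
    by (simp only: mult_ac)
  also have "\<dots> = 1" unfolding * using Suc by (simp only: c_def s_def)
  finally show ?case by (simp only: I_def c_def s_def)
qed

text \<open>Both tails converge: for m = -n the fraction is p^n / (p^n - y), which tends to
  0.\<close>

lemma inverse_bounded_geometric:
  fixes y p :: complex
  assumes p: "norm p < 1" "p \<noteq> 0" and y: "y \<noteq> 0" and ny: "\<And>m. y * p powi m \<noteq> 1"
  obtains B where "B > 0" "\<And>m. norm (1 / (1 - y * p powi m)) \<le> B"
proof -
  have "(\<lambda>n. 1 / (1 - y * p ^ n)) \<longlonglongrightarrow> 1 / (1 - y * 0)"
    by (intro tendsto_intros LIMSEQ_power_zero p) auto
  hence "Bseq (\<lambda>n. 1 / (1 - y * p ^ n))" using convergent_imp_Bseq convergentI by blast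
  then obtain B1 where B1: "B1 > 0" "\<And>n. norm (1 / (1 - y * p ^ n)) \<le> B1" unfolding Bseq_def by auto
  have "(\<lambda>n. p ^ n / (p ^ n - y)) \<longlonglongrightarrow> 0 / (0 - y)"
    by (intro tendsto_intros LIMSEQ_power_zero p) (use y in auto)
  hence "Bseq (\<lambda>n. p ^ n / (p ^ n - y))" using convergent_imp_Bseq convergentI by blast
  then obtain B2 where B2: "B2 > 0" "\<And>n. norm (p ^ n / (p ^ n - y)) \<le> B2" unfolding Bseq_def by auto
  have eq: "1 / (1 - y * p powi (- int n)) = p ^ n / (p ^ n - y)" for n
    using p ny[of "- int n"] by (simp add: power_int_minus divide_simps)
  have "norm (1 / (1 - y * p powi m)) \<le> max B1 B2" for m
  proof (cases "m \<ge> 0")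
    case True
    thus ?thesis using B1(2)[of "nat m"] by (simp add: power_int_def)
  next
    case False
    hence "m = - int (nat (- m))" by simp
    thus ?thesis using B2(2)[of "nat (-m)"] eq[of "nat (-m)"] by (metis max.coboundedI2)
  qed
  thus ?thesis using that[of "max B1 B2"] B1 by auto
qed

text \<open>The finite expansion as n tends to infinity, by dominated convergence: 1/theta as a sum
  over its poles. Two of the three factors (p; p) come from the limits of \<open>ic\<close>, the
  third from \<open>jt\<close>.\<close>

lemma partial_fractions:
  assumes p: "norm p < 1" "p \<noteq> 0" and y: "y \<noteq> 0" and ny: "\<And>m. y * p powi m \<noteq> 1"
  shows "((\<lambda>m. (-1) powi m * p powi tri (m + 1) / (1 - y * p powi m)) has_sum (qp p p ^ 3 / jt y p)) UNIV"
proof -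
  obtain B where B: "B > 0" "\<And>m. norm (ic p m) \<le> B" using ic_bounded[OF p(1)] by blast
  obtain C where C: "C > 0" "\<And>m. norm (1 / (1 - y * p powi m)) \<le> C" using inverse_bounded_geometric[OF assms] by blast
  define f where "f = (\<lambda>n m. (-1) powi m * p powi tri (m + 1) * (ic p (int n - m) * ic p (int n + m)) / (1 - y * p powi m))"
  define g where "g = (\<lambda>m. (-1) powi m * p powi tri (m + 1) * (1 / qp p p * (1 / qp p p)) / (1 - y * p powi m))"
  define M where "M = (\<lambda>k. (norm p powi tri k * norm p powi k) * (B * B * C))"
  have lim: "(\<lambda>n. f n k) \<longlonglongrightarrow> g k" for k
    unfolding f_def g_def using ic_LIMSEQ[OF p(1), of "-k"] ic_LIMSEQ[OF p(1), of k] ny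
    by (intro tendsto_intros) simp_all
  have bound: "norm (f n k) \<le> M k" for n k
  proof -
    have "norm (f n k) = norm p powi tri (k + 1) * (norm (ic p (int n - k)) * norm (ic p (int n + k)) * norm (1 / (1 - y * p powi k)))"
      by (simp add: f_def norm_mult norm_divide norm_power_int)
    also have "\<dots> \<le> norm p powi tri (k + 1) * (B * B * C)"
      using B C by (intro mult_mono mult_nonneg_nonneg zero_le_power_int norm_ge_zero order.refl) auto
    also have "\<dots> = M k" unfolding M_def tri_Suc using p by (simp add: power_int_add)
    finally show ?thesis .
  qed
  have M: "M summable_on UNIV"
    unfolding M_def by (intro summable_on_cmult_left summable_tri) (use p in auto)
  have t: "g summable_on UNIV" "(\<lambda>n. infsum (f n) UNIV) \<longlonglongrightarrow> infsum g UNIV"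
    using tannery_infsum[OF lim bound M] by auto
  have ny1: "y * p ^ k \<noteq> 1" for k using ny[of "int k"] by simp
  have ny2: "p / y * p ^ k \<noteq> 1" for k
  proof
    assume "p / y * p ^ k = 1"
    hence "y * p powi (- int (Suc k)) = 1"
      using p y by (simp add: power_int_minus divide_simps del: of_nat_Suc split: if_splits)
    with ny show False by blast
  qed
  have inf: "infsum (f n) UNIV = 1 / ((\<Prod>k<Suc n. 1 - y * p ^ k) * (\<Prod>k<n. 1 - (p / y) * p ^ k))" for n
  proof -
    have "infsum (f n) UNIV = infsum (f n) {-int n..int n}"
      by (rule infsum_cong_neutral) (auto simp: f_def ic_def)
    also have "\<dots> = (\<Sum>m\<in>{-int n..int n}. f n m)" by simp
    finally have "infsum (f n) UNIV * ((\<Prod>k<Suc n. 1 - y * p ^ k) * (\<Prod>k<n. 1 - (p / y) * p ^ k)) = 1"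
      using finite_partial_fractions[OF assms, of n] by (simp add: f_def)
    moreover from this have "(\<Prod>k<Suc n. 1 - y * p ^ k) * (\<Prod>k<n. 1 - (p / y) * p ^ k) \<noteq> 0" by (metis mult_zero_right zero_neq_one)
    ultimately show ?thesis by (metis nonzero_eq_divide_eq)
  qed
  have nz: "qp y p \<noteq> 0" "qp (p / y) p \<noteq> 0" using ny1 ny2 by (intro qp_nonzero p; blast)+
  have "(\<lambda>n. \<Prod>k<Suc n. 1 - y * p ^ k) \<longlonglongrightarrow> qp y p"
    by (intro LIMSEQ_Suc qp_LIMSEQ p)
  hence "(\<lambda>n. infsum (f n) UNIV) \<longlonglongrightarrow> 1 / (qp y p * qp (p / y) p)"
    unfolding inf using nz by (intro tendsto_intros qp_LIMSEQ p) auto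
  with t(2) have "infsum g UNIV = 1 / (qp y p * qp (p / y) p)" using LIMSEQ_unique by blast
  with t(1) have "(g has_sum (1 / (qp y p * qp (p / y) p))) UNIV" by (simp add: has_sum_iff)
  hence "((\<lambda>k. g k * (qp p p * qp p p)) has_sum (1 / (qp y p * qp (p / y) p) * (qp p p * qp p p))) UNIV"
    by (rule has_sum_cmult_left)
  also have "(\<lambda>k. g k * (qp p p * qp p p)) = (\<lambda>m. (-1) powi m * p powi tri (m + 1) / (1 - y * p powi m))"
    using qp_self_nonzero[OF p(1)] by (simp add: g_def fun_eq_iff)
  also have "1 / (qp y p * qp (p / y) p) * (qp p p * qp p p) = qp p p ^ 3 / jt y p"
    using qp_self_nonzero[OF p(1)] nz by (simp add: jt_def field_simps power3_eq_cube)
  finally show ?thesis .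
qed

section \<open>Products of series and Kronecker's bilateral sum\<close>

lemma has_sum_times:
  fixes f :: "'a \<Rightarrow> complex" and g :: "'b \<Rightarrow> complex"
  assumes "(f has_sum S) A" "(g has_sum T) B"
  shows "((\<lambda>(a, b). f a * g b) has_sum (S * T)) (A \<times> B)"
proof (rule has_sum_SigmaI)
  show "((\<lambda>b. case (a, b) of (a, b) \<Rightarrow> f a * g b) has_sum (f a * T)) B" for a
    using has_sum_cmult_right[OF assms(2)] by simp
  show "((\<lambda>a. f a * T) has_sum (S * T)) A" by (rule has_sum_cmult_left[OF assms(1)])
  have f: "(\<lambda>a. norm (f a)) summable_on A" and g: "(\<lambda>b. norm (g b)) summable_on B"
    using assms by (auto simp: summable_on_iff_abs_summable_on_complex[symmetric] dest: has_sum_imp_summable)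
  have "(\<lambda>(a, b). norm (f a) * norm (g b)) summable_on A \<times> B"
    by (rule summable_on_SigmaI[where g = "\<lambda>a. norm (f a) * infsum (\<lambda>b. norm (g b)) B"])
       (auto intro!: has_sum_cmult_right summable_on_cmult_left f has_sum_infsum g)
  hence "(\<lambda>x. norm ((\<lambda>(a, b). f a * g b) x)) summable_on A \<times> B"
    by (simp add: case_prod_unfold norm_mult)
  thus "(\<lambda>(a, b). f a * g b) summable_on A \<times> B" by (rule abs_summable_summable)
qed

text \<open>Multiply the sum by the theta series of \<open>jt x p\<close> and collect the powers
  x^N: each inner sum is the partial fraction expansion at y p^N, and by \<open>jt_shift\<close> its
  value is a coefficient of the theta series at x y. The annulus |p| < |x| < 1 gives absolute
  convergence in both directions and keeps \<open>jt x p\<close> away from 0.\<close>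

lemma kronecker:
  assumes p: "p \<noteq> 0" and x: "norm p < norm x" "norm x < 1"
    and y: "y \<noteq> 0" and ny: "\<And>m. y * p powi m \<noteq> 1"
  shows "((\<lambda>n. x powi n / (1 - y * p powi n)) has_sum (qp p p ^ 3 * jt (x * y) p / (jt x p * jt y p))) UNIV"
proof -
  from x have p1: "norm p < 1" by linarith
  have x0: "x \<noteq> 0" using x(1) by auto
  obtain C where C: "C > 0" "\<And>m. norm (1 / (1 - y * p powi m)) \<le> C"
    using inverse_bounded_geometric[OF p1 p y ny] by blast
  define K where "K = (\<lambda>n. x powi n / (1 - y * p powi n))"
  have K: "K summable_on UNIV"
  proof (rule summable_on_int; rule abs_summable_summable)
    have "(\<lambda>n. norm x ^ n * C) summable_on UNIV"
      by (intro summable_on_cmult_left summable_nonneg_imp_summable_on summable_geometric) (use x in auto)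
    thus "(\<lambda>n. norm (K (int n))) summable_on UNIV"
    proof (rule Infinite_Sum.abs_summable_on_comparison_test')
      fix n
      have "norm (K (int n)) = norm x ^ n * norm (1 / (1 - y * p powi (int n)))"
        by (simp add: K_def norm_mult norm_divide norm_power)
      also have "\<dots> \<le> norm x ^ n * C" using C(2)[of "int n"] by (intro mult_left_mono) auto
      finally show "norm (K (int n)) \<le> norm x ^ n * C" .
    qed
  next
    obtain D where D: "D > 0" "\<And>m. norm (1 / (1 - (1 / y) * p powi m)) \<le> D"
    proof (rule inverse_bounded_geometric[OF p1 p, of "1 / y"])
      show "1 / y * p powi m \<noteq> 1" for m
      proof
        assume "1 / y * p powi m = 1"
        hence "y * p powi (- m) = 1" using y p by (simp add: power_int_minus field_simps)
        thus False using ny by blast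
      qed
    qed (use y in auto)
    have "(\<lambda>n. (norm p / norm x) ^ n * (D / norm y)) summable_on UNIV"
      by (intro summable_on_cmult_left summable_nonneg_imp_summable_on summable_geometric) (use x x0 in auto)
    thus "(\<lambda>n. norm (K (- int n))) summable_on UNIV"
    proof (rule Infinite_Sum.abs_summable_on_comparison_test')
      fix n
      have "K (- int n) = - ((p / x) ^ n * (1 / (1 - (1 / y) * p powi (int n))) * (1 / y))"
        using x0 p y ny[of "- int n"] by (simp add: K_def power_int_minus divide_simps) (simp add: algebra_simps)
      hence "norm (K (- int n)) = (norm p / norm x) ^ n * norm (1 / (1 - (1 / y) * p powi (int n))) * (1 / norm y)"
        by (simp add: norm_mult norm_divide norm_power)
      also have "\<dots> \<le> (norm p / norm x) ^ n * D * (1 / norm y)"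
        by (intro mult_mono mult_nonneg_nonneg D order.refl) (use D(1) in auto)
      finally show "norm (K (- int n)) \<le> (norm p / norm x) ^ n * (D / norm y)" by simp
    qed
  qed
  define S where "S = infsum K UNIV"
  have hK: "(K has_sum S) UNIV" using K by (simp add: S_def)
  have nx: "x * p powi m \<noteq> 1" for m
  proof
    assume "x * p powi m = 1"
    hence e: "norm x * norm p powi m = 1" by (metis norm_mult norm_one norm_power_int)
    show False
    proof (cases "m \<ge> 0")
      case True
      hence "norm p powi m \<le> 1" using p1 by (simp add: power_int_le_one)
      hence "norm x * norm p powi m \<le> norm x" by (simp add: mult_left_le)
      thus ?thesis using e x by simp
    next
      case False
      have "norm p powi m = norm p powi (m + 1) / norm p" using p by (simp add: power_int_add)
      moreover have "1 \<le> norm p powi (m + 1)"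
      proof -
        have "inverse (norm p powi (m + 1)) \<le> 1"
          unfolding power_int_minus[symmetric] using False p1 by (intro power_int_le_one) auto
        moreover have "norm p powi (m + 1) > 0" using p by simp
        ultimately show ?thesis by (auto simp: inverse_le_1_iff)
      qed
      ultimately have "1 / norm p \<le> norm p powi m" using p by (simp add: divide_simps)
      hence "norm x * (1 / norm p) \<le> 1" using e mult_left_mono[of "1 / norm p" "norm p powi m" "norm x"] by simp
      thus ?thesis using x p by (simp add: field_simps)
    qed
  qed
  have jx: "jt x p \<noteq> 0" and jy: "jt y p \<noteq> 0" by (intro jt_nonzero p1 p x0 y nx ny)+
  have "((\<lambda>(k, n). (p powi tri k * (- x) powi k) * K n) has_sum (jt x p * S)) (UNIV \<times> UNIV)"
    by (intro has_sum_times jacobi_triple_product p1 p x0 hK)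
  also have "?this \<longleftrightarrow> ((\<lambda>(N, m). x powi N * ((-1) powi m * p powi tri (m + 1) / (1 - (y * p powi N) * p powi m)))
                has_sum (jt x p * S)) (UNIV \<times> UNIV)"
  proof -
    have "x powi (k + n) * ((-1) powi (- k) * p powi tri (- k + 1) / (1 - (y * p powi (k + n)) * p powi (- k)))
             = p powi tri k * (- x) powi k * K n" for k n
    proof -
      have "tri (- k + 1) = tri k" using tri_Suc[of "-k"] by (simp add: tri_minus)
      moreover have "x powi (k + n) = x powi k * x powi n" using x0 by (simp add: power_int_add)
      moreover have "p powi (k + n) * p powi (- k) = p powi n"
        using p by (simp add: power_int_add power_int_minus)
      moreover have "(- x) powi k = (-1) powi k * x powi k" by (simp flip: power_int_mult_distrib)
      moreover have "(-1 :: complex) powi (- k) = (-1) powi k" by (simp add: power_int_minus flip: power_int_inverse)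
      ultimately show ?thesis unfolding mult.assoc[of y] by (simp only: K_def) (simp only: mult_ac times_divide_eq_right)
    qed
    thus ?thesis
      by (intro has_sum_reindex_bij_witness[of _ "\<lambda>(N, m). (- m, N + m)" "\<lambda>(k, n). (k + n, - k)"]) (auto simp: prod_eq_iff)
  qed
  finally have *: "((\<lambda>(N, m). x powi N * ((-1) powi m * p powi tri (m + 1) / (1 - (y * p powi N) * p powi m)))
                has_sum (jt x p * S)) (UNIV \<times> UNIV)" .
  have "((\<lambda>N. qp p p ^ 3 / jt y p * (p powi tri N * (- (x * y)) powi N)) has_sum (jt x p * S)) UNIV"
  proof (rule has_sum_SigmaD[OF *])
    fix N :: int
    have "((\<lambda>m. (-1) powi m * p powi tri (m + 1) / (1 - (y * p powi N) * p powi m)) has_sum (qp p p ^ 3 / jt (y * p powi N) p)) UNIV"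
      using ny[of "N + m" for m] y p by (intro partial_fractions p1) (auto simp: power_int_add mult.assoc)
    hence "((\<lambda>m. x powi N * ((-1) powi m * p powi tri (m + 1) / (1 - (y * p powi N) * p powi m))) has_sum
           (x powi N * (qp p p ^ 3 / jt (y * p powi N) p))) UNIV"
      by (rule has_sum_cmult_right)
    also have "x powi N * (qp p p ^ 3 / jt (y * p powi N) p) = qp p p ^ 3 / jt y p * (p powi tri N * (- (x * y)) powi N)"
    proof -
      have "(- (x * y)) powi N = x powi N * (- y) powi N" by (simp flip: power_int_mult_distrib)
      thus ?thesis using jy y p by (simp add: jt_shift[OF p1 p y] power_int_minus field_simps)
    qed
    finally show "((\<lambda>m. case (N, m) of (N, m) \<Rightarrow> x powi N * ((-1) powi m * p powi tri (m + 1) / (1 - (y * p powi N) * p powi m))) has_sum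
        (qp p p ^ 3 / jt y p * (p powi tri N * (- (x * y)) powi N))) UNIV" by simp
  qed
  moreover have "((\<lambda>N. qp p p ^ 3 / jt y p * (p powi tri N * (- (x * y)) powi N)) has_sum (qp p p ^ 3 / jt y p * jt (x * y) p)) UNIV"
    using x0 y by (intro has_sum_cmult_right jacobi_triple_product p1 p) auto
  ultimately have "jt x p * S = qp p p ^ 3 / jt y p * jt (x * y) p" by (rule has_sum_unique)
  hence "S = qp p p ^ 3 * jt (x * y) p / (jt x p * jt y p)" using jx jy by (simp add: field_simps)
  thus ?thesis using hK by (simp add: K_def)
qed

section \<open>Reduction of forms\<close>

lemma bqf_eqI:
  assumes "\<And>x y. bqf_eval f x y = bqf_eval g x y"
  shows "f = g"
proof -
  obtain a b c where f: "f = (a, b, c)" by (cases f)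
  obtain a' b' c' where g: "g = (a', b', c')" by (cases g)
  show ?thesis using assms[of 1 0] assms[of 0 1] assms[of 1 1] by (simp add: f g)
qed

text \<open>Substitution in coefficients. The outer coefficients are the values of f at the matrix
  columns (p, s) and (r, t), which is how parities and minima enter below.\<close>

definition bqf_subst :: "bqf \<Rightarrow> int \<Rightarrow> int \<Rightarrow> int \<Rightarrow> int \<Rightarrow> bqf" where
  "bqf_subst f p r s t = (bqf_eval f p s,
     (case f of (a, b, c) \<Rightarrow> 2 * a * p * r + b * (p * t + r * s) + 2 * c * s * t), bqf_eval f r t)"

lemma bqf_eval_subst: "bqf_eval (bqf_subst f p r s t) x y = bqf_eval f (p * x + r * y) (s * x + t * y)"
  by (cases f) (simp add: bqf_subst_def algebra_simps power2_eq_square)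

lemma bqf_disc_subst: "bqf_disc (bqf_subst f p r s t) = (p * t - r * s)\<^sup>2 * bqf_disc f"
  by (cases f) (simp add: bqf_subst_def algebra_simps power2_eq_square)

lemma bqf_equiv_iff: "(f, g) \<in> bqf_equiv \<longleftrightarrow> (\<exists>p r s t. p * t - r * s = 1 \<and> g = bqf_subst f p r s t)"
proof -
  have "g = bqf_subst f p r s t \<longleftrightarrow> (\<forall>x y. bqf_eval g x y = bqf_eval f (p * x + r * y) (s * x + t * y))" for p r s t
    by (auto simp: bqf_eval_subst intro: bqf_eqI)
  thus ?thesis by (simp add: bqf_equiv_def)
qed

lemma bqf_subst_subst:
  "bqf_subst (bqf_subst f p r s t) p' r' s' t' =
   bqf_subst f (p * p' + r * s') (p * r' + r * t') (s * p' + t * s') (s * r' + t * t')"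
  by (rule bqf_eqI) (simp add: bqf_eval_subst algebra_simps)

lemma bqf_subst_id: "bqf_subst f 1 0 0 1 = f"
  by (rule bqf_eqI) (simp add: bqf_eval_subst)

lemma bqf_equiv_equiv: "equiv UNIV bqf_equiv"
proof (rule equivI)
  show "refl bqf_equiv"
  proof (rule refl_onI)
    fix f
    show "(f, f) \<in> bqf_equiv" unfolding bqf_equiv_iff
      by (rule exI[of _ 1], rule exI[of _ 0], rule exI[of _ 0], rule exI[of _ 1]) (simp add: bqf_subst_id)
  qed
  show "sym bqf_equiv"
  proof (rule symI)
    fix f g assume "(f, g) \<in> bqf_equiv"
    then obtain p r s t where d: "p * t - r * s = 1" and g: "g = bqf_subst f p r s t"
      by (auto simp: bqf_equiv_iff)
    have "bqf_subst g t (-r) (-s) p = bqf_subst f 1 0 0 1"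
      using d unfolding g bqf_subst_subst by (simp add: algebra_simps)
    hence "f = bqf_subst g t (-r) (-s) p" by (simp add: bqf_subst_id)
    moreover have "t * p - (-r) * (-s) = 1" using d by (simp add: algebra_simps)
    ultimately show "(g, f) \<in> bqf_equiv" unfolding bqf_equiv_iff by blast
  qed
  show "trans bqf_equiv"
  proof (rule transI)
    fix f g h assume "(f, g) \<in> bqf_equiv" "(g, h) \<in> bqf_equiv"
    then obtain p r s t p' r' s' t' where *: "p * t - r * s = 1" "g = bqf_subst f p r s t"
      "p' * t' - r' * s' = 1" "h = bqf_subst g p' r' s' t'" by (auto simp: bqf_equiv_iff)
    have "(p * p' + r * s') * (s * r' + t * t') - (p * r' + r * t') * (s * p' + t * s')
        = (p * t - r * s) * (p' * t' - r' * s')" by (simp add: algebra_simps)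
    thus "(f, h) \<in> bqf_equiv" unfolding bqf_equiv_iff * bqf_subst_subst using * by (metis mult_1)
  qed
qed auto

lemma pos_def_subst:
  assumes "bqf_pos_def f" "p * t - r * s = 1"
  shows "bqf_pos_def (bqf_subst f p r s t)"
  unfolding bqf_pos_def_def bqf_eval_subst
proof (intro allI impI)
  fix x y :: int assume xy: "(x, y) \<noteq> (0, 0)"
  have "x = t * (p * x + r * y) - r * (s * x + t * y)" "y = p * (s * x + t * y) - s * (p * x + r * y)"
    using assms(2) by algebra+
  hence "(p * x + r * y, s * x + t * y) \<noteq> (0, 0)" using xy by auto
  thus "bqf_eval f (p * x + r * y) (s * x + t * y) > 0" using assms(1) unfolding bqf_pos_def_def by blast
qed

lemma pos_def_forms_subst:
  assumes "f \<in> pos_def_forms D" "p * t - r * s = 1"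
  shows "bqf_subst f p r s t \<in> pos_def_forms D"
  using assms pos_def_subst by (auto simp: pos_def_forms_def bqf_disc_subst)

text \<open>Completing the square: 4a f(x, y) = (2ax + by)^2 - D y^2.\<close>

lemma pos_def_formI:
  assumes "a > 0" "bqf_disc (a, b, c) < 0"
  shows "bqf_pos_def (a, b, c)"
  unfolding bqf_pos_def_def
proof (intro allI impI)
  fix x y :: int assume xy: "(x, y) \<noteq> (0, 0)"
  have *: "4 * a * bqf_eval (a, b, c) x y = (2 * a * x + b * y)\<^sup>2 + (- bqf_disc (a, b, c)) * y\<^sup>2"
    by (simp add: algebra_simps power2_eq_square)
  have "(2 * a * x + b * y)\<^sup>2 + (- bqf_disc (a, b, c)) * y\<^sup>2 > 0"
  proof (cases "y = 0")
    case True
    thus ?thesis using xy assms(1) by auto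
  next
    case False
    hence "(- bqf_disc (a, b, c)) * y\<^sup>2 > 0" using assms(2) by (intro mult_pos_pos) auto
    thus ?thesis by (smt (verit) zero_le_power2)
  qed
  hence "a * bqf_eval (a, b, c) x y > 0" using * by (metis mult.assoc zero_less_mult_iff zero_less_numeral not_numeral_less_zero)
  thus "bqf_eval (a, b, c) x y > 0" using assms(1) by (simp only: zero_less_mult_pos)
qed

text \<open>Not Gauss reduction: the outer coefficients are required to be even, which D = 1 mod 8
  makes possible, and only matrices that are the identity or the swap modulo 2 relate such forms.
  With e = 2i + 1 the bounds become i < 2A and i < 2C.\<close>

definition reduced_forms :: "int \<Rightarrow> bqf set" where
  "reduced_forms D = {(2 * A, - e, 2 * C) | A C e. 0 < A \<and> 0 < C \<and> 0 < e \<and> e < 4 * A \<and> e < 4 * C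
      \<and> e\<^sup>2 - 16 * A * C = D}"

lemma reduced_forms_pos_def: "D < 0 \<Longrightarrow> f \<in> reduced_forms D \<Longrightarrow> f \<in> pos_def_forms D"
  by (auto simp: reduced_forms_def pos_def_forms_def intro!: pos_def_formI)

text \<open>For D = 1 mod 8 the form splits modulo 2 into two distinct linear factors, so it is even
  at exactly two of the three nonzero vectors modulo 2. A matrix with these as columns makes both
  outer coefficients even.\<close>

lemma exists_even_outer:
  assumes D: "D mod 8 = 1" "D < 0" and f: "f \<in> pos_def_forms D"
  shows "\<exists>A b C. A > 0 \<and> C > 0 \<and> (f, (2 * A, b, 2 * C)) \<in> bqf_equiv"
proof -
  obtain a b c where abc: "f = (a, b, c)" by (cases f)
  have d: "b\<^sup>2 - 4 * a * c = D" using f by (simp add: pos_def_forms_def abc)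
  have "odd b"
  proof
    assume "even b"
    then obtain k where "b = 2 * k" by blast
    hence "D = 4 * (k\<^sup>2 - a * c)" using d by (simp add: power2_eq_square)
    thus False using D(1) by presburger
  qed
  then obtain k where k: "b = 2 * k + 1" by (auto elim: oddE)
  have "even (k * (k + 1))" by simp
  then obtain l where l: "k * (k + 1) = 2 * l" by blast
  have "D = 8 * l + 1 - 4 * (a * c)" using d l by (simp add: k power2_eq_square algebra_simps)
  moreover define w where "w = a * c"
  ultimately have "D = 8 * l + 1 - 4 * w" by simp
  hence "even w" using D(1) by presburger
  hence "even (a * c)" by (simp add: w_def)
  hence "even a \<or> even c" by simp
  have "\<exists>p r s t. p * t - r * s = 1 \<and> even (bqf_eval f p s) \<and> even (bqf_eval f r t)"
  proof -
    consider "even a" "even c" | "even a" "odd c" | "odd a" "even c" using \<open>even a \<or> even c\<close> by blast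
    thus ?thesis
    proof cases
      case 1
      thus ?thesis by (intro exI[of _ 1] exI[of _ 0]) (simp add: abc)
    next
      case 2
      thus ?thesis using \<open>odd b\<close>
        by (intro exI[of _ 1] exI[of _ 1] exI[of _ 0] exI[of _ 1]) (simp add: abc)
    next
      case 3
      thus ?thesis using \<open>odd b\<close>
        by (intro exI[of _ 1] exI[of _ 0] exI[of _ 1] exI[of _ 1]) (simp add: abc)
    qed
  qed
  then obtain p r s t where *: "p * t - r * s = 1" "even (bqf_eval f p s)" "even (bqf_eval f r t)" by blast
  define g where "g = bqf_subst f p r s t"
  have "g \<in> pos_def_forms D" using pos_def_forms_subst[OF f *(1)] by (simp add: g_def)
  hence pos: "bqf_eval g 1 0 > 0" "bqf_eval g 0 1 > 0" by (auto simp: pos_def_forms_def bqf_pos_def_def)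
  obtain A C where AC: "bqf_eval f p s = 2 * A" "bqf_eval f r t = 2 * C" using * by blast
  obtain b' where "g = (2 * A, b', 2 * C)" using AC by (simp add: g_def bqf_subst_def)
  moreover have "(f, g) \<in> bqf_equiv" unfolding bqf_equiv_iff g_def using *(1) by blast
  ultimately show ?thesis using pos by (intro exI[of _ A] exI[of _ b'] exI[of _ C]) auto
qed

text \<open>Descent on A + C. If e > 4A, replacing x by x + 2y keeps the outer coefficients even and
  lowers C to C + 4A - e, which stays positive since twice it is a value of the form; e > 4C is
  symmetric. Equality is excluded because e is odd.\<close>

lemma reduction_descent:
  fixes A C b :: int
  assumes D: "D mod 8 = 1" "D < 0"
  shows "A > 0 \<Longrightarrow> C > 0 \<Longrightarrow> b\<^sup>2 - 16 * A * C = D \<Longrightarrow> \<exists>g\<in>reduced_forms D. ((2 * A, b, 2 * C), g) \<in> bqf_equiv"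
proof (induction "nat (A + C)" arbitrary: A b C rule: less_induct)
  case (less A C b)
  have tr: "(f, h) \<in> bqf_equiv" if "(f, g) \<in> bqf_equiv" "(g, h) \<in> bqf_equiv" for f g h
    using bqf_equiv_equiv that by (auto simp: equiv_def dest: transD)
  have sub: "(f, bqf_subst f p r s t) \<in> bqf_equiv" if "p * t - r * s = 1" for f p r s t
    unfolding bqf_equiv_iff using that by blast
  have "odd b"
  proof
    assume "even b"
    then obtain k where "b = 2 * k" by blast
    hence "D = 4 * (k\<^sup>2 - 4 * A * C)" using less.prems by (simp add: power2_eq_square)
    thus False using D(1) by presburger
  qed
  have pd: "bqf_pos_def (2 * A, b, 2 * C)" using less.prems D by (intro pos_def_formI) auto
  have main: "\<exists>g\<in>reduced_forms D. ((2 * A, - e, 2 * C), g) \<in> bqf_equiv"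
    if e: "e > 0" "odd e" "e\<^sup>2 - 16 * A * C = D" "A > 0" "C > 0"
      and IH: "\<And>A' b' C'. nat (A' + C') < nat (A + C) \<Longrightarrow> A' > 0 \<Longrightarrow> C' > 0 \<Longrightarrow> b'\<^sup>2 - 16 * A' * C' = D \<Longrightarrow>
         \<exists>g\<in>reduced_forms D. ((2 * A', b', 2 * C'), g) \<in> bqf_equiv" for A C e :: int
  proof -
    have pd: "bqf_pos_def (2 * A, - e, 2 * C)" using e D by (intro pos_def_formI) auto
    consider "e < 4 * A" "e < 4 * C" | "e > 4 * A" | "e > 4 * C"
    proof -
      have "e \<noteq> 4 * A" "e \<noteq> 4 * C" using \<open>odd e\<close> by auto
      thus ?thesis using that by linarith
    qed
    thus ?thesis
    proof cases
      case 1
      have "(2 * A, - e, 2 * C) \<in> reduced_forms D" unfolding reduced_forms_def using 1 e by blast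
      thus ?thesis using sub[of 1 1 0 0 "(2 * A, - e, 2 * C)"] by (auto simp: bqf_subst_id)
    next
      case 2
      define C' where "C' = 4 * A - e + C"
      have eq: "bqf_subst (2 * A, - e, 2 * C) 1 2 0 1 = (2 * A, 8 * A - e, 2 * C')"
        by (simp add: bqf_subst_def C'_def)
      have "bqf_eval (2 * A, - e, 2 * C) 2 1 > 0"
        by (rule pd[unfolded bqf_pos_def_def, rule_format]) simp
      hence "C' > 0" by (simp add: C'_def)
      moreover have "(8 * A - e)\<^sup>2 - 16 * A * C' = D" using e(3) by (simp add: C'_def power2_eq_square algebra_simps)
      ultimately obtain g where "g \<in> reduced_forms D" "((2 * A, 8 * A - e, 2 * C'), g) \<in> bqf_equiv"
        using IH[of A C' "8 * A - e"] 2 e by (auto simp: C'_def)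
      moreover have "((2 * A, - e, 2 * C), (2 * A, 8 * A - e, 2 * C')) \<in> bqf_equiv"
        using sub[of 1 1 2 0 "(2 * A, - e, 2 * C)"] unfolding eq by simp
      ultimately show ?thesis using tr by blast
    next
      case 3
      define A' where "A' = A - e + 4 * C"
      have eq: "bqf_subst (2 * A, - e, 2 * C) 1 0 2 1 = (2 * A', 8 * C - e, 2 * C)"
        by (simp add: bqf_subst_def A'_def)
      have "bqf_eval (2 * A, - e, 2 * C) 1 2 > 0"
        by (rule pd[unfolded bqf_pos_def_def, rule_format]) simp
      hence "A' > 0" by (simp add: A'_def)
      moreover have "(8 * C - e)\<^sup>2 - 16 * A' * C = D" using e(3) by (simp add: A'_def power2_eq_square algebra_simps)
      ultimately obtain g where "g \<in> reduced_forms D" "((2 * A', 8 * C - e, 2 * C), g) \<in> bqf_equiv"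
        using IH[of A' C "8 * C - e"] 3 e by (auto simp: A'_def)
      moreover have "((2 * A, - e, 2 * C), (2 * A', 8 * C - e, 2 * C)) \<in> bqf_equiv"
        using sub[of 1 1 0 2 "(2 * A, - e, 2 * C)"] unfolding eq by simp
      ultimately show ?thesis using tr by blast
    qed
  qed
  show ?case
  proof (cases "b < 0")
    case True
    have "\<exists>g\<in>reduced_forms D. ((2 * A, - (- b), 2 * C), g) \<in> bqf_equiv"
      by (rule main) (use less True \<open>odd b\<close> in auto)
    thus ?thesis by simp
  next
    case False
    hence "b > 0" using \<open>odd b\<close> by (cases "b = 0") auto
    \<comment> \<open>A quarter turn makes a positive middle coefficient negative and exchanges the
      outer ones.\<close>
    have eq: "bqf_subst (2 * A, b, 2 * C) 0 (-1) 1 0 = (2 * C, - b, 2 * A)" by (simp add: bqf_subst_def)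
    have "\<exists>g\<in>reduced_forms D. ((2 * C, - b, 2 * A), g) \<in> bqf_equiv"
      by (rule main) (use less \<open>b > 0\<close> \<open>odd b\<close> in \<open>auto simp: algebra_simps\<close>)
    moreover have "((2 * A, b, 2 * C), (2 * C, - b, 2 * A)) \<in> bqf_equiv"
      using sub[of 0 0 "-1" 1 "(2 * A, b, 2 * C)"] unfolding eq by simp
    ultimately show ?thesis using tr by blast
  qed
qed

text \<open>Twice the form is (4A - e)x^2 + (4C - e)y^2 + e(x - y)^2. As x and x - y are odd, the
  first and last terms are at least 4A - e and e, with equality in total only at (1, 0) and (-1, 0).
  So 2A is the minimum over a parity class, hence an invariant.\<close>

lemma odd_even_minimum:
  fixes A C e x y :: int
  assumes "0 < e" "e < 4 * A" "e < 4 * C" "odd x" "even y"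
  shows "2 * A \<le> 2 * A * x\<^sup>2 - e * x * y + 2 * C * y\<^sup>2"
    and "2 * A * x\<^sup>2 - e * x * y + 2 * C * y\<^sup>2 = 2 * A \<Longrightarrow> \<bar>x\<bar> = 1 \<and> y = 0"
proof -
  define v where "v = 2 * A * x\<^sup>2 - e * x * y + 2 * C * y\<^sup>2"
  define U V W where "U = (4 * A - e) * x\<^sup>2" "V = (4 * C - e) * y\<^sup>2" "W = e * (x - y)\<^sup>2"
  have v: "2 * v = U + V + W"
    by (simp add: v_def U_V_W_def power2_eq_square algebra_simps)
  have sq: "z\<^sup>2 \<ge> 1" if "z \<noteq> 0" for z :: int using that by (simp add: int_one_le_iff_zero_less)
  have "x \<noteq> 0" "x - y \<noteq> 0" using assms by auto
  hence U: "4 * A - e \<le> U" and W: "e \<le> W"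
    using mult_left_mono[OF sq[of x], of "4 * A - e"] mult_left_mono[OF sq[of "x - y"], of e] assms
    by (simp_all add: U_V_W_def)
  have V: "0 \<le> V" using assms by (simp add: U_V_W_def)
  show "2 * A \<le> 2 * A * x\<^sup>2 - e * x * y + 2 * C * y\<^sup>2"
    unfolding v_def[symmetric] using v U V W by linarith
  assume "2 * A * x\<^sup>2 - e * x * y + 2 * C * y\<^sup>2 = 2 * A"
  hence "v = 2 * A" by (simp add: v_def)
  hence "V = 0" "U = 4 * A - e" using v U V W by linarith+
  hence "y = 0" "x\<^sup>2 = 1" using assms by (auto simp: U_V_W_def)
  thus "\<bar>x\<bar> = 1 \<and> y = 0" by (simp add: power2_eq_1_iff) auto
qed

text \<open>Evenness of the outer coefficients on both sides forces the matrix to be the identity or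
  the swap modulo 2. Outer coefficients, being minima over parity classes, are matched, and
  attaining the minimum makes the matrix diagonal or antidiagonal. The latter would give -e' = e
  with both positive.\<close>

lemma reduced_forms_unique:
  assumes D: "odd D" and f: "f \<in> reduced_forms D" and g: "g \<in> reduced_forms D" and fg: "(f, g) \<in> bqf_equiv"
  shows "f = g"
proof -
  obtain A C e where f': "f = (2 * A, - e, 2 * C)" "0 < e" "e < 4 * A" "e < 4 * C" "e\<^sup>2 - 16 * A * C = D"
    using f by (auto simp: reduced_forms_def)
  obtain A' C' e' where g': "g = (2 * A', - e', 2 * C')" "0 < e'" "e' < 4 * A'" "e' < 4 * C'" "e'\<^sup>2 - 16 * A' * C' = D"
    using g by (auto simp: reduced_forms_def)
  have "odd e"
  proof
    assume "even e"
    hence "even (e\<^sup>2 - 16 * A * C)" by simp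
    thus False using f'(5) D by simp
  qed
  obtain p r s t where d: "p * t - r * s = 1" and gs: "g = bqf_subst f p r s t"
    using fg by (auto simp: bqf_equiv_iff)
  have fs: "f = bqf_subst g t (-r) (-s) p"
  proof -
    have "bqf_subst g t (-r) (-s) p = bqf_subst f 1 0 0 1"
      using d unfolding gs bqf_subst_subst by (simp add: algebra_simps)
    thus ?thesis by (simp add: bqf_subst_id)
  qed
  have g1: "2 * A' = 2 * A * p\<^sup>2 - e * p * s + 2 * C * s\<^sup>2"
    and g3: "2 * C' = 2 * A * r\<^sup>2 - e * r * t + 2 * C * t\<^sup>2"
    and g2: "- e' = 4 * A * p * r - e * (p * t + r * s) + 4 * C * s * t"
    using gs by (simp_all add: f' g' bqf_subst_def)
  have f1: "2 * A = 2 * A' * t\<^sup>2 - e' * t * (-s) + 2 * C' * (-s)\<^sup>2"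
    and f3: "2 * C = 2 * A' * (-r)\<^sup>2 - e' * (-r) * p + 2 * C' * p\<^sup>2"
    using fs by (simp_all add: f' g' bqf_subst_def)
  have "even (2 * A * p\<^sup>2 - e * p * s + 2 * C * s\<^sup>2)" "even (2 * A * r\<^sup>2 - e * r * t + 2 * C * t\<^sup>2)"
    unfolding g1[symmetric] g3[symmetric] by simp_all
  hence "even p \<or> even s" "even r \<or> even t" using \<open>odd e\<close> by auto
  moreover have "odd (p * t - r * s)" using d by simp
  ultimately have "odd p \<and> even s \<and> even r \<and> odd t \<or> even p \<and> odd s \<and> odd r \<and> even t" by auto
  have g1': "2 * A' = 2 * C * s\<^sup>2 - e * s * p + 2 * A * p\<^sup>2" unfolding g1 by (simp add: mult_ac)
  have g3': "2 * C' = 2 * C * t\<^sup>2 - e * t * r + 2 * A * r\<^sup>2" unfolding g3 by (simp add: mult_ac)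
  have f1': "2 * A = 2 * C' * (-s)\<^sup>2 - e' * (-s) * t + 2 * A' * t\<^sup>2" unfolding f1 by (simp add: mult_ac)
  have f3': "2 * C = 2 * C' * p\<^sup>2 - e' * p * (-r) + 2 * A' * (-r)\<^sup>2" unfolding f3 by (simp add: mult_ac)
  note m = odd_even_minimum
  from \<open>odd p \<and> even s \<and> even r \<and> odd t \<or> even p \<and> odd s \<and> odd r \<and> even t\<close> show ?thesis
  proof
    assume 1: "odd p \<and> even s \<and> even r \<and> odd t"
    have "2 * A \<le> 2 * A'" unfolding g1 by (rule m(1)) (use 1 f'(2-4) in simp_all)
    moreover have "2 * A' \<le> 2 * A" unfolding f1 by (rule m(1)) (use 1 g'(2-4) in simp_all)
    ultimately have A: "A' = A" by simp
    have p: "\<bar>p\<bar> = 1 \<and> s = 0" by (rule m(2)[of e A C]) (use 1 f'(2-4) g1 A in simp_all)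
    have "2 * C \<le> 2 * C'" unfolding g3' by (rule m(1)) (use 1 f'(2-4) in simp_all)
    moreover have "2 * C' \<le> 2 * C" unfolding f3' by (rule m(1)) (use 1 g'(2-4) in simp_all)
    ultimately have C: "C' = C" by simp
    have "\<bar>t\<bar> = 1 \<and> r = 0" by (rule m(2)[of e C A]) (use 1 f'(2-4) g3' C in simp_all)
    hence "e' = e" using g2 d p by simp
    thus ?thesis using A C by (simp add: f'(1) g'(1))
  next
    assume 2: "even p \<and> odd s \<and> odd r \<and> even t"
    have "2 * C \<le> 2 * A'" unfolding g1' by (rule m(1)) (use 2 f'(2-4) in simp_all)
    moreover have "2 * A' \<le> 2 * C" unfolding f3 by (rule m(1)) (use 2 g'(2-4) in simp_all)
    ultimately have A: "A' = C" by simp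
    have p: "\<bar>s\<bar> = 1 \<and> p = 0" by (rule m(2)[of e C A]) (use 2 f'(2-4) g1' A in simp_all)
    have "2 * A \<le> 2 * C'" unfolding g3 by (rule m(1)) (use 2 f'(2-4) in simp_all)
    moreover have "2 * C' \<le> 2 * A" unfolding f1' by (rule m(1)) (use 2 g'(2-4) in simp_all)
    ultimately have C: "C' = A" by simp
    have "\<bar>r\<bar> = 1 \<and> t = 0" by (rule m(2)[of e A C]) (use 2 f'(2-4) g3 C in simp_all)
    moreover have "- r * s = 1" using d p by simp
    ultimately have "- e' = e" using g2 p by simp
    thus ?thesis using f'(2) g'(2) by simp
  qed
qed

text \<open>The exceptional forms have discriminants -4m^2 and -3m^2, never 1 modulo 8.\<close>

lemma class_weight_1:
  assumes D: "D mod 8 = 1" and C: "C \<in> form_classes D"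
  shows "class_weight C = 1"
proof -
  have sub: "C \<subseteq> pos_def_forms D" using C by (auto simp: form_classes_def quotient_def)
  have "m * m mod 8 \<in> {0, 1, 4}" for m :: int
  proof -
    have "m mod 8 \<in> {0,1,2,3,4,5,6,7}" by auto
    moreover have "m * m mod 8 = (m mod 8) * (m mod 8) mod 8" by (simp add: mod_simps)
    ultimately show ?thesis by auto
  qed
  hence sq: "m * m mod 8 = 0 \<or> m * m mod 8 = 1 \<or> m * m mod 8 = 4" for m :: int by auto
  have "(m, 0, m) \<notin> C" for m
  proof
    assume "(m, 0, m) \<in> C"
    hence "- (4 * (m * m)) = D" using sub by (auto simp: pos_def_forms_def)
    thus False using D by presburger
  qed
  moreover have "(m, m, m) \<notin> C" for m
  proof
    assume "(m, m, m) \<in> C"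
    hence "- 3 * (m * m) = D" using sub by (auto simp: pos_def_forms_def power2_eq_square)
    thus False using D sq[of m] by presburger
  qed
  ultimately show ?thesis by (simp add: class_weight_def)
qed

lemma reduced_forms_bij:
  assumes D: "D mod 8 = 1" "D < 0"
  shows "bij_betw (\<lambda>f. (bqf_equiv \<inter> pos_def_forms D \<times> pos_def_forms D) `` {f}) (reduced_forms D) (form_classes D)"
proof -
  define P where "P = pos_def_forms D"
  define R where "R = bqf_equiv \<inter> P \<times> P"
  have R: "equiv P R"
  proof (rule equivI)
    show "refl_on P R" "R \<subseteq> P \<times> P"
      using bqf_equiv_equiv by (auto simp: R_def equiv_def refl_on_def)
    show "sym R" using bqf_equiv_equiv unfolding R_def equiv_def by (intro symI) (auto dest: symD)
    show "trans R" using bqf_equiv_equiv unfolding R_def equiv_def by (intro transI) (blast dest: transD)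
  qed
  have sub: "reduced_forms D \<subseteq> P" using reduced_forms_pos_def[OF D(2)] by (auto simp: P_def)
  have "inj_on (\<lambda>f. R `` {f}) (reduced_forms D)"
  proof (rule inj_onI)
    fix f g assume fg: "f \<in> reduced_forms D" "g \<in> reduced_forms D" "R `` {f} = R `` {g}"
    hence "(f, g) \<in> R" using eq_equiv_class[OF _ R] sub by blast
    moreover have "odd D" using D by presburger
    ultimately show "f = g" using fg reduced_forms_unique by (auto simp: R_def)
  qed
  moreover have "(\<lambda>f. R `` {f}) ` reduced_forms D = P // R"
  proof (intro equalityI subsetI)
    fix X assume "X \<in> P // R"
    then obtain f where f: "f \<in> P" "X = R `` {f}" by (auto simp: quotient_def)
    obtain A b C where AC: "A > 0" "C > 0" "(f, (2 * A, b, 2 * C)) \<in> bqf_equiv"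
      using exists_even_outer[OF D] f(1) unfolding P_def by blast
    have "(2 * A, b, 2 * C) \<in> P"
      using AC(3) f(1) pos_def_forms_subst unfolding bqf_equiv_iff P_def by metis
    hence "b\<^sup>2 - 16 * A * C = D" by (simp add: P_def pos_def_forms_def)
    then obtain g where g: "g \<in> reduced_forms D" "((2 * A, b, 2 * C), g) \<in> bqf_equiv"
      using reduction_descent[OF D AC(1,2)] by blast
    have "(f, g) \<in> bqf_equiv" using AC(3) g(2) bqf_equiv_equiv by (auto simp: equiv_def dest: transD)
    hence "(f, g) \<in> R" using f(1) g(1) sub by (auto simp: R_def)
    hence "X = R `` {g}" using f(2) equiv_class_eq[OF R] by simp
    thus "X \<in> (\<lambda>f. R `` {f}) ` reduced_forms D" using g(1) by blast
  qed (use sub in \<open>auto simp: quotient_def\<close>)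
  ultimately show ?thesis unfolding bij_betw_def form_classes_def R_def P_def by blast
qed

text \<open>The reduced forms (2A, -(2i+1), 2C) of discriminant 1 - 8n: the equation is (2i+1)^2 -
  16AC = 1 - 8n divided by 8, and the strict bounds on i imply A, C > 0.\<close>

definition red_triples :: "nat \<Rightarrow> (nat \<times> nat \<times> nat) set" where
  "red_triples n = {(A, C, i). i < 2 * A \<and> i < 2 * C \<and> 2 * A * C = n + i * (i + 1) div 2}"

lemma hurwitz_class_number_eq_card:
  assumes n: "n > 0"
  shows "hurwitz_class_number (8 * n - 1) = card (red_triples n)"
proof -
  define D where "D = - int (8 * n - 1)"
  have Dn: "D = 1 - 8 * int n" using n by (simp add: D_def of_nat_diff)
  have "(1 - 8 * m) mod 8 = 1" for m :: int by presburger
  hence D: "D mod 8 = 1" "D < 0" unfolding Dn using n by simp_all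
  obtain k where k: "n = Suc k" using n by (cases n) auto
  have "8 * n - 1 = 4 * (2 * k + 1) + 3" by (simp add: k)
  hence "(8 * n - 1) mod 4 = 3" "8 * n - 1 \<noteq> 0" by presburger+
  hence "hurwitz_class_number (8 * n - 1) = (\<Sum>C\<in>form_classes D. class_weight C)"
    by (simp add: hurwitz_class_number_def D_def)
  also have "\<dots> = (\<Sum>C\<in>form_classes D. 1)"
    by (rule sum.cong) (use class_weight_1[OF D(1)] in auto)
  also have "\<dots> = card (form_classes D)" by simp
  also have "card (form_classes D) = card (reduced_forms D)"
    using bij_betw_same_card[OF reduced_forms_bij[OF D]] by simp
  also have "card (reduced_forms D) = card (red_triples n)"
  proof (rule sym, rule bij_betw_same_card)
    define h where "h = (\<lambda>(A, C, i). (2 * int A, - (2 * int i + 1), 2 * int C))"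
    have key: "(2 * int i + 1)\<^sup>2 - 16 * int A * int C = D \<longleftrightarrow> 2 * A * C = n + i * (i + 1) div 2" for A C i :: nat
    proof -
      have "even (i * (i + 1))" by simp
      then obtain j where j: "i * (i + 1) = 2 * j" by blast
      have "2 * A * C = n + i * (i + 1) div 2 \<longleftrightarrow> 4 * (A * C) = 2 * n + i * (i + 1)" unfolding j by auto
      also have "\<dots> \<longleftrightarrow> int (4 * (A * C)) = int (2 * n + i * (i + 1))" by (simp only: of_nat_eq_iff)
      also have "\<dots> \<longleftrightarrow> (2 * int i + 1)\<^sup>2 - 16 * int A * int C = D"
        by (auto simp: Dn power2_eq_square algebra_simps)
      finally show ?thesis by simp
    qed
    show "bij_betw h (red_triples n) (reduced_forms D)"
    proof (rule bij_betwI')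
      show "(h x = h y) = (x = y)" for x y by (auto simp: h_def split: prod.splits)
      show "h x \<in> reduced_forms D" if x: "x \<in> red_triples n" for x
      proof -
        obtain A C i where [simp]: "x = (A, C, i)" by (cases x)
        have "i < 2 * A" "i < 2 * C" "(2 * int i + 1)\<^sup>2 - 16 * int A * int C = D"
          using x key by (auto simp: red_triples_def)
        thus ?thesis unfolding reduced_forms_def h_def by (intro CollectI exI[of _ "int A"] exI[of _ "int C"] exI[of _ "2 * int i + 1"]) auto
      qed
      show "\<exists>x\<in>red_triples n. f = h x" if "f \<in> reduced_forms D" for f
      proof -
        obtain A C e where f: "f = (2 * A, - e, 2 * C)" "0 < A" "0 < C" "0 < e" "e < 4 * A" "e < 4 * C" "e\<^sup>2 - 16 * A * C = D"
          using \<open>f \<in> reduced_forms D\<close> by (auto simp: reduced_forms_def)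
        have "odd e"
        proof
          assume "even e"
          hence "even (e\<^sup>2 - 16 * A * C)" by simp
          thus False using f(7) D by presburger
        qed
        then obtain k where k: "e = 2 * k + 1" by (auto elim: oddE)
        define A' C' i where "A' = nat A" "C' = nat C" "i = nat k"
        have eqs: "A = int A'" "C = int C'" "k = int i" using f k by (simp_all add: A'_C'_i_def)
        have "(2 * int i + 1)\<^sup>2 - 16 * int A' * int C' = D" using f(7) by (simp add: k eqs)
        hence "2 * A' * C' = n + i * (i + 1) div 2" using key by blast
        moreover have "i < 2 * A'" "i < 2 * C'" using f by (simp_all add: k eqs)
        ultimately have "(A', C', i) \<in> red_triples n" by (simp add: red_triples_def)
        moreover have "f = h (A', C', i)" by (simp add: h_def f(1) k eqs)
        ultimately show ?thesis by blast
      qed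
    qed
  qed
  finally show ?thesis by simp
qed

section \<open>The generating function of the class numbers\<close>

locale nome =
  fixes q :: complex
  assumes q1: "norm q < 1" and q0: "q \<noteq> 0"
begin

text \<open>The value 1/2 at the pole keeps the reflection gam (-m) = 1 - gam m valid for all m. The
  recurrence gam m = 1 + q^(2m) gam m fails at m = 0 by exactly 1, and this is where the boundary
  terms below originate.\<close>

definition gam :: "int \<Rightarrow> complex" where
  "gam m = (if m = 0 then 1 / 2 else 1 / (1 - q powi (2 * m)))"

definition cc :: "int \<Rightarrow> int \<Rightarrow> complex" where
  "cc s t = gam (s - t) - gam (- s - t)"

definition pp :: "nat \<Rightarrow> complex" where
  "pp s = (\<Sum>i<2 * s. q powi (- tri (int i + 1)))"

text \<open>Here k stands for s = k + 1. The parameter t moves the pole of the kernel; at t = 0 the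
  kernel is (1 + q^(2s)) / (1 - q^(2s)), and its expansion counts the reduced triples.\<close>

definition h :: "nat \<Rightarrow> complex" where
  "h t = (\<Sum>\<^sub>\<infinity>k. q powi (2 * ((int k + 1)\<^sup>2 - (int t)\<^sup>2)) * pp (Suc k) * cc (int k + 1) (int t))"

lemma powi_ne_1: "m \<noteq> 0 \<Longrightarrow> q powi m \<noteq> 1"
  using powi_neq_1[OF q1 q0] by blast

lemma gam_minus: "gam (- m) = 1 - gam m"
proof (cases "m = 0")
  case False
  hence "q powi (2 * m) \<noteq> 1" by (intro powi_ne_1) auto
  thus ?thesis using False q0 by (simp add: gam_def power_int_minus field_simps)
qed (simp add: gam_def)

lemma gam_rec: "m \<noteq> 0 \<Longrightarrow> gam m = 1 + q powi (2 * m) * gam m"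
  using powi_ne_1[of "2 * m"] by (simp add: gam_def field_simps)

lemma gam_bounded: obtains B where "B \<ge> 1" "\<And>m. norm (gam m) \<le> B"
proof -
  have "(\<lambda>n. 1 / (1 - q\<^sup>2 ^ n)) \<longlonglongrightarrow> 1 / (1 - 0)"
    using q1 by (intro tendsto_intros LIMSEQ_power_zero) (auto simp: norm_power power_less_one_iff)
  hence "Bseq (\<lambda>n. 1 / (1 - q\<^sup>2 ^ n))" using convergent_imp_Bseq convergentI by blast
  then obtain B where B: "B > 0" "\<And>n. norm (1 / (1 - q\<^sup>2 ^ n)) \<le> B" unfolding Bseq_def by auto
  have 1: "norm (gam (int n)) \<le> B + 1" for n
  proof (cases "n = 0")
    case False
    have "q powi (2 * int n) = q\<^sup>2 ^ n" by (simp add: power_int_mult)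
    thus ?thesis using B(2)[of n] False by (simp add: gam_def)
  qed (use B in \<open>simp add: gam_def\<close>)
  have "norm (gam m) \<le> B + 2" for m
  proof (cases "m \<ge> 0")
    case True
    thus ?thesis using 1[of "nat m"] by simp
  next
    case False
    hence "m = - int (nat (- m))" by simp
    hence "gam m = 1 - gam (int (nat (- m)))" using gam_minus by metis
    also have "norm \<dots> \<le> norm (1 :: complex) + norm (gam (int (nat (- m))))" by (rule norm_triangle_ineq4)
    also have "\<dots> \<le> B + 2" using 1[of "nat (-m)"] by simp
    finally show ?thesis .
  qed
  thus ?thesis using that[of "B + 2"] B by auto
qed

text \<open>A telescoping certificate in s for the change from t to t + 1. The last summand handles
  the generic case; the step function (2, then 1 at k = t + 1, then 0) repairs s = t and s = t + 1,
  where \<open>gam 0\<close> occurs, and is normalised to vanish for large k so that the boundary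
  term of the Abel summation tends to 0.\<close>

definition Y :: "int \<Rightarrow> int \<Rightarrow> complex" where
  "Y t k = (if k \<le> t + 1 then 2 else 0) - (if k = t + 1 then 1 else 0)
     + q powi (2 * (k\<^sup>2 - k - t\<^sup>2 - t)) * (gam (k - 1 - t) - gam (k + t))"

lemma cc_telescope:
  assumes "s \<ge> 1" "t \<ge> 0"
  shows "q powi (2 * (s\<^sup>2 - (t + 1)\<^sup>2)) * cc s (t + 1) - q powi (2 * (s\<^sup>2 - t\<^sup>2)) * cc s t = Y t s - Y t (s + 1)"
proof -
  \<comment> \<open>In a = s - t and b = s + t all q-powers are monomials in \<open>A\<close>,
    \<open>B\<close>, \<open>E\<close>, \<open>Q\<close>, so the claim is a rational identity;
    \<open>gam 0\<close> enters only for a = 0 and a = 1.\<close>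
  define a b where "a = s - t" and "b = s + t"
  define A B E Q where "A = q powi (2 * a)" and "B = q powi (2 * b)" and "E = q powi (2 * (a * b))" and "Q = q\<^sup>2"
  have nz: "A \<noteq> 0" "B \<noteq> 0" "E \<noteq> 0" "Q \<noteq> 0" using q0 by (auto simp: A_def B_def E_def Q_def)
  have Q: "Q = q powi 2" by (simp add: Q_def)
  have "2 * (s\<^sup>2 - (t + 1)\<^sup>2) = (2 * (a * b) + 2 * a) - (2 * b + 2)"
    by (simp add: a_def b_def power2_eq_square algebra_simps)
  hence e1: "q powi (2 * (s\<^sup>2 - (t + 1)\<^sup>2)) = E * A / (B * Q)"
    unfolding A_def B_def E_def Q using q0 by (simp add: power_int_add power_int_diff)
  have e2: "q powi (2 * (s\<^sup>2 - t\<^sup>2)) = E"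
    and e3: "q powi (2 * (s\<^sup>2 - s - t\<^sup>2 - t)) = E / B"
    and e4: "q powi (2 * ((s + 1)\<^sup>2 - (s + 1) - t\<^sup>2 - t)) = E * A"
    unfolding A_def B_def E_def Q using q0
    by (simp_all add: a_def b_def power2_eq_square algebra_simps flip: power_int_add power_int_diff)
  have "- s - (t + 1) = - (b + 1)" "- s - t = - b" "s - (t + 1) = a - 1" "s - t = a" "s - 1 - t = a - 1"
    "s + t = b" "s + 1 - 1 - t = a" "s + 1 + t = b + 1" by (simp_all add: a_def b_def)
  hence g: "gam (s - (t + 1)) = gam (a - 1)" "gam (- s - (t + 1)) = 1 - gam (b + 1)" "gam (s - t) = gam a"
     "gam (- s - t) = 1 - gam b" "gam (s - 1 - t) = gam (a - 1)" "gam (s + t) = gam b"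
     "gam (s + 1 - 1 - t) = gam a" "gam (s + 1 + t) = gam (b + 1)"
    by (simp_all only: gam_minus)
  have "b \<ge> 1" using assms by (simp add: b_def)
  hence B1: "B \<noteq> 1" "B * Q \<noteq> 1"
    using powi_ne_1[of "2 * b"] powi_ne_1[of "2 * (b + 1)"] q0
    by (auto simp: B_def Q_def power_int_add distrib_left)
  have gb: "gam b = 1 / (1 - B)" "gam (b + 1) = 1 / (1 - B * Q)"
    using \<open>b \<ge> 1\<close> q0 by (simp_all add: gam_def B_def Q_def power_int_add distrib_left)
  have ga: "A \<noteq> 1 \<and> gam a = 1 / (1 - A)" if "a \<noteq> 0"
    using that powi_ne_1[of "2 * a"] by (simp add: gam_def A_def)
  have ga1: "A \<noteq> Q \<and> gam (a - 1) = Q / (Q - A)" if "a \<noteq> 1"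
  proof -
    have "q powi (2 * (a - 1)) = A / Q" unfolding A_def Q right_diff_distrib using q0 by (subst power_int_diff) auto
    moreover from this have "A \<noteq> Q" using that powi_ne_1[of "2 * (a - 1)"] nz by auto
    ultimately show ?thesis using that nz by (simp add: gam_def) (simp add: divide_simps)
  qed
  show ?thesis
  proof (cases "a = 0 \<or> a = 1")
    case False
    hence "Y t s - Y t (s + 1) = E / B * (gam (a - 1) - gam b) - E * A * (gam a - gam (b + 1))"
      unfolding Y_def e3 e4 g by (auto simp: a_def)
    moreover have "A \<noteq> 1" "A \<noteq> Q" "gam a = 1 / (1 - A)" "gam (a - 1) = Q / (Q - A)" using ga ga1 False by auto
    ultimately show ?thesis unfolding cc_def e1 e2 g gb using nz B1
      by (simp add: divide_simps) algebra
  next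
    case True
    have "gam 0 = 1 / 2" by (simp add: gam_def)
    from True show ?thesis
    proof
      assume a: "a = 0"
      hence "Y t s - Y t (s + 1) = 1 + E / B * (gam (a - 1) - gam b) - E * A * (gam a - gam (b + 1))"
        unfolding Y_def e3 e4 g by (auto simp: a_def)
      moreover have "A = 1" "E = 1" "Q \<noteq> 1" "gam a = 1 / 2" "gam (a - 1) = Q / (Q - 1)"
        using ga1 \<open>gam 0 = 1 / 2\<close> by (auto simp: a A_def E_def)
      ultimately show ?thesis unfolding cc_def e1 e2 g gb using nz B1
        by (simp add: divide_simps) algebra
    next
      assume a: "a = 1"
      hence "Y t s - Y t (s + 1) = 1 + E / B * (gam (a - 1) - gam b) - E * A * (gam a - gam (b + 1))"
        unfolding Y_def e3 e4 g by (auto simp: a_def)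
      moreover have "A = Q" "E = B" "Q \<noteq> 1" "gam a = 1 / (1 - Q)" "gam (a - 1) = 1 / 2"
        using ga \<open>gam 0 = 1 / 2\<close> by (auto simp: a A_def E_def B_def Q_def)
      ultimately show ?thesis unfolding cc_def e1 e2 g gb using nz B1
        by (simp add: divide_simps) algebra
    qed
  qed
qed

text \<open>The increment of \<open>pp\<close> from k - 1 to k: its terms with i = 2k - 1 and i = 2k
  - 2.\<close>

definition ww :: "nat \<Rightarrow> complex" where
  "ww k = q powi (- tri (2 * int k)) + q powi (- tri (2 * int k - 1))"

lemma pp_Suc: "pp (Suc s) = pp s + ww (Suc s)"
  by (simp add: pp_def ww_def algebra_simps)

lemma pp_0 [simp]: "pp 0 = 0" by (simp add: pp_def)

lemma abel_summation:
  "(\<Sum>k<K. pp (Suc k) * (Y t (int k + 1) - Y t (int k + 2)))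
     = (\<Sum>k<K. ww (Suc k) * Y t (int k + 1)) - pp K * Y t (int K + 1)"
  by (induction K) (simp_all add: pp_Suc algebra_simps)

text \<open>Abel summation produces differences of \<open>vv t\<close> at distance 2t + 1, so their
  sum collapses to two windows of that length.\<close>

definition vv :: "int \<Rightarrow> int \<Rightarrow> complex" where
  "vv t m = (q powi (m - 1 - t) + q powi (m + t)) * gam m"

lemma sum_vv:
  "(\<Sum>k<K. vv t (int k - t) - vv t (int k + 1 + t)) = (\<Sum>m\<in>{-t..t}. vv t m) - (\<Sum>m\<in>{int K-t..int K+t}. vv t m)"
  if "t \<ge> 0"
proof (induction K)
  case (Suc K)
  have "{int K-t..int K+t} = insert (int K - t) {int K+1-t..int K+t}"
    and "{int (Suc K)-t..int (Suc K)+t} = insert (int K + 1 + t) {int K+1-t..int K+t}" using that by auto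
  thus ?case using Suc by simp
qed simp

text \<open>q^m / (1 - q^(2m)) is odd in m, so only the middle term \<open>gam 0\<close>
  survives.\<close>

lemma sum_q_gam: "t \<ge> 0 \<Longrightarrow> (\<Sum>m\<in>{-t..t}. q powi m * gam m) = 1 / 2"
proof (induction t rule: int_ge_induct)
  case base
  show ?case by (simp add: gam_def)
next
  case (step t)
  have "{-(t+1)..t+1} = insert (- (t + 1)) (insert (t + 1) {-t..t})" using step by auto
  hence "(\<Sum>m\<in>{-(t+1)..t+1}. q powi m * gam m) = q powi (-(t+1)) * gam (-(t+1)) + (q powi (t+1) * gam (t+1) + 1/2)"
    using step by simp
  also have "q powi (-(t+1)) * gam (-(t+1)) = q powi (-(t+1)) * (1 - gam (t+1))" by (simp only: gam_minus)
  also have "1 - gam (t+1) = - (q powi (2 * (t+1)) * gam (t+1))" using gam_rec[of "t+1"] step by (simp add: algebra_simps)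
  also have "q powi (-(t+1)) * - (q powi (2 * (t+1)) * gam (t+1)) = - (q powi (t + 1) * gam (t + 1))"
  proof -
    have "q powi (-(t+1)) * q powi (2 * (t+1)) = q powi (t + 1)" using q0 by (simp add: algebra_simps flip: power_int_add)
    thus ?thesis by (simp add: mult.assoc[symmetric])
  qed
  finally show ?case by simp
qed

text \<open>With x = k + 1 the 2x^2 in the exponent of \<open>Y\<close> cancels the quadratic part
  of \<open>ww\<close>, leaving q^(-x) + q^(x-1). The growing power q^(-x) is removed by the
  recurrence of \<open>gam\<close>: its constant parts cancel between the two \<open>gam\<close>
  terms, and its failure at m = 0 gives the correction at k = t.\<close>

lemma ww_Y:
  assumes t: "t \<ge> 0"
  shows "ww (Suc k) * Y t (int k + 1) =
     (if int k \<le> t then 2 * ww (Suc k) else 0) - (if int k = t then ww (Suc k) else 0)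
     + q powi (- 2 * (t\<^sup>2 + t)) * (vv t (int k - t) - vv t (int k + 1 + t) - (if int k = t then q powi (- t - 1) else 0))"
proof -
  define x where "x = int k + 1"
  have t1: "tri (2 * x) = 2 * x\<^sup>2 - x" "tri (2 * x - 1) = 2 * x\<^sup>2 - 3 * x + 1"
    using two_tri[of "2 * x"] two_tri[of "2 * x - 1"] by (simp_all add: algebra_simps power2_eq_square)
  have w: "ww (Suc k) * q powi (2 * (x\<^sup>2 - x - t\<^sup>2 - t)) = q powi (- 2 * (t\<^sup>2 + t)) * (q powi (- x) + q powi (x - 1))"
  proof -
    have "ww (Suc k) = q powi (- (2 * x\<^sup>2 - x)) + q powi (- (2 * x\<^sup>2 - 3 * x + 1))"
    proof -
      have "int (Suc k) = x" by (simp add: x_def)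
      thus ?thesis by (simp only: ww_def t1)
    qed
    thus ?thesis using q0 by (simp add: distrib_left distrib_right algebra_simps flip: power_int_add)
  qed
  have v: "(q powi (- x) + q powi (x - 1)) * (gam (x - 1 - t) - gam (x + t)) =
        vv t (x - 1 - t) - vv t (x + t) - (if x = t + 1 then q powi (- t - 1) else 0)"
  proof -
    have g2: "q powi (- x) * gam (x + t) = q powi (- x) + q powi (x + 2 * t) * gam (x + t)"
    proof -
      have "gam (x + t) = 1 + q powi (2 * (x + t)) * gam (x + t)" using t by (intro gam_rec) (auto simp: x_def)
      hence "q powi (- x) * gam (x + t) = q powi (- x) + (q powi (- x) * q powi (2 * (x + t))) * gam (x + t)"
        by (metis distrib_left mult.assoc mult.right_neutral)
      also have "q powi (- x) * q powi (2 * (x + t)) = q powi (x + 2 * t)" using q0 by (simp add: algebra_simps flip: power_int_add)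
      finally show ?thesis .
    qed
    have g1: "q powi (- x) * gam (x - 1 - t) = q powi (- x) + q powi (x - 2 - 2 * t) * gam (x - 1 - t) - (if x = t + 1 then q powi (- t - 1) else 0)"
    proof (cases "x = t + 1")
      case True
      thus ?thesis by (simp add: gam_def)
    next
      case False
      hence "gam (x - 1 - t) = 1 + q powi (2 * (x - 1 - t)) * gam (x - 1 - t)" by (intro gam_rec) auto
      hence "q powi (- x) * gam (x - 1 - t) = q powi (- x) + (q powi (- x) * q powi (2 * (x - 1 - t))) * gam (x - 1 - t)"
        by (metis distrib_left mult.assoc mult.right_neutral)
      also have "q powi (- x) * q powi (2 * (x - 1 - t)) = q powi (x - 2 - 2 * t)" using q0 by (simp add: algebra_simps flip: power_int_add)
      finally show ?thesis using False by simp
    qed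
    have "x - 1 - t - 1 - t = x - 2 - 2 * t" "x - 1 - t + t = x - 1" "x + t - 1 - t = x - 1" "x + t + t = x + 2 * t" by simp_all
    hence "vv t (x - 1 - t) = (q powi (x - 2 - 2 * t) + q powi (x - 1)) * gam (x - 1 - t)"
       "vv t (x + t) = (q powi (x - 1) + q powi (x + 2 * t)) * gam (x + t)" by (simp_all only: vv_def)
    thus ?thesis using g1 g2 by (simp add: algebra_simps)
  qed
  have "ww (Suc k) * Y t x = ww (Suc k) * ((if x \<le> t + 1 then 2 else 0) - (if x = t + 1 then 1 else 0))
     + (ww (Suc k) * q powi (2 * (x\<^sup>2 - x - t\<^sup>2 - t))) * (gam (x - 1 - t) - gam (x + t))"
    by (simp add: Y_def algebra_simps)
  also have "\<dots> = ww (Suc k) * ((if x \<le> t + 1 then 2 else 0) - (if x = t + 1 then 1 else 0))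
     + q powi (- 2 * (t\<^sup>2 + t)) * (vv t (x - 1 - t) - vv t (x + t) - (if x = t + 1 then q powi (- t - 1) else 0))"
    unfolding w mult.assoc v ..
  also have "d * ((if P then 2 else 0) - (if R then 1 else 0)) = (if P then 2 * d else 0) - (if R then d else 0)"
    for d :: complex and P R by simp
  finally have *: "ww (Suc k) * Y t x =
    (if x \<le> t + 1 then 2 * ww (Suc k) else 0) - (if x = t + 1 then ww (Suc k) else 0) +
     q powi (- 2 * (t\<^sup>2 + t)) * (vv t (x - 1 - t) - vv t (x + t) - (if x = t + 1 then q powi (- t - 1) else 0))" .
  have "(x \<le> t + 1) = (int k \<le> t)" "(x = t + 1) = (int k = t)" "x - 1 - t = int k - t" by (auto simp: x_def)
  from *[unfolded this] show ?thesis unfolding x_def .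
qed

lemma sum_ww_Y:
  assumes "K > t"
  shows "(\<Sum>k<K. ww (Suc k) * Y (int t) (int k + 1)) = 2 * pp (Suc t) - ww (Suc t)
     + q powi (- 2 * ((int t)\<^sup>2 + int t)) * ((q powi (- int t - 1) + q powi int t) / 2
        - (\<Sum>m\<in>{int K - int t..int K + int t}. vv (int t) m) - q powi (- int t - 1))"
proof -
  have a: "(\<Sum>k<K. if int k \<le> int t then 2 * ww (Suc k) else 0) = 2 * pp (Suc t)"
  proof -
    have "(\<Sum>k<K. if int k \<le> int t then 2 * ww (Suc k) else 0) = (\<Sum>k<Suc t. 2 * ww (Suc k))"
      by (rule sum.mono_neutral_cong_right) (use assms in auto)
    also have "(\<Sum>k<n. ww (Suc k)) = pp n" for n by (induction n) (simp_all add: pp_Suc)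
    hence "(\<Sum>k<Suc t. 2 * ww (Suc k)) = 2 * pp (Suc t)" by (simp only: flip: sum_distrib_left)
    finally show ?thesis .
  qed
  have b: "(\<Sum>k<K. if int k = int t then f k else 0) = f t" for f :: "nat \<Rightarrow> complex"
    using assms by (simp add: sum.delta)
  have c: "(\<Sum>m\<in>{-int t..int t}. vv (int t) m) = (q powi (- int t - 1) + q powi int t) / 2"
  proof -
    have "vv (int t) m = (q powi (- int t - 1) + q powi int t) * (q powi m * gam m)" for m
    proof -
      have "q powi (m - 1 - int t) = q powi (- int t - 1) * q powi m" "q powi (m + int t) = q powi int t * q powi m"
        using q0 by (simp_all add: power_int_add power_int_diff power_int_minus field_simps)
      thus ?thesis by (simp add: vv_def algebra_simps)
    qed
    thus ?thesis using sum_q_gam[of "int t"] by (simp flip: sum_distrib_left)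
  qed
  show ?thesis
    unfolding ww_Y[OF of_nat_0_le_iff] sum.distrib sum_subtractf sum_distrib_left[symmetric] a b
      sum_vv[OF of_nat_0_le_iff, unfolded sum_subtractf] c by simp
qed

lemma vv_LIMSEQ: "(\<lambda>K. vv (int t) (int K + j)) \<longlonglongrightarrow> 0"
proof -
  obtain B where B: "B \<ge> 1" "\<And>m. norm (gam m) \<le> B" using gam_bounded by blast
  have "(\<lambda>K. (q powi (j - 1 - int t) + q powi (j + int t)) * q ^ K) \<longlonglongrightarrow> (q powi (j - 1 - int t) + q powi (j + int t)) * 0"
    by (intro tendsto_intros LIMSEQ_power_zero q1)
  hence "(\<lambda>K. ((q powi (j - 1 - int t) + q powi (j + int t)) * q ^ K) * gam (int K + j)) \<longlonglongrightarrow> 0"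
    using lim_null_mult_right_bounded[where B = B and g = "\<lambda>K. gam (int K + j)" and F = sequentially] B by simp
  moreover have "((q powi (j - 1 - int t) + q powi (j + int t)) * q ^ K) * gam (int K + j) = vv (int t) (int K + j)" for K
  proof -
    have e: "int K + j - 1 - int t = int K + (j - 1 - int t)" "int K + j + int t = int K + (j + int t)" by simp_all
    have "q powi (int K + j - 1 - int t) = q ^ K * q powi (j - 1 - int t)" "q powi (int K + j + int t) = q ^ K * q powi (j + int t)"
      unfolding e power_int_add[OF disjI1[OF q0], of "int K"] by simp_all
    thus ?thesis by (simp add: vv_def algebra_simps)
  qed
  ultimately show ?thesis by simp
qed

lemma pp_bound: "norm (pp s) \<le> 2 * real s * norm q powi (int s - 2 * (int s)\<^sup>2)"
proof -
  have t: "tri (2 * int s) = 2 * (int s)\<^sup>2 - int s"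
    using two_tri[of "2 * int s"] by (simp add: algebra_simps power2_eq_square)
  have "norm (pp s) \<le> (\<Sum>i<2 * s. norm q powi (int s - 2 * (int s)\<^sup>2))"
    unfolding pp_def
  proof (rule sum_norm_le)
    fix i assume "i \<in> {..<2 * s}"
    hence "tri (int i + 1) \<le> tri (2 * int s)" by (intro tri_mono) auto
    thus "norm (q powi (- tri (int i + 1))) \<le> norm q powi (int s - 2 * (int s)\<^sup>2)"
      unfolding norm_power_int using q1 q0 t by (intro power_int_decreasing) auto
  qed
  also have "\<dots> = 2 * real s * norm q powi (int s - 2 * (int s)\<^sup>2)" by simp
  finally show ?thesis .
qed

text \<open>The weight q^(2s^2) compensates the largest term of \<open>pp s\<close>, whose exponent
  is -tri (2s) = s - 2s^2, and leaves a factor q^s. This bound controls the sums over s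
  below.\<close>

lemma theta_pp_bound: "norm (q powi (2 * (int s)\<^sup>2) * pp s) \<le> 2 * real s * norm q ^ s"
proof -
  have "norm (q powi (2 * (int s)\<^sup>2) * pp s) \<le> norm q powi (2 * (int s)\<^sup>2) * (2 * real s * norm q powi (int s - 2 * (int s)\<^sup>2))"
    unfolding norm_mult norm_power_int by (intro mult_left_mono pp_bound) auto
  also have "\<dots> = 2 * real s * norm q powi (2 * (int s)\<^sup>2 + (int s - 2 * (int s)\<^sup>2))"
    using q0 by (subst power_int_add) auto
  finally show ?thesis by simp
qed

lemma summable_arith_geometric: "(\<lambda>k. 2 * real (Suc k) * norm q ^ Suc k) summable_on UNIV"
proof -
  have "summable (\<lambda>k. real (Suc k) * norm q ^ k)"
    using geometric_deriv_sums[of "norm q"] q1 by (auto simp: sums_iff)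
  hence "summable (\<lambda>k. (2 * norm q) * (real (Suc k) * norm q ^ k))" by (rule summable_mult)
  also have "(\<lambda>k. (2 * norm q) * (real (Suc k) * norm q ^ k)) = (\<lambda>k. 2 * real (Suc k) * norm q ^ Suc k)"
    by (simp add: algebra_simps)
  finally show ?thesis by (intro summable_nonneg_imp_summable_on) auto
qed

lemma cc_bounded: obtains B where "B \<ge> 1" "\<And>s t. norm (cc s t) \<le> B"
proof -
  obtain B where B: "B \<ge> 1" "\<And>m. norm (gam m) \<le> B" using gam_bounded by blast
  have "norm (cc s t) \<le> 2 * B" for s t
    unfolding cc_def using norm_triangle_ineq4[of "gam (s - t)" "gam (- s - t)"] B(2)[of "s - t"] B(2)[of "- s - t"] by linarith
  thus ?thesis using that[of "2 * B"] B(1) by auto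
qed

lemma h_summable:
  "(\<lambda>k. q powi (2 * ((int k + 1)\<^sup>2 - (int t)\<^sup>2)) * pp (Suc k) * cc (int k + 1) (int t)) summable_on UNIV"
proof -
  obtain B where B: "B \<ge> 1" "\<And>s t. norm (cc s t) \<le> B" using cc_bounded by blast
  define c where "c = norm (q powi (- 2 * (int t)\<^sup>2)) * B"
  show ?thesis
  proof (rule abs_summable_summable, rule Infinite_Sum.abs_summable_on_comparison_test')
    show "(\<lambda>k. (2 * real (Suc k) * norm q ^ Suc k) * c) summable_on UNIV"
      by (intro summable_on_cmult_left summable_arith_geometric)
    fix k
    have "q powi (2 * ((int k + 1)\<^sup>2 - (int t)\<^sup>2)) = q powi (2 * (int (Suc k))\<^sup>2) * q powi (- 2 * (int t)\<^sup>2)"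
      using q0 by (simp add: algebra_simps flip: power_int_add)
    hence "norm (q powi (2 * ((int k + 1)\<^sup>2 - (int t)\<^sup>2)) * pp (Suc k) * cc (int k + 1) (int t))
       = norm (q powi (2 * (int (Suc k))\<^sup>2) * pp (Suc k)) * (norm (q powi (- 2 * (int t)\<^sup>2)) * norm (cc (int k + 1) (int t)))"
      by (simp add: norm_mult mult_ac)
    also have "\<dots> \<le> (2 * real (Suc k) * norm q ^ Suc k) * c"
      unfolding c_def by (intro mult_mono theta_pp_bound B(2) mult_nonneg_nonneg) auto
    finally show "norm (q powi (2 * ((int k + 1)\<^sup>2 - (int t)\<^sup>2)) * pp (Suc k) * cc (int k + 1) (int t))
       \<le> (2 * real (Suc k) * norm q ^ Suc k) * c" .
  qed
qed

text \<open>Partial sums over k < K are transformed by \<open>cc_telescope\<close> and Abel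
  summation. As K grows, the far window of \<open>vv\<close> tends to 0, and so does the boundary
  term, since \<open>Y\<close> contributes q^(2K^2 + 2K) against the growth q^(-2K^2) of
  \<open>pp K\<close>.\<close>

lemma h_Suc: "h (Suc t) = h t + 2 * pp (Suc t) - ww (Suc t)
     + q powi (- 2 * ((int t)\<^sup>2 + int t)) * (q powi int t - q powi (- int t - 1)) / 2"
proof -
  define f where "f = (\<lambda>t k. q powi (2 * ((int k + 1)\<^sup>2 - (int t)\<^sup>2)) * pp (Suc k) * cc (int k + 1) (int t))"
  have f: "(\<lambda>K. \<Sum>k<K. f t k) \<longlonglongrightarrow> h t" for t
    using has_sum_imp_sums[OF has_sum_infsum[OF h_summable[of t]]] by (simp add: f_def h_def sums_def)
  have diff: "f (Suc t) k - f t k = pp (Suc k) * (Y (int t) (int k + 1) - Y (int t) (int k + 2))" for k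
  proof -
    have "f (Suc t) k - f t k = pp (Suc k) * (q powi (2 * ((int k + 1)\<^sup>2 - (int t + 1)\<^sup>2)) * cc (int k + 1) (int t + 1)
        - q powi (2 * ((int k + 1)\<^sup>2 - (int t)\<^sup>2)) * cc (int k + 1) (int t))"
      unfolding f_def of_nat_Suc add.commute[of 1] right_diff_distrib by (simp only: mult_ac)
    also have "\<dots> = pp (Suc k) * (Y (int t) (int k + 1) - Y (int t) (int k + 1 + 1))"
      by (subst cc_telescope) auto
    finally show ?thesis by (simp add: add.assoc)
  qed
  define R where "R = (\<lambda>K. 2 * pp (Suc t) - ww (Suc t)
     + q powi (- 2 * ((int t)\<^sup>2 + int t)) * ((q powi (- int t - 1) + q powi int t) / 2
        - (\<Sum>m\<in>{int K - int t..int K + int t}. vv (int t) m) - q powi (- int t - 1)) - pp K * Y (int t) (int K + 1))"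
  have "(\<Sum>k<K. f (Suc t) k) - (\<Sum>k<K. f t k) = R K" if "K > t" for K
    unfolding sum_subtractf[symmetric] diff abel_summation sum_ww_Y[OF that] R_def ..
  hence RL: "(\<lambda>K. R K) \<longlonglongrightarrow> h (Suc t) - h t"
    by (intro Lim_transform_eventually[OF tendsto_diff[OF f f]]) (auto simp: eventually_sequentially intro!: exI[of _ "Suc t"])
  have "(\<lambda>K. \<Sum>m\<in>{int K - int t..int K + int t}. vv (int t) m) \<longlonglongrightarrow> 0"
  proof -
    have "(\<Sum>m\<in>{int K - int t..int K + int t}. vv (int t) m) = (\<Sum>j\<in>{- int t..int t}. vv (int t) (int K + j))" for K
      by (rule sum.reindex_bij_witness[of _ "\<lambda>j. int K + j" "\<lambda>m. m - int K"]) auto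
    thus ?thesis by (simp only:) (intro tendsto_null_sum vv_LIMSEQ)
  qed
  moreover have "(\<lambda>K. pp K * Y (int t) (int K + 1)) \<longlonglongrightarrow> 0"
  proof -
    obtain B where B: "B \<ge> 1" "\<And>m. norm (gam m) \<le> B" using gam_bounded by blast
    define c where "c = norm (q powi (- 2 * ((int t)\<^sup>2 + int t))) * (2 * B)"
    have "(\<lambda>k. 2 * real (Suc k) * norm q ^ Suc k) \<longlonglongrightarrow> 0"
      using summable_arith_geometric by (intro summable_LIMSEQ_zero summable_on_imp_summable)
    hence "(\<lambda>k. 2 * real k * norm q ^ k) \<longlonglongrightarrow> 0" by (rule LIMSEQ_imp_Suc)
    hence lim: "(\<lambda>k. (2 * real k * norm q ^ k) * c) \<longlonglongrightarrow> 0" by (rule tendsto_mult_left_zero)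
    have "norm (pp K * Y (int t) (int K + 1)) \<le> (2 * real K * norm q ^ K) * c" if "K > t" for K
    proof -
      define g where "g = gam (int K - int t) - gam (int K + 1 + int t)"
      have Y: "Y (int t) (int K + 1) = q powi (2 * ((int K)\<^sup>2 + int K - (int t)\<^sup>2 - int t)) * g"
        using that by (simp add: Y_def g_def power2_eq_square algebra_simps)
      have e: "q powi (2 * ((int K)\<^sup>2 + int K - (int t)\<^sup>2 - int t)) =
          q powi (2 * (int K)\<^sup>2) * (q ^ (2 * K) * q powi (- 2 * ((int t)\<^sup>2 + int t)))"
      proof -
        have "q ^ (2 * K) = q powi (2 * int K)" by (simp add: power_int_def nat_mult_distrib)
        thus ?thesis using q0 by (simp add: algebra_simps flip: power_int_add)
      qed
      have "norm (pp K * Y (int t) (int K + 1)) = norm (q powi (2 * (int K)\<^sup>2) * pp K) *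
            (norm q ^ (2 * K) * (norm (q powi (- 2 * ((int t)\<^sup>2 + int t))) * norm g))"
        unfolding Y e by (simp add: norm_mult norm_power mult_ac)
      also have "norm g \<le> 2 * B"
        unfolding g_def using norm_triangle_ineq4 B(2) by (smt (verit, best))
      hence "norm (q powi (2 * (int K)\<^sup>2) * pp K) * (norm q ^ (2 * K) * (norm (q powi (- 2 * ((int t)\<^sup>2 + int t))) * norm g))
         \<le> (2 * real K * norm q ^ K) * (1 * c)"
        unfolding c_def using q1 by (intro mult_mono theta_pp_bound mult_nonneg_nonneg power_le_one) auto
      finally show ?thesis by simp
    qed
    hence "\<forall>\<^sub>F K in sequentially. norm (pp K * Y (int t) (int K + 1)) \<le> (2 * real K * norm q ^ K) * c"
      by (auto simp: eventually_sequentially intro!: exI[of _ "Suc t"])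
    thus ?thesis using lim by (rule Lim_null_comparison)
  qed
  ultimately have "(\<lambda>K. R K) \<longlonglongrightarrow> 2 * pp (Suc t) - ww (Suc t)
     + q powi (- 2 * ((int t)\<^sup>2 + int t)) * ((q powi (- int t - 1) + q powi int t) / 2
        - 0 - q powi (- int t - 1)) - 0"
    unfolding R_def by (intro tendsto_add tendsto_diff tendsto_mult tendsto_const)
  from LIMSEQ_unique[OF RL this] have "h (Suc t) - h t = 2 * pp (Suc t) - ww (Suc t)
     + q powi (- 2 * ((int t)\<^sup>2 + int t)) * ((q powi (- int t - 1) + q powi int t) / 2
        - 0 - q powi (- int t - 1)) - 0" .
  thus ?thesis by (simp add: field_simps)
qed

text \<open>Summation of \<open>h_Suc\<close>: once a term q^(-tri (i + 1)) has entered
  \<open>pp\<close>, every further step adds 2 to its coefficient, which is therefore linear in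
  t.\<close>

lemma h_closed: "h t = h 0 + (\<Sum>i<2 * t. (4 * of_nat t - 2 * of_nat i - 1) * q powi (- tri (int i + 1))) / 2"
proof (induction t)
  case (Suc t)
  define u v where "u = q powi (- tri (2 * int t + 1))" and "v = q powi (- tri (2 * int t + 2))"
  have tri: "tri (2 * int t + 1) = 2 * (int t)\<^sup>2 + int t" "tri (2 * int t + 2) = 2 * (int t)\<^sup>2 + 3 * int t + 1"
    using two_tri[of "2 * int t + 1"] two_tri[of "2 * int t + 2"] by (simp_all add: algebra_simps power2_eq_square)
  have "q powi (- 2 * ((int t)\<^sup>2 + int t)) * q powi int t = u"
    unfolding u_def tri using q0 by (simp add: algebra_simps del: power_int_of_nat flip: power_int_add)
  moreover have "q powi (- 2 * ((int t)\<^sup>2 + int t)) * q powi (- int t - 1) = v"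
    unfolding v_def tri using q0 by (simp add: algebra_simps flip: power_int_add)
  moreover have w: "ww (Suc t) = u + v" by (simp add: ww_def u_def v_def algebra_simps)
  moreover have S: "(\<Sum>i<2 * Suc t. (4 * of_nat (Suc t) - 2 * of_nat i - 1) * q powi (- tri (int i + 1)))
     = (\<Sum>i<2 * t. (4 * of_nat t - 2 * of_nat i - 1) * q powi (- tri (int i + 1))) + 4 * pp t + 3 * u + v"
  proof -
    have "(\<Sum>i<2 * Suc t. (4 * of_nat (Suc t) - 2 * of_nat i - 1) * q powi (- tri (int i + 1)))
       = (\<Sum>i<2 * t. (4 * of_nat (Suc t) - 2 * of_nat i - 1) * q powi (- tri (int i + 1))) + 3 * u + v"
      by (simp add: u_def v_def algebra_simps)
    also have "(\<Sum>i<2 * t. (4 * of_nat (Suc t) - 2 * of_nat i - 1) * q powi (- tri (int i + 1)))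
       = (\<Sum>i<2 * t. (4 * of_nat t - 2 * of_nat i - 1) * q powi (- tri (int i + 1)) + 4 * q powi (- tri (int i + 1)))"
      by (intro sum.cong) (simp_all add: algebra_simps)
    also have "\<dots> = (\<Sum>i<2 * t. (4 * of_nat t - 2 * of_nat i - 1) * q powi (- tri (int i + 1))) + 4 * pp t"
      by (simp add: sum.distrib pp_def sum_distrib_left)
    finally show ?thesis by simp
  qed
  ultimately show ?case unfolding h_Suc Suc.IH pp_Suc S right_diff_distrib w by (simp add: field_simps)
qed simp

end

section \<open>The member at t = 0 as a sum over triples\<close>

lemma has_sum_geometric_abs:
  fixes x :: complex
  assumes "norm x < 1"
  shows "((\<lambda>l::int. x ^ nat \<bar>l\<bar>) has_sum ((1 + x) / (1 - x))) UNIV"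
proof -
  have "((\<lambda>n. x ^ n) has_sum (x / (1 - x))) {1..}" by (rule has_sum_geometric_from_1[OF assms])
  moreover have "((\<lambda>n. x ^ n) has_sum S) {1..} \<longleftrightarrow> ((\<lambda>l::int. x ^ nat \<bar>l\<bar>) has_sum S) {1..}" for S
    by (rule has_sum_reindex_bij_witness[of _ nat int]) auto
  moreover have "((\<lambda>n. x ^ n) has_sum S) {1..} \<longleftrightarrow> ((\<lambda>l::int. x ^ nat \<bar>l\<bar>) has_sum S) {..-1}" for S
    by (rule has_sum_reindex_bij_witness[of _ "\<lambda>l. nat (- l)" "\<lambda>n. - int n"]) auto
  ultimately have 1: "((\<lambda>l::int. x ^ nat \<bar>l\<bar>) has_sum (x / (1 - x))) {1..}"
    and 2: "((\<lambda>l::int. x ^ nat \<bar>l\<bar>) has_sum (x / (1 - x))) {..-1}" by auto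
  have "((\<lambda>l::int. x ^ nat \<bar>l\<bar>) has_sum (1 + (x / (1 - x) + x / (1 - x)))) ({0} \<union> ({1..} \<union> {..-1}))"
    by (intro has_sum_Un_disjoint 1 2) (auto simp: has_sum_finite_iff)
  also have "{0} \<union> ({1..} \<union> {..-1}) = (UNIV :: int set)" by auto
  also have "1 + (x / (1 - x) + x / (1 - x)) = (1 + x) / (1 - x)"
  proof -
    have "x \<noteq> 1" using assms by auto
    have "(1 + x) / (1 - x) = ((1 - x) + (x + x)) / (1 - x)" by simp
    also have "\<dots> = (1 - x) / (1 - x) + (x / (1 - x) + x / (1 - x))" by (simp only: add_divide_distrib)
    finally show ?thesis using \<open>x \<noteq> 1\<close> by simp
  qed
  finally show ?thesis .
qed

lemma summable_on_times:
  fixes f :: "'a \<Rightarrow> real" and g :: "'b \<Rightarrow> real"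
  assumes "f summable_on A" "g summable_on B" "\<And>a. f a \<ge> 0" "\<And>b. g b \<ge> 0"
  shows "(\<lambda>(a, b). f a * g b) summable_on (A \<times> B)"
proof (rule summable_on_SigmaI)
  show "((\<lambda>b. case (a, b) of (a, b) \<Rightarrow> f a * g b) has_sum (f a * infsum g B)) B" for a
    using has_sum_cmult_right[OF has_sum_infsum[OF assms(2)]] by simp
  show "(\<lambda>a. f a * infsum g B) summable_on A" by (rule summable_on_cmult_left[OF assms(1)])
qed (use assms in auto)

lemma summable_powi_abs: "0 < r \<Longrightarrow> r < 1 \<Longrightarrow> (\<lambda>t::int. r powi \<bar>t\<bar>) summable_on UNIV" for r :: real
  by (rule summable_on_int) (auto intro!: summable_nonneg_imp_summable_on summable_geometric)

text \<open>Symmetric partial sums are the ones along which the sum \<open>Z\<close>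
  telescopes.\<close>

lemma has_sum_int_LIMSEQ:
  fixes f :: "int \<Rightarrow> 'a :: {comm_monoid_add, topological_space}"
  assumes "(f has_sum S) UNIV"
  shows "(\<lambda>n. \<Sum>t\<in>{- int n..int n}. f t) \<longlonglongrightarrow> S"
proof -
  have "filterlim (\<lambda>n. {- int n..int n}) (finite_subsets_at_top UNIV) sequentially"
    unfolding filterlim_iff eventually_finite_subsets_at_top
  proof (intro allI impI, elim exE conjE)
    fix P :: "int set \<Rightarrow> bool" and X :: "int set"
    assume X: "finite X" "\<forall>Y. finite Y \<and> X \<subseteq> Y \<and> Y \<subseteq> UNIV \<longrightarrow> P Y"
    have "bdd_above (abs ` X)" using X(1) by simp
    then obtain b where b: "\<And>x. x \<in> X \<Longrightarrow> \<bar>x\<bar> \<le> b" by (auto simp: bdd_above_def)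
    have "P {- int n..int n}" if "n \<ge> nat b" for n
    proof -
      have "X \<subseteq> {- int n..int n}" using b that by force
      thus ?thesis using X(2) by simp
    qed
    thus "\<forall>\<^sub>F n in sequentially. P {- int n..int n}" by (auto simp: eventually_sequentially)
  qed
  thus ?thesis using assms unfolding has_sum_def by (rule filterlim_compose[rotated])
qed

lemma sixth_root_cube:
  fixes w :: complex
  assumes "w\<^sup>2 - w + 1 = 0"
  shows "w ^ 3 = - 1"
proof -
  have "w ^ 3 + 1 = (w + 1) * (w\<^sup>2 - w + 1)" by (simp add: algebra_simps power2_eq_square power3_eq_cube)
  thus ?thesis using assms by (simp add: eq_neg_iff_add_eq_0)
qed

lemma exists_sixth_root: "\<exists>w :: complex. w\<^sup>2 - w + 1 = 0"
proof
  define s where "s = \<i> * complex_of_real (sqrt 3)"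
  have s: "s\<^sup>2 = - 3" by (simp add: s_def power_mult_distrib flip: of_real_power)
  have "((1 + s) / 2)\<^sup>2 - (1 + s) / 2 + 1 = (s\<^sup>2 + 3) / 4" by (simp add: power2_eq_square field_simps)
  thus "((1 + s) / 2)\<^sup>2 - (1 + s) / 2 + 1 = 0" using s by simp
qed

definition TT :: "(nat \<times> nat \<times> nat) set" where
  "TT = {(A, C, i). i < 2 * A \<and> i < 2 * C}"

definition TN :: "nat \<times> nat \<times> nat \<Rightarrow> int" where
  "TN = (\<lambda>(A, C, i). 2 * int A * int C - tri (int i + 1))"

text \<open>For A <= C the bound i < 2A gives tri (i + 1) <= 2A^2 - A, so TN >= 2A(C - A) + A >=
  C.\<close>

lemma TN_lower: "(A, C, i) \<in> TT \<Longrightarrow> int A \<le> TN (A, C, i) \<and> int C \<le> TN (A, C, i)"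
proof (induction A C rule: linorder_wlog)
  case (le A C)
  hence A: "i < 2 * A" "A \<ge> 1" "A \<le> C" by (auto simp: TT_def)
  have "tri (int i + 1) \<le> tri (2 * int A)" using A by (intro tri_mono) auto
  also have "tri (2 * int A) = 2 * int A * int A - int A"
    using two_tri[of "2 * int A"] by (simp add: algebra_simps)
  moreover define D where "D = 2 * int A * (int C - int A)"
  ultimately have "TN (A, C, i) \<ge> D + int A" by (simp add: TN_def algebra_simps)
  moreover have "1 * (int C - int A) \<le> D" unfolding D_def using A by (intro mult_right_mono) auto
  moreover have "int A \<le> int C" using A by simp
  moreover define N where "N = TN (A, C, i)"
  ultimately have "int A \<le> N" "int C \<le> N" by simp_all
  thus ?case by (simp add: N_def)
next
  case (sym A C)
  thus ?case by (simp add: TT_def TN_def mult_ac)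
qed

context nome begin

lemma TT_summable: "(\<lambda>x. q powi TN x) summable_on TT"
proof (rule abs_summable_summable, rule Infinite_Sum.abs_summable_on_comparison_test')
  \<comment> \<open>A and C are at most TN and i < 2A, so A + C + i <= 4 TN; a fourth root of |q|
    provides a geometric factor for each index.\<close>
  define \<rho> where "\<rho> = root 4 (norm q)"
  have \<rho>: "\<rho> \<ge> 0" "\<rho> < 1" "\<rho> ^ 4 = norm q" "\<rho> > 0" using q1 q0 by (auto simp: \<rho>_def)
  have g: "(\<lambda>n. \<rho> ^ n) summable_on UNIV"
    using \<rho> by (intro summable_nonneg_imp_summable_on summable_geometric) auto
  have "(\<lambda>(A, x). \<rho> ^ A * (case x of (C, i) \<Rightarrow> \<rho> ^ C * \<rho> ^ i)) summable_on UNIV \<times> (UNIV \<times> UNIV)"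
    by (intro summable_on_times g) (use \<rho> in auto)
  hence "(\<lambda>(A, C, i). \<rho> ^ A * (\<rho> ^ C * \<rho> ^ i)) summable_on UNIV" by (simp add: case_prod_unfold)
  thus "(\<lambda>(A, C, i). \<rho> ^ A * (\<rho> ^ C * \<rho> ^ i)) summable_on TT" by (rule summable_on_subset) auto
  fix x assume x: "x \<in> TT"
  obtain A C i where [simp]: "x = (A, C, i)" by (cases x)
  have le: "int A \<le> TN x" "int C \<le> TN x" "i < 2 * A" using TN_lower x by (auto simp: TT_def)
  have "norm (q powi TN x) = norm q powi TN x" by (simp add: norm_power_int)
  also have "\<dots> = \<rho> powi (4 * TN x)" unfolding \<rho>(3)[symmetric] by (simp add: power_int_mult)
  also have "\<dots> \<le> \<rho> powi (int (A + (C + i)))"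
    by (intro power_int_decreasing) (use \<rho> le in auto)
  also have "\<dots> = \<rho> ^ A * (\<rho> ^ C * \<rho> ^ i)" unfolding power_int_of_nat by (simp only: power_add)
  finally show "norm (q powi TN x) \<le> (case x of (A, C, i) \<Rightarrow> \<rho> ^ A * (\<rho> ^ C * \<rho> ^ i))" by simp
qed

lemma cc_0: assumes "s > 0" shows "((\<lambda>l::int. q powi (2 * s * \<bar>l\<bar>)) has_sum cc s 0) UNIV"
proof -
  define x where "x = q ^ nat (2 * s)"
  have x: "norm x < 1" "x \<noteq> 1" using q1 assms power_neq_1[OF q1, of "nat (2 * s)"]
    by (auto simp: x_def norm_power power_less_one_iff)
  have "q powi (2 * s) = x" using assms by (simp add: x_def power_int_def)
  hence "gam s = 1 / (1 - x)" using assms by (simp add: gam_def)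
  moreover have "cc s 0 = 2 * gam s - 1" by (simp add: cc_def gam_minus)
  ultimately have "cc s 0 = 2 * (1 / (1 - x)) - 1" by simp
  also have "\<dots> = (1 + x) / (1 - x)" using x by (simp add: field_simps)
  finally have "cc s 0 = (1 + x) / (1 - x)" .
  moreover have "x ^ nat \<bar>l\<bar> = q powi (2 * s * \<bar>l\<bar>)" for l
    using assms by (simp add: x_def power_int_nonneg_exp nat_mult_distrib flip: power_mult)
  ultimately show ?thesis using has_sum_geometric_abs[OF x(1)] by simp
qed

text \<open>With s = min(A, C) and l = C - A one has 2AC = 2s^2 + 2s|l|, and the range of i is i <
  2s. The sum over l is \<open>cc s 0\<close>, the sum over i is \<open>pp s\<close>.\<close>

lemma TT_has_sum: "((\<lambda>x. q powi TN x) has_sum h 0) TT"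
proof -
  define S where "S = (\<Sum>\<^sub>\<infinity>x\<in>TT. q powi TN x)"
  have "((\<lambda>x. q powi TN x) has_sum S) TT" unfolding S_def by (rule has_sum_infsum[OF TT_summable])
  also have "?this \<longleftrightarrow> ((\<lambda>(k, l, i). q powi (2 * (int k + 1)\<^sup>2) * (q powi (2 * (int k + 1) * \<bar>l\<bar>) * q powi (- tri (int i + 1)))) has_sum S)
      (Sigma UNIV (\<lambda>k. UNIV \<times> {..<2 * Suc k}))"
  proof (rule has_sum_reindex_bij_witness[of _
      "\<lambda>(k, l, i). (Suc k + nat (- l), Suc k + nat l, i)" "\<lambda>(A, C, i). (min A C - 1, int C - int A, i)"])
    fix x assume "x \<in> TT"
    then obtain A C i where x: "x = (A, C, i)" "i < 2 * A" "i < 2 * C" by (auto simp: TT_def)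
    define s where "s = min (int A) (int C)"
    have s: "int (min A C - 1) + 1 = s" using x by (auto simp: s_def of_nat_diff)
    have "2 * s\<^sup>2 + 2 * s * \<bar>int C - int A\<bar> = 2 * int A * int C"
    proof (cases "A \<le> C")
      case True
      hence "s = int A" "\<bar>int C - int A\<bar> = int C - int A" by (auto simp: s_def)
      thus ?thesis by (simp add: power2_eq_square algebra_simps)
    next
      case False
      hence "s = int C" "\<bar>int C - int A\<bar> = int A - int C" by (auto simp: s_def)
      thus ?thesis by (simp add: power2_eq_square algebra_simps)
    qed
    hence "TN x = 2 * s\<^sup>2 + (2 * s * \<bar>int C - int A\<bar> - tri (int i + 1))" by (simp add: TN_def x)
    hence "q powi TN x = q powi (2 * s\<^sup>2) * (q powi (2 * s * \<bar>int C - int A\<bar>) * q powi (- tri (int i + 1)))"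
      using q0 by (simp add: power_int_add power_int_diff power_int_minus divide_inverse)
    thus "(case case x of (A, C, i) \<Rightarrow> (min A C - 1, int C - int A, i) of
          (k, l, i) \<Rightarrow> q powi (2 * (int k + 1)\<^sup>2) * (q powi (2 * (int k + 1) * \<bar>l\<bar>) * q powi (- tri (int i + 1)))) = q powi TN x"
      by (simp only: x(1) prod.case s)
  qed (auto simp: TT_def min_def split: if_splits)
  finally have *: "\<dots>" .
  have "((\<lambda>k. q powi (2 * ((int k + 1)\<^sup>2 - (int 0)\<^sup>2)) * pp (Suc k) * cc (int k + 1) (int 0)) has_sum S) UNIV"
  proof (rule has_sum_SigmaD[OF *])
    fix k
    have "((\<lambda>(l, i). q powi (2 * (int k + 1) * \<bar>l\<bar>) * q powi (- tri (int i + 1))) has_sum (cc (int k + 1) 0 * pp (Suc k)))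
        (UNIV \<times> {..<2 * Suc k})"
      unfolding pp_def by (intro has_sum_times cc_0) (auto simp: has_sum_finite_iff)
    from has_sum_cmult_right[OF this, of "q powi (2 * (int k + 1)\<^sup>2)"]
    show "((\<lambda>y. case (k, y) of (k, l, i) \<Rightarrow> q powi (2 * (int k + 1)\<^sup>2) * (q powi (2 * (int k + 1) * \<bar>l\<bar>) * q powi (- tri (int i + 1))))
       has_sum q powi (2 * ((int k + 1)\<^sup>2 - (int 0)\<^sup>2)) * pp (Suc k) * cc (int k + 1) (int 0)) (UNIV \<times> {..<2 * Suc k})"
      by (simp add: case_prod_unfold mult_ac)
  qed
  hence "S = h 0" unfolding h_def by (simp add: infsumI)
  thus ?thesis using has_sum_infsum[OF TT_summable] by (simp add: S_def)
qed

section \<open>Alternating sums of the kernel over multiples of 3\<close>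

lemma cc_even: "cc s (- t) = cc s t"
  using gam_minus[of "s + t"] gam_minus[of "t - s"] by (simp add: cc_def algebra_simps)

text \<open>For t > s >= 0 both arguments of \<open>gam\<close> are negative, and gam (-m) = -q^(2m)
  gam m is small. The base r = sqrt |q| is chosen so that the loss r^(-s) is covered by the factor
  |q|^s = r^(2s) of \<open>theta_pp_bound\<close>.\<close>

lemma cc_decay:
  obtains B where "B \<ge> 1" "\<And>s t. s \<ge> 0 \<Longrightarrow> norm (cc s t) \<le> B * sqrt (norm q) powi (\<bar>t\<bar> - s)"
proof -
  obtain B where B: "B \<ge> 1" "\<And>m. norm (gam m) \<le> B" using gam_bounded by blast
  define r where "r = sqrt (norm q)"
  have r: "r > 0" "r < 1" "r\<^sup>2 = norm q" using q0 q1 by (auto simp: r_def)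
  have main: "norm (cc s t) \<le> (2 * B) * r powi (t - s)" if "s \<ge> 0" "t \<ge> 0" for s t :: int
  proof (cases "t \<le> s")
    case True
    have "norm (cc s t) \<le> 2 * B"
      unfolding cc_def using norm_triangle_ineq4[of "gam (s - t)" "gam (- s - t)"] B(2)[of "s - t"] B(2)[of "- s - t"] by linarith
    also have "1 \<le> r powi (t - s)"
    proof -
      have "r powi (s - t) \<le> 1" using r True by (intro power_int_le_one) auto
      moreover have "r powi (t - s) = inverse (r powi (s - t))" by (simp flip: power_int_minus)
      ultimately show ?thesis using r by (simp add: one_le_inverse)
    qed
    hence "2 * B * 1 \<le> 2 * B * r powi (t - s)" using B by (intro mult_left_mono) auto
    finally show ?thesis by simp
  next
    case False
    have small: "norm (q powi (2 * m) * gam m) \<le> B * r powi (t - s)" if "m \<ge> t - s" for m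
    proof -
      have "norm q powi (2 * m) = r powi (4 * m)" unfolding r(3)[symmetric] by (simp add: power_int_power)
      also have "\<dots> \<le> r powi (t - s)" using r that False by (intro power_int_decreasing) auto
      finally show ?thesis unfolding norm_mult norm_power_int
        using B(1) B(2)[of m] r by (subst mult.commute) (intro mult_mono; simp)
    qed
    have gm: "gam (- m) = - (q powi (2 * m) * gam m)" if "m \<noteq> 0" for m
    proof -
      have "gam m - 1 = q powi (2 * m) * gam m" using gam_rec[OF that] by (metis add_diff_cancel_left')
      thus ?thesis unfolding gam_minus by (metis minus_diff_eq)
    qed
    have "gam (s - t) = - (q powi (2 * (t - s)) * gam (t - s))" "gam (- s - t) = - (q powi (2 * (s + t)) * gam (s + t))"
      using gm[of "t - s"] gm[of "s + t"] False that by simp_all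
    hence "norm (cc s t) \<le> norm (q powi (2 * (t - s)) * gam (t - s)) + norm (q powi (2 * (s + t)) * gam (s + t))"
      unfolding cc_def by (metis norm_minus_cancel norm_triangle_ineq4)
    also have "\<dots> \<le> B * r powi (t - s) + B * r powi (t - s)" using that by (intro add_mono small) auto
    finally show ?thesis by simp
  qed
  have "norm (cc s t) \<le> (2 * B) * r powi (\<bar>t\<bar> - s)" if "s \<ge> 0" for s t
    using main[OF that, of "\<bar>t\<bar>"] cc_even[of s t] by (cases "t \<ge> 0") auto
  thus ?thesis using that[of "2 * B"] B(1) by (auto simp: r_def)
qed

text \<open>The factor of q^(2s^2) \<open>pp s\<close> when the weighted sum of the
  \<open>h (3 * t)\<close> is carried out over t first.\<close>

definition Z :: "int \<Rightarrow> complex" where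
  "Z s = (\<Sum>\<^sub>\<infinity>t. (-1) powi t * cc s (3 * t))"

lemma cc_neg: "cc (- s) t = - cc s t"
  by (simp add: cc_def)

lemma Z_summable: "(\<lambda>t. (-1) powi t * cc s (3 * t)) summable_on UNIV"
proof -
  obtain B where B: "B \<ge> 1" "\<And>s t. s \<ge> 0 \<Longrightarrow> norm (cc s t) \<le> B * sqrt (norm q) powi (\<bar>t\<bar> - s)" using cc_decay by blast
  define r where "r = sqrt (norm q)"
  have r: "r > 0" "r < 1" using q0 q1 by (auto simp: r_def)
  have "(\<lambda>t. (-1) powi t * cc s (3 * t)) summable_on UNIV" if "s \<ge> 0" for s
  proof (rule abs_summable_summable, rule Infinite_Sum.abs_summable_on_comparison_test')
    show "(\<lambda>t. B * (r powi (- s) * r powi \<bar>t\<bar>)) summable_on UNIV"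
      by (intro summable_on_cmult_right summable_powi_abs r)
    fix t
    have "norm ((-1) powi t * cc s (3 * t)) \<le> B * r powi (\<bar>3 * t\<bar> - s)"
      using B(2)[OF that, of "3 * t"] by (simp add: norm_mult norm_power_int r_def)
    also have "\<dots> \<le> B * r powi (- s + \<bar>t\<bar>)" using B(1) r by (intro mult_left_mono power_int_decreasing) auto
    also have "\<dots> = B * (r powi (- s) * r powi \<bar>t\<bar>)" using r by (subst power_int_add) auto
    finally show "norm ((-1) powi t * cc s (3 * t)) \<le> B * (r powi (- s) * r powi \<bar>t\<bar>)" .
  qed
  from this[of s] this[of "- s"] show ?thesis
    by (cases "s \<ge> 0") (auto simp: cc_neg summable_on_uminus)
qed

lemma Z_neg: "Z (- s) = - Z s"
  by (simp add: Z_def cc_neg infsum_uminus)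

lemma Z_0: "Z 0 = 0"
  by (simp add: Z_def cc_def)

lemma gam_LIMSEQ: "(\<lambda>n. gam (3 * int n + j)) \<longlonglongrightarrow> 1" "(\<lambda>n. gam (- 3 * int n + j)) \<longlonglongrightarrow> 0"
proof -
  have 1: "(\<lambda>n. gam (3 * int n + j)) \<longlonglongrightarrow> 1" for j
  proof -
    have "norm (q ^ 6) < 1" using q1 by (simp add: norm_power power_less_one_iff)
    hence "(\<lambda>n. 1 / (1 - q powi (2 * j) * (q ^ 6) ^ n)) \<longlonglongrightarrow> 1 / (1 - q powi (2 * j) * 0)"
      by (intro tendsto_intros LIMSEQ_power_zero) auto
    moreover have "gam (3 * int n + j) = 1 / (1 - q powi (2 * j) * (q ^ 6) ^ n)" if "n > nat \<bar>j\<bar>" for n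
    proof -
      have "q powi (2 * (3 * int n + j)) = q powi (int (6 * n)) * q powi (2 * j)"
        using q0 by (simp add: algebra_simps flip: power_int_add)
      hence "q powi (2 * (3 * int n + j)) = q powi (2 * j) * (q ^ 6) ^ n"
        by (simp only: power_int_of_nat power_mult) (simp only: mult.commute)
      thus ?thesis using that by (simp add: gam_def)
    qed
    hence "\<forall>\<^sub>F n in sequentially. 1 / (1 - q powi (2 * j) * (q ^ 6) ^ n) = gam (3 * int n + j)"
      by (auto simp: eventually_sequentially intro!: exI[of _ "Suc (nat \<bar>j\<bar>)"])
    ultimately show ?thesis by (auto intro: Lim_transform_eventually)
  qed
  show "(\<lambda>n. gam (3 * int n + j)) \<longlonglongrightarrow> 1" by (rule 1)
  have "(\<lambda>n. 1 - gam (3 * int n + - j)) \<longlonglongrightarrow> 1 - 1" by (intro tendsto_intros 1)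
  moreover have "1 - gam (3 * int n + - j) = gam (- 3 * int n + j)" for n
    using gam_minus[of "3 * int n + - j"] by (simp add: algebra_simps)
  ultimately show "(\<lambda>n. gam (- 3 * int n + j)) \<longlonglongrightarrow> 0" by simp
qed

text \<open>gam (s + 3 - 3t) = gam (s - 3(t - 1)) occurs in the two sums with opposite signs, so Z s
  + Z (s + 3) telescopes. Four boundary values remain; they tend to 0, 0 and 1, 1 and cancel in
  pairs.\<close>

lemma Z_shift: "Z (s + 3) = - Z s"
proof -
  have Z: "((\<lambda>t. (-1) powi t * cc s (3 * t)) has_sum Z s) UNIV" for s
    unfolding Z_def by (rule has_sum_infsum[OF Z_summable])
  have "((\<lambda>t. (-1) powi t * cc s (3 * t) + (-1) powi t * cc (s + 3) (3 * t)) has_sum (Z s + Z (s + 3))) UNIV"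
    by (intro has_sum_add Z)
  hence "(\<lambda>n. \<Sum>t\<in>{- int n..int n}. (-1) powi t * cc s (3 * t) + (-1) powi t * cc (s + 3) (3 * t)) \<longlonglongrightarrow> Z s + Z (s + 3)"
    by (rule has_sum_int_LIMSEQ)
  moreover have "(\<Sum>t\<in>{- int n..int n}. (-1) powi t * cc s (3 * t) + (-1) powi t * cc (s + 3) (3 * t))
      = (-1) ^ n * ((gam (- 3 * int n + s) - gam (- 3 * int n + (- s - 3))) + (gam (3 * int n + (s + 3)) - gam (3 * int n + (- s))))" for n
  proof (induction n)
    case 0
    show ?case by (simp add: cc_def)
  next
    case (Suc n)
    have "{- int (Suc n)..int (Suc n)} = insert (- int n - 1) (insert (int n + 1) {- int n..int n})" by auto
    moreover have "(-1 :: complex) powi (- int n - 1) = - ((-1) ^ n)" "(-1 :: complex) powi (int n + 1) = - ((-1) ^ n)"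
      by (simp_all add: power_int_diff power_int_add power_int_minus flip: power_inverse)
    ultimately show ?case using Suc by (simp add: cc_def algebra_simps)
  qed
  moreover have "(\<lambda>n. (-1) ^ n * ((gam (- 3 * int n + s) - gam (- 3 * int n + (- s - 3))) + (gam (3 * int n + (s + 3)) - gam (3 * int n + (- s))))) \<longlonglongrightarrow> 0"
  proof (rule tendsto_norm_zero_cancel)
    have "(\<lambda>n. ((gam (- 3 * int n + s) - gam (- 3 * int n + (- s - 3))) + (gam (3 * int n + (s + 3)) - gam (3 * int n + (- s))))) \<longlonglongrightarrow> (0 - 0) + (1 - 1)"
      by (intro tendsto_intros gam_LIMSEQ)
    from tendsto_norm[OF this]
    show "(\<lambda>n. norm ((-1) ^ n * ((gam (- 3 * int n + s) - gam (- 3 * int n + (- s - 3))) + (gam (3 * int n + (s + 3)) - gam (3 * int n + (- s)))))) \<longlonglongrightarrow> 0"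
      by (simp add: norm_mult norm_power)
  qed
  ultimately have "Z s + Z (s + 3) = 0" by (simp add: LIMSEQ_unique)
  thus ?thesis by (simp add: eq_neg_iff_add_eq_0 add.commute)
qed

text \<open>Since w^3 = -1, both sides change sign under s -> s + 3, so agreement at s = 0, 1, 2
  suffices. At s = 2, Z 2 = -Z (-1) = Z 1 matches w + 1/w = 1.\<close>

lemma Z_eq:
  assumes w: "w\<^sup>2 - w + 1 = 0"
  shows "Z (int s) * (w - 1 / w) = Z 1 * (w ^ s - 1 / w ^ s)"
proof (induction s rule: nat_less_induct)
  case (1 s)
  have w0: "w \<noteq> 0" using w by auto
  have w2: "w\<^sup>2 = w - 1" using w by (simp add: algebra_simps add_eq_0_iff)
  have w3: "w ^ 3 = - 1" by (rule sixth_root_cube[OF w])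
  have w1: "w + 1 / w = 1" using w2 w0 by (simp add: field_simps power2_eq_square)
  consider "s = 0" | "s = 1" | "s = 2" | m where "s = m + 3" by (metis One_nat_def Suc_1 add_2_eq_Suc' add_Suc_right less_2_cases_iff not_less_eq numeral_3_eq_3 less_antisym not0_implies_Suc)
  thus ?case
  proof cases
    case 3
    have "Z 2 = - Z (- 1)" using Z_shift[of "-1"] by simp
    hence "Z 2 = Z 1" using Z_neg[of 1] by simp
    moreover have "w\<^sup>2 - 1 / w\<^sup>2 = (w - 1 / w) * (w + 1 / w)" using w0 by (simp add: field_simps power2_eq_square)
    ultimately show ?thesis using 3 w1 by simp
  next
    case 4
    have "Z (int m) * (w - 1 / w) = Z 1 * (w ^ m - 1 / w ^ m)" using 1 4 by simp
    moreover have "Z (int s) = - Z (int m)" using Z_shift[of "int m"] 4 by (simp add: algebra_simps)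
    moreover have "w ^ s = - (w ^ m)" using w3 4 by (simp add: power_add)
    ultimately show ?thesis by (simp add: algebra_simps)
  qed (auto simp: Z_0)
qed

text \<open>Both sides are \<open>\<Sum>\<^sub>t\<Sum>\<^sub>s (-1)\<^sup>t q\<^bsup>2s\<^sup>2\<^esup> p\<^sub>s c\<^sub>s\<^sub>,\<^sub>3\<^sub>t\<close>.\<close>
lemma sum_h_3:
  assumes w: "w\<^sup>2 - w + 1 = 0"
  shows "((\<lambda>t. (-1) powi t * q powi (18 * t\<^sup>2) * h (nat \<bar>3 * t\<bar>)) has_sum
     (Z 1 / (w - 1 / w) * (\<Sum>\<^sub>\<infinity>k. q powi (2 * (int k + 1)\<^sup>2) * pp (Suc k) * (w ^ Suc k - 1 / w ^ Suc k)))) UNIV"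
    and "(\<lambda>k. q powi (2 * (int k + 1)\<^sup>2) * pp (Suc k) * (w ^ Suc k - 1 / w ^ Suc k)) summable_on UNIV"
proof -
  define f where "f = (\<lambda>t k. (q powi (2 * (int k + 1)\<^sup>2) * pp (Suc k)) * ((-1) powi t * cc (int k + 1) (3 * t)))"
  have w0: "w \<noteq> 0" using w by auto
  have wne: "w - 1 / w \<noteq> 0"
  proof
    assume "w - 1 / w = 0"
    hence "w * w = 1" using w0 by (simp add: field_simps)
    hence "w = 2" using w by (simp add: power2_eq_square algebra_simps)
    thus False using \<open>w * w = 1\<close> by simp
  qed
  obtain B where B: "B \<ge> 1" "\<And>s t. s \<ge> 0 \<Longrightarrow> norm (cc s t) \<le> B * sqrt (norm q) powi (\<bar>t\<bar> - s)" using cc_decay by blast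
  define r where "r = sqrt (norm q)"
  have r: "r > 0" "r < 1" "r\<^sup>2 = norm q" using q0 q1 by (auto simp: r_def)
  have "norm (complex_of_real r) < 1" "complex_of_real r \<noteq> 0" using r by auto
  \<comment> \<open>After paying for the kernel, the majorant decays in s only like r^s, so the
    arithmetic-geometric series is reused at the nome r = sqrt |q|.\<close>
  then interpret R: nome "of_real r" by unfold_locales
  have rs: "(\<lambda>k. 2 * real (Suc k) * r ^ Suc k) summable_on UNIV" using R.summable_arith_geometric r by simp
  have "(\<lambda>(t, k). f t k) summable_on (UNIV \<times> UNIV)"
  proof (rule abs_summable_summable, rule Infinite_Sum.abs_summable_on_comparison_test')
    show "(\<lambda>(t, k). r powi \<bar>t\<bar> * (B * (2 * real (Suc k) * r ^ Suc k))) summable_on (UNIV \<times> UNIV)"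
      using B(1) r by (intro summable_on_times summable_on_cmult_right summable_powi_abs rs) (auto intro!: mult_nonneg_nonneg)
    fix x :: "int \<times> nat"
    obtain t k where [simp]: "x = (t, k)" by (cases x)
    have "norm (f t k) = norm (q powi (2 * (int (Suc k))\<^sup>2) * pp (Suc k)) * norm (cc (int k + 1) (3 * t))"
      by (simp add: f_def norm_mult norm_power_int add.commute)
    also have "\<dots> \<le> (2 * real (Suc k) * norm q ^ Suc k) * (B * r powi (\<bar>3 * t\<bar> - (int k + 1)))"
      unfolding r_def using B by (intro mult_mono theta_pp_bound) auto
    also have "\<dots> \<le> (2 * real (Suc k) * norm q ^ Suc k) * (B * r powi (\<bar>t\<bar> - int (Suc k)))"
      using B(1) r by (intro mult_left_mono power_int_decreasing mult_nonneg_nonneg) auto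
    also have "r powi (\<bar>t\<bar> - int (Suc k)) = r powi \<bar>t\<bar> / r ^ Suc k"
      using r by (subst power_int_diff) (auto simp del: of_nat_Suc)
    also have "norm q ^ Suc k = r ^ Suc k * r ^ Suc k" unfolding r(3)[symmetric] by (simp add: power2_eq_square power_mult_distrib)
    also have "(2 * real (Suc k) * (r ^ Suc k * r ^ Suc k)) * (B * (r powi \<bar>t\<bar> / r ^ Suc k)) = r powi \<bar>t\<bar> * (B * (2 * real (Suc k) * r ^ Suc k))"
      using r by (simp add: field_simps)
    finally show "norm (case x of (t, k) \<Rightarrow> f t k) \<le> (case x of (t, k) \<Rightarrow> r powi \<bar>t\<bar> * (B * (2 * real (Suc k) * r ^ Suc k)))" by simp
  qed
  then obtain S where S: "((\<lambda>(t, k). f t k) has_sum S) (UNIV \<times> UNIV)" by (auto simp: summable_on_def)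
  have 1: "((\<lambda>t. (-1) powi t * q powi (18 * t\<^sup>2) * h (nat \<bar>3 * t\<bar>)) has_sum S) UNIV"
  proof (rule has_sum_SigmaD[OF S])
    fix t :: int
    have "((\<lambda>k. (-1) powi t * q powi (18 * t\<^sup>2) * (q powi (2 * ((int k + 1)\<^sup>2 - (int (nat \<bar>3 * t\<bar>))\<^sup>2)) * pp (Suc k) * cc (int k + 1) (int (nat \<bar>3 * t\<bar>)))) has_sum
        ((-1) powi t * q powi (18 * t\<^sup>2) * h (nat \<bar>3 * t\<bar>))) UNIV"
      unfolding h_def by (intro has_sum_cmult_right has_sum_infsum h_summable)
    also have "(\<lambda>k. (-1) powi t * q powi (18 * t\<^sup>2) * (q powi (2 * ((int k + 1)\<^sup>2 - (int (nat \<bar>3 * t\<bar>))\<^sup>2)) * pp (Suc k) * cc (int k + 1) (int (nat \<bar>3 * t\<bar>)))) = f t"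
    proof
      fix k
      have arr: "e * X * (Y * P * C) = (X * Y * P) * (e * C)" for e X Y P C :: complex by (simp add: mult_ac)
      have "q powi (18 * t\<^sup>2) * q powi (2 * ((int k + 1)\<^sup>2 - (int (nat \<bar>3 * t\<bar>))\<^sup>2)) = q powi (2 * (int k + 1)\<^sup>2)"
        using q0 by (simp add: algebra_simps power2_eq_square flip: power_int_add abs_mult)
      moreover have "cc (int k + 1) (int (nat \<bar>3 * t\<bar>)) = cc (int k + 1) (3 * t)"
        using cc_even[of "int k + 1" "3 * t"] by (cases "t \<ge> 0") auto
      ultimately show "(-1) powi t * q powi (18 * t\<^sup>2) * (q powi (2 * ((int k + 1)\<^sup>2 - (int (nat \<bar>3 * t\<bar>))\<^sup>2)) * pp (Suc k) * cc (int k + 1) (int (nat \<bar>3 * t\<bar>))) = f t k"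
        unfolding f_def by (simp only: arr)
    qed
    finally show "((\<lambda>k. case (t, k) of (t, k) \<Rightarrow> f t k) has_sum ((-1) powi t * q powi (18 * t\<^sup>2) * h (nat \<bar>3 * t\<bar>))) UNIV" by simp
  qed
  have S': "((\<lambda>(k, t). f t k) has_sum S) (UNIV \<times> UNIV)" using S has_sum_swap[of "\<lambda>(t, k). f t k" UNIV UNIV S] by simp
  have "((\<lambda>k. Z 1 / (w - 1 / w) * (q powi (2 * (int k + 1)\<^sup>2) * pp (Suc k) * (w ^ Suc k - 1 / w ^ Suc k))) has_sum S) UNIV"
  proof (rule has_sum_SigmaD[OF S'])
    fix k
    have "Z (int k + 1) = Z 1 / (w - 1 / w) * (w ^ Suc k - 1 / w ^ Suc k)"
      using Z_eq[OF w, of "Suc k"] wne by (simp add: field_simps add.commute)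
    hence "q powi (2 * (int k + 1)\<^sup>2) * pp (Suc k) * Z (int k + 1) = Z 1 / (w - 1 / w) * (q powi (2 * (int k + 1)\<^sup>2) * pp (Suc k) * (w ^ Suc k - 1 / w ^ Suc k))"
      by (simp only: mult_ac)
    moreover have "((\<lambda>t. f t k) has_sum (q powi (2 * (int k + 1)\<^sup>2) * pp (Suc k) * Z (int k + 1))) UNIV"
      unfolding f_def Z_def by (intro has_sum_cmult_right has_sum_infsum Z_summable)
    ultimately show "((\<lambda>t. case (k, t) of (k, t) \<Rightarrow> f t k) has_sum (Z 1 / (w - 1 / w) * (q powi (2 * (int k + 1)\<^sup>2) * pp (Suc k) * (w ^ Suc k - 1 / w ^ Suc k)))) UNIV" by simp
  qed
  hence hs: "((\<lambda>k. Z 1 / (w - 1 / w) * (q powi (2 * (int k + 1)\<^sup>2) * pp (Suc k) * (w ^ Suc k - 1 / w ^ Suc k))) has_sum S) UNIV" .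
  have "w ^ 3 = - 1" by (rule sixth_root_cube[OF w])
  hence "norm w ^ 3 = 1" by (metis norm_minus_cancel norm_one norm_power)
  hence nw: "norm w = 1" using power_eq_imp_eq_base[of "norm w" 3 1] by simp
  show sm: "(\<lambda>k. q powi (2 * (int k + 1)\<^sup>2) * pp (Suc k) * (w ^ Suc k - 1 / w ^ Suc k)) summable_on UNIV"
  proof (rule abs_summable_summable, rule Infinite_Sum.abs_summable_on_comparison_test')
    show "(\<lambda>k. (2 * real (Suc k) * norm q ^ Suc k) * 2) summable_on UNIV"
      by (intro summable_on_cmult_left summable_arith_geometric)
    fix k
    have "norm (w ^ Suc k - 1 / w ^ Suc k) \<le> 2"
      by (rule order.trans[OF norm_triangle_ineq4]) (simp add: norm_power norm_divide norm_mult nw)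
    moreover have "norm (q powi (2 * (int k + 1)\<^sup>2) * pp (Suc k)) \<le> 2 * real (Suc k) * norm q ^ Suc k"
      using theta_pp_bound[of "Suc k"] by (simp only: of_nat_Suc add.commute)
    ultimately show "norm (q powi (2 * (int k + 1)\<^sup>2) * pp (Suc k) * (w ^ Suc k - 1 / w ^ Suc k)) \<le> (2 * real (Suc k) * norm q ^ Suc k) * 2"
      unfolding norm_mult[of "q powi (2 * (int k + 1)\<^sup>2) * pp (Suc k)"]
      by - (rule mult_mono, assumption+, simp_all)
  qed
  have "S = Z 1 / (w - 1 / w) * (\<Sum>\<^sub>\<infinity>k. q powi (2 * (int k + 1)\<^sup>2) * pp (Suc k) * (w ^ Suc k - 1 / w ^ Suc k))"
    using has_sum_unique[OF hs has_sum_cmult_right[OF has_sum_infsum[OF sm]]] .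
  with 1 show "((\<lambda>t. (-1) powi t * q powi (18 * t\<^sup>2) * h (nat \<bar>3 * t\<bar>)) has_sum
     (Z 1 / (w - 1 / w) * (\<Sum>\<^sub>\<infinity>k. q powi (2 * (int k + 1)\<^sup>2) * pp (Suc k) * (w ^ Suc k - 1 / w ^ Suc k)))) UNIV"
    by simp
qed

end

section \<open>Evaluation of the bilateral sum\<close>

lemma has_sum_int_split:
  fixes f :: "int \<Rightarrow> 'a :: real_normed_vector"
  assumes "((\<lambda>n. f (int n + 1)) has_sum S) UNIV" "((\<lambda>n. f (- int n - 1)) has_sum S') UNIV"
  shows "(f has_sum (f 0 + (S + S'))) UNIV"
proof -
  have "(f has_sum S) {1..} \<longleftrightarrow> ((\<lambda>n. f (int n + 1)) has_sum S) UNIV"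
    by (rule has_sum_reindex_bij_witness[of _ "\<lambda>n. int n + 1" "\<lambda>k. nat (k - 1)"]) auto
  moreover have "(f has_sum S') {..-1} \<longleftrightarrow> ((\<lambda>n. f (- int n - 1)) has_sum S') UNIV"
    by (rule has_sum_reindex_bij_witness[of _ "\<lambda>n. - int n - 1" "\<lambda>k. nat (- k - 1)"]) auto
  ultimately have "(f has_sum (f 0 + (S + S'))) ({0} \<union> ({1..} \<union> {..-1}))"
    using assms by (intro has_sum_Un_disjoint) (auto simp: has_sum_finite_iff)
  also have "{0} \<union> ({1..} \<union> {..-1}) = (UNIV :: int set)" by auto
  finally show ?thesis .
qed

lemma has_sum_geometric: "norm (x :: complex) < 1 \<Longrightarrow> ((\<lambda>n. x ^ n) has_sum (1 / (1 - x))) UNIV"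
  by (rule norm_summable_imp_has_sum) (auto simp: norm_power intro: geometric_sums)

context nome begin

text \<open>Subtracting 1 leaves gam - 1 = x / (1 - x) with x = q^(2(3t+c)), a geometric series. In
  the other order the sum over t is geometric with ratio -(q^(2(j+1)))^3.\<close>

lemma lambert_swap:
  assumes c: "c > 0"
  obtains S where "((\<lambda>t. (-1) ^ t * (gam (3 * int t + int c) - 1)) has_sum S) UNIV"
    "((\<lambda>j. (q\<^sup>2 ^ Suc j) ^ c / (1 + (q\<^sup>2 ^ Suc j) ^ 3)) has_sum S) UNIV"
proof -
  define f where "f = (\<lambda>t j. (-1) ^ t * (q\<^sup>2 ^ Suc j) ^ (3 * t + c))"
  define r where "r = norm q ^ 2"
  have r: "0 < r" "r < 1" using q0 q1 by (auto simp: r_def power_less_one_iff)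
  have Q: "norm (q\<^sup>2 ^ Suc j) < 1" for j
    using q1 by (simp add: norm_power power_less_one_iff flip: power_mult power_Suc del: power_Suc)
  have "(\<lambda>(t, j). f t j) summable_on (UNIV \<times> UNIV)"
  proof (rule abs_summable_summable, rule Infinite_Sum.abs_summable_on_comparison_test')
    show "(\<lambda>(t, j). r ^ t * r ^ j) summable_on (UNIV \<times> UNIV)"
      using r by (intro summable_on_times summable_nonneg_imp_summable_on summable_geometric) auto
    fix x :: "nat \<times> nat"
    obtain t j where [simp]: "x = (t, j)" by (cases x)
    have "norm (f t j) = r ^ (Suc j * (3 * t + c))" by (simp only: f_def norm_mult norm_power norm_minus_cancel norm_one power_one mult_1_left r_def power_mult)
    also have "t + j \<le> Suc j * (3 * t + c)" using c by (cases c) (simp_all add: algebra_simps)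
    hence "r ^ (Suc j * (3 * t + c)) \<le> r ^ (t + j)" using r by (intro power_decreasing) auto
    finally show "norm (case x of (t, j) \<Rightarrow> f t j) \<le> (case x of (t, j) \<Rightarrow> r ^ t * r ^ j)" by (simp add: power_add)
  qed
  then obtain S where S: "((\<lambda>(t, j). f t j) has_sum S) (UNIV \<times> UNIV)" by (auto simp: summable_on_def)
  hence S': "((\<lambda>(j, t). f t j) has_sum S) (UNIV \<times> UNIV)" using has_sum_swap[of "\<lambda>(t, j). f t j" UNIV UNIV S] by simp
  have 1: "((\<lambda>t. (-1) ^ t * (gam (3 * int t + int c) - 1)) has_sum S) UNIV"
  proof (rule has_sum_SigmaD[OF S])
    fix t
    define x where "x = q\<^sup>2 ^ (3 * t + c)"
    have x: "norm x < 1" using q1 c by (simp add: x_def norm_power power_less_one_iff flip: power_mult)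
    have "q powi (2 * (3 * int t + int c)) = q powi (int (2 * (3 * t + c)))" by simp
    also have "\<dots> = x" unfolding power_int_of_nat x_def by (rule power_mult)
    finally have "gam (3 * int t + int c) = 1 / (1 - x)" using c by (simp add: gam_def)
    moreover have "x \<noteq> 1" using x by auto
    hence "1 / (1 - x) - 1 = x * (1 / (1 - x))" by (simp add: divide_simps)
    ultimately have g: "gam (3 * int t + int c) - 1 = x * (1 / (1 - x))" by simp
    have "((\<lambda>j. (-1) ^ t * (x * x ^ j)) has_sum ((-1) ^ t * (x * (1 / (1 - x))))) UNIV"
      by (intro has_sum_cmult_right has_sum_geometric x)
    moreover have "(-1) ^ t * (x * x ^ j) = f t j" for j
    proof -
      have "x * x ^ j = (q\<^sup>2) ^ ((3 * t + c) * Suc j)" unfolding power_mult x_def by simp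
      also have "\<dots> = (q\<^sup>2 ^ Suc j) ^ (3 * t + c)" by (metis mult.commute power_mult)
      finally show ?thesis by (simp add: f_def)
    qed
    ultimately show "((\<lambda>j. case (t, j) of (t, j) \<Rightarrow> f t j) has_sum ((-1) ^ t * (gam (3 * int t + int c) - 1))) UNIV"
      by (simp add: g)
  qed
  have 2: "((\<lambda>j. (q\<^sup>2 ^ Suc j) ^ c / (1 + (q\<^sup>2 ^ Suc j) ^ 3)) has_sum S) UNIV"
  proof (rule has_sum_SigmaD[OF S'])
    fix j
    define x where "x = q\<^sup>2 ^ Suc j"
    have "norm (- (x ^ 3)) < 1" using Q[of j] by (simp add: x_def norm_power power_less_one_iff del: power_Suc)
    hence "((\<lambda>t. x ^ c * (- (x ^ 3)) ^ t) has_sum (x ^ c * (1 / (1 - - (x ^ 3))))) UNIV"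
      by (intro has_sum_cmult_right has_sum_geometric)
    moreover have "x ^ c * (- (x ^ 3)) ^ t = f t j" for t
    proof -
      have "(- (x ^ 3)) ^ t = (-1) ^ t * x ^ (3 * t)" unfolding power_mult by (rule power_minus)
      thus ?thesis unfolding f_def x_def[symmetric] by (simp only: power_add mult_ac)
    qed
    ultimately show "((\<lambda>t. case (j, t) of (j, t) \<Rightarrow> f t j) has_sum ((q\<^sup>2 ^ Suc j) ^ c / (1 + (q\<^sup>2 ^ Suc j) ^ 3))) UNIV"
      by (simp add: x_def)
  qed
  show ?thesis using that[OF 1 2] .
qed

lemma powi_ne_minus_1: "q powi m \<noteq> -1"
proof
  assume *: "q powi m = -1"
  have "q powi (m + m) = 1" unfolding power_int_add[OF disjI1[OF q0]] * by simp
  hence "m = 0" using powi_ne_1[of "m + m"] by auto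
  thus False using * by simp
qed

text \<open>Folding t with -t expresses Z 1 by the series of \<open>lambert_swap\<close> for c = 1
  and c = 2. These are the parts n >= 1 and n <= -1 of Kronecker's sum with x = q^2, y = -1 and base
  q^6, whose term n = 0 is 1/2.\<close>

lemma Z_1: "Z 1 = 2 * (qp (q ^ 6) (q ^ 6) ^ 3 * jt (- (q\<^sup>2)) (q ^ 6) / (jt (q\<^sup>2) (q ^ 6) * jt (-1) (q ^ 6)))"
proof -
  obtain \<alpha> where a: "((\<lambda>t. (-1) ^ t * (gam (3 * int t + int 1) - 1)) has_sum \<alpha>) UNIV"
    "((\<lambda>j. (q\<^sup>2 ^ Suc j) ^ 1 / (1 + (q\<^sup>2 ^ Suc j) ^ 3)) has_sum \<alpha>) UNIV" using lambert_swap[of 1] by auto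
  obtain \<beta> where b: "((\<lambda>t. (-1) ^ t * (gam (3 * int t + int 2) - 1)) has_sum \<beta>) UNIV"
    "((\<lambda>j. (q\<^sup>2 ^ Suc j)\<^sup>2 / (1 + (q\<^sup>2 ^ Suc j) ^ 3)) has_sum \<beta>) UNIV" using lambert_swap[of 2] by auto
  define g where "g = (\<lambda>t. (-1) powi t * cc 1 (3 * t))"
  \<comment> \<open>The kernel at 3(t + 1) pairs the arguments 3(t + 1) + 1 and 3t + 2, so the first
    series starts one step later and loses its term t = 0.\<close>
  define T where "T = \<alpha> - (gam 1 - 1) + \<beta>"
  have "((\<lambda>t. (-1) ^ t * (gam (3 * int t + int 1) - 1)) has_sum (\<alpha> - (gam 1 - 1))) {1..}"
  proof -
    have "((\<lambda>t. (-1) ^ t * (gam (3 * int t + int 1) - 1)) has_sum (\<alpha> - (gam 1 - 1))) (UNIV - {0})"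
      using has_sum_Diff[OF a(1), of "{0}" "gam 1 - 1"] by (simp add: has_sum_finite_iff)
    also have "UNIV - {0} = {1 :: nat..}" by auto
    finally show ?thesis .
  qed
  also have "?this \<longleftrightarrow> ((\<lambda>t. (-1) ^ Suc t * (gam (3 * int (Suc t) + int 1) - 1)) has_sum (\<alpha> - (gam 1 - 1))) UNIV"
    by (rule has_sum_reindex_bij_witness[of _ Suc "\<lambda>t. t - 1"]) auto
  finally have "((\<lambda>t. (-1) ^ Suc t * (gam (3 * int (Suc t) + int 1) - 1) + (-1) ^ t * (gam (3 * int t + int 2) - 1)) has_sum T) UNIV"
    unfolding T_def by (intro has_sum_add b(1))
  also have "(\<lambda>t. (-1) ^ Suc t * (gam (3 * int (Suc t) + int 1) - 1) + (-1) ^ t * (gam (3 * int t + int 2) - 1)) = (\<lambda>t. g (int t + 1))"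
  proof
    fix t
    have "(-1 :: complex) powi (int t + 1) = (-1) ^ Suc t" by (simp add: power_int_add)
    moreover have "cc 1 (3 * (int t + 1)) = gam (3 * int (Suc t) + int 1) - gam (3 * int t + int 2)"
      using gam_minus[of "3 * int t + 2"] gam_minus[of "3 * int (Suc t) + 1"] by (simp add: cc_def algebra_simps)
    ultimately show "(-1) ^ Suc t * (gam (3 * int (Suc t) + int 1) - 1) + (-1) ^ t * (gam (3 * int t + int 2) - 1) = g (int t + 1)"
      unfolding g_def by (simp only:) (simp add: algebra_simps)
  qed
  finally have g1: "((\<lambda>t. g (int t + 1)) has_sum T) UNIV" .
  have "g (- int t - 1) = g (int t + 1)" for t
  proof -
    have e: "- int t - 1 = - (int t + 1)" by simp
    have "(-1 :: complex) powi (- (int t + 1)) = (-1) powi (int t + 1)"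
      unfolding power_int_minus by (simp flip: power_int_inverse)
    thus ?thesis unfolding g_def e mult_minus_right cc_even by simp
  qed
  hence "(g has_sum (g 0 + (T + T))) UNIV" using g1 by (intro has_sum_int_split) simp_all
  hence "Z 1 = g 0 + (T + T)" by (simp add: Z_def g_def infsumI)
  also have "g 0 = 2 * gam 1 - 1" using gam_minus[of 1] by (simp add: g_def cc_def)
  finally have Z1: "Z 1 = 1 + 2 * (\<alpha> + \<beta>)" by (simp add: T_def algebra_simps)
  define K where "K = (\<lambda>n. (q\<^sup>2) powi n / (1 - (-1) * (q ^ 6) powi n))"
  have K: "(K has_sum (qp (q ^ 6) (q ^ 6) ^ 3 * jt (q\<^sup>2 * -1) (q ^ 6) / (jt (q\<^sup>2) (q ^ 6) * jt (-1) (q ^ 6)))) UNIV"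
    unfolding K_def
  proof (rule kronecker)
    have "norm q ^ 6 < norm q ^ 2" using q0 q1 by (intro power_strict_decreasing) auto
    thus "norm (q ^ 6) < norm (q\<^sup>2)" by (simp add: norm_power)
    show "norm (q\<^sup>2) < 1" using q1 by (simp add: norm_power power_less_one_iff)
    show "- 1 * (q ^ 6) powi m \<noteq> 1" for m
      using powi_ne_minus_1[of "6 * m"] by (simp add: power_int_power minus_equation_iff[of _ 1])
  qed (use q0 in auto)
  have "((\<lambda>n. K (int n + 1)) has_sum \<alpha>) UNIV"
  proof -
    have "K (int n + 1) = (q\<^sup>2 ^ Suc n) ^ 1 / (1 + (q\<^sup>2 ^ Suc n) ^ 3)" for n
    proof -
      have "int n + 1 = int (Suc n)" by simp
      moreover have "(q ^ 6) ^ Suc n = (q\<^sup>2 ^ Suc n) ^ 3" by (simp only: flip: power_mult) (simp add: mult.commute)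
      ultimately show ?thesis by (simp only: K_def power_int_of_nat) simp
    qed
    thus ?thesis using a(2) by simp
  qed
  moreover have "((\<lambda>n. K (- int n - 1)) has_sum \<beta>) UNIV"
  proof -
    have "K (- int n - 1) = (q\<^sup>2 ^ Suc n)\<^sup>2 / (1 + (q\<^sup>2 ^ Suc n) ^ 3)" for n
    proof -
      define x where "x = q\<^sup>2 ^ Suc n"
      have e: "- int n - 1 = - int (Suc n)" by simp
      have x3: "(q ^ 6) ^ Suc n = x ^ 3" unfolding x_def by (simp only: flip: power_mult) (simp add: mult.commute)
      have x0: "x \<noteq> 0" using q0 by (simp add: x_def)
      have "x ^ 3 = q powi int (6 * Suc n)" unfolding power_int_of_nat power_mult x3 ..
      hence "x ^ 3 \<noteq> -1" using powi_ne_minus_1 by metis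
      hence "1 + x ^ 3 \<noteq> 0" by (simp add: add_eq_0_iff)
      moreover have "K (- int n - 1) = inverse x / (1 + inverse (x ^ 3))"
        unfolding K_def e power_int_minus power_int_of_nat x3 x_def by simp
      ultimately show ?thesis unfolding x_def[symmetric] using x0
        by (simp add: divide_simps add.commute) (simp add: power2_eq_square power3_eq_cube)
    qed
    thus ?thesis using b(2) by simp
  qed
  ultimately have "(K has_sum (K 0 + (\<alpha> + \<beta>))) UNIV" by (rule has_sum_int_split)
  from has_sum_unique[OF this K]
  have e: "1 / 2 + (\<alpha> + \<beta>) = qp (q ^ 6) (q ^ 6) ^ 3 * jt (- (q\<^sup>2)) (q ^ 6) / (jt (q\<^sup>2) (q ^ 6) * jt (-1) (q ^ 6))"
    by (simp add: K_def)
  have "Z 1 = 2 * (1 / 2 + (\<alpha> + \<beta>))" unfolding Z1 by (simp add: algebra_simps)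
  thus ?thesis unfolding e .
qed

end

text \<open>1 / (1 - y p^n) is expanded in powers of y p^n for n >= 0 and of its inverse for n < 0;
  the annulus condition on y makes both expansions converge.\<close>

lemma kronecker_double:
  assumes p: "p \<noteq> 0" and x: "norm p < norm x" "norm x < 1" and y: "norm p < norm y" "norm y < 1"
  shows "((\<lambda>(n, m). x ^ n * y ^ m * p ^ (n * m) - p ^ (Suc n * Suc m) / (x ^ Suc n * y ^ Suc m)) has_sum
     (qp p p ^ 3 * jt (x * y) p / (jt x p * jt y p))) (UNIV \<times> UNIV)"
proof -
  have p1: "norm p < 1" using x by linarith
  have x0: "x \<noteq> 0" and y0: "y \<noteq> 0" using x y by auto
  have pn: "norm (y * p ^ n) < 1" for n
  proof -
    have "norm y * norm p ^ n \<le> norm y * 1" using p1 by (intro mult_left_mono power_le_one) auto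
    thus ?thesis using y by (simp add: norm_mult norm_power)
  qed
  have pm: "norm (p ^ Suc n / y) < 1" for n
  proof -
    have "norm p ^ Suc n \<le> norm p ^ 1" using p1 by (intro power_decreasing) auto
    thus ?thesis using y y0 by (simp add: norm_divide norm_power divide_simps del: power_Suc)
  qed
  have ny: "y * p powi m \<noteq> 1" for m
  proof (cases "m \<ge> 0")
    case True
    thus ?thesis using pn[of "nat m"] by (auto simp: power_int_def)
  next
    case False
    define k where "k = nat (- m - 1)"
    have m: "m = - int (Suc k)" using False by (simp add: k_def)
    show ?thesis
    proof
      assume "y * p powi m = 1"
      hence "p ^ Suc k / y = 1" unfolding m power_int_minus power_int_of_nat using p y0 by (simp add: field_simps)
      thus False using pm[of k] by simp
    qed
  qed
  have K: "((\<lambda>n. x powi n / (1 - y * p powi n)) has_sum (qp p p ^ 3 * jt (x * y) p / (jt x p * jt y p))) UNIV"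
    by (rule kronecker) (use p x y0 ny in auto)
  define f where "f = (\<lambda>n m. x ^ n * y ^ m * p ^ (n * m))"
  define g where "g = (\<lambda>n m. p ^ (Suc n * Suc m) / (x ^ Suc n * y ^ Suc m))"
  have geo: "(\<lambda>n. r ^ n) summable_on UNIV" if "0 \<le> r" "r < 1" for r :: real
    using that by (intro summable_nonneg_imp_summable_on summable_geometric) auto
  have f: "(\<lambda>(n, m). f n m) summable_on (UNIV \<times> UNIV)"
  proof (rule abs_summable_summable, rule Infinite_Sum.abs_summable_on_comparison_test')
    show "(\<lambda>(n, m). norm x ^ n * norm y ^ m) summable_on (UNIV \<times> UNIV)"
      using x y by (intro summable_on_times geo) auto
    show "norm (case z of (n, m) \<Rightarrow> f n m) \<le> (case z of (n, m) \<Rightarrow> norm x ^ n * norm y ^ m)" for z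
    proof -
      have "norm p ^ (n * m) \<le> 1" for n m using p1 by (intro power_le_one) auto
      hence "norm x ^ n * norm y ^ m * norm p ^ (n * m) \<le> norm x ^ n * norm y ^ m * 1" for n m
        by (intro mult_left_mono) auto
      thus ?thesis by (cases z) (simp add: f_def norm_mult norm_power)
    qed
  qed
  have g: "(\<lambda>(n, m). g n m) summable_on (UNIV \<times> UNIV)"
  proof (rule abs_summable_summable, rule Infinite_Sum.abs_summable_on_comparison_test')
    show "(\<lambda>(n, m). (norm p / norm x) ^ Suc n * (1 / norm y * (norm p / norm y) ^ m)) summable_on (UNIV \<times> UNIV)"
      unfolding power_Suc using x y x0 y0 by (intro summable_on_times summable_on_cmult_right geo) auto
    show "norm (case z of (n, m) \<Rightarrow> g n m) \<le> (case z of (n, m) \<Rightarrow> (norm p / norm x) ^ Suc n * (1 / norm y * (norm p / norm y) ^ m))" for z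
    proof (cases z)
      case (Pair n m)
      have "norm p ^ (Suc n * Suc m) \<le> norm p ^ (Suc n + m)" using p1 by (intro power_decreasing) auto
      hence "norm p ^ (Suc n * Suc m) / (norm x ^ Suc n * norm y ^ Suc m) \<le> norm p ^ (Suc n + m) / (norm x ^ Suc n * norm y ^ Suc m)"
        by (intro divide_right_mono) auto
      also have "\<dots> = (norm p / norm x) ^ Suc n * (1 / norm y * (norm p / norm y) ^ m)"
        by (simp only: power_add power_divide times_divide_times_eq mult_1_left power_Suc mult_ac)
      finally show ?thesis by (simp add: Pair g_def norm_mult norm_power norm_divide del: power_Suc mult_Suc)
    qed
  qed
  define S where "S = infsum (\<lambda>(n, m). f n m) (UNIV \<times> UNIV)"
  define S' where "S' = infsum (\<lambda>(n, m). g n m) (UNIV \<times> UNIV)"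
  have hS: "((\<lambda>(n, m). f n m) has_sum S) (UNIV \<times> UNIV)" and hS': "((\<lambda>(n, m). g n m) has_sum S') (UNIV \<times> UNIV)"
    unfolding S_def S'_def by (intro has_sum_infsum f g)+
  have a: "((\<lambda>n. x powi int n / (1 - y * p powi int n)) has_sum S) UNIV"
  proof (rule has_sum_SigmaD[OF hS])
    fix n
    have "((\<lambda>m. x ^ n * (y * p ^ n) ^ m) has_sum (x ^ n * (1 / (1 - y * p ^ n)))) UNIV"
      by (intro has_sum_cmult_right has_sum_geometric pn)
    thus "((\<lambda>m. case (n, m) of (n, m) \<Rightarrow> f n m) has_sum (x powi int n / (1 - y * p powi int n))) UNIV"
      by (simp add: f_def power_mult power_mult_distrib mult.assoc)
  qed
  have b: "((\<lambda>n. x powi (- int n - 1) / (1 - y * p powi (- int n - 1))) has_sum (- S')) UNIV"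
  proof -
    have "((\<lambda>n. - (x powi (- int n - 1) / (1 - y * p powi (- int n - 1)))) has_sum S') UNIV"
    proof (rule has_sum_SigmaD[OF hS'])
      fix n
      define u where "u = p ^ Suc n / y"
      have u: "norm u < 1" using pm by (simp add: u_def)
      have "((\<lambda>m. u / x ^ Suc n * u ^ m) has_sum (u / x ^ Suc n * (1 / (1 - u)))) UNIV"
        by (intro has_sum_cmult_right has_sum_geometric u)
      moreover have "u / x ^ Suc n * u ^ m = g n m" for m
      proof -
        have "u / x ^ Suc n * u ^ m = u ^ Suc m / x ^ Suc n" by simp
        also have "u ^ Suc m = p ^ (Suc n * Suc m) / y ^ Suc m" unfolding u_def power_divide power_mult ..
        finally show ?thesis by (simp only: g_def divide_divide_eq_left mult.commute[of "y ^ Suc m"])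
      qed
      moreover have "u / x ^ Suc n * (1 / (1 - u)) = - (x powi (- int n - 1) / (1 - y * p powi (- int n - 1)))"
      proof -
        have e: "- int n - 1 = - int (Suc n)" by simp
        have "p ^ Suc n \<noteq> 0" "y \<noteq> p ^ Suc n" using p u y0 by (auto simp: u_def)
        thus ?thesis unfolding e power_int_minus power_int_of_nat u_def using x0 y0
          by (simp add: divide_simps del: power_Suc) (simp add: algebra_simps del: power_Suc)
      qed
      ultimately show "((\<lambda>m. case (n, m) of (n, m) \<Rightarrow> g n m) has_sum (- (x powi (- int n - 1) / (1 - y * p powi (- int n - 1))))) UNIV" by simp
    qed
    from has_sum_uminusI[OF this] show ?thesis by simp
  qed
  define F where "F = (\<lambda>n. x powi n / (1 - y * p powi n))"
  have a': "((\<lambda>n. F (int n + 1)) has_sum (S - F 0)) UNIV"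
  proof -
    have "((\<lambda>n. F (int n)) has_sum (S - F 0)) (UNIV - {0})"
    proof -
      have "((\<lambda>n. F (int n)) has_sum S) UNIV" using a by (simp add: F_def)
      from has_sum_Diff[OF this, of "{0}" "F 0"] show ?thesis by (simp add: has_sum_finite_iff)
    qed
    also have "?this \<longleftrightarrow> ((\<lambda>n. F (int n + 1)) has_sum (S - F 0)) UNIV"
      by (rule has_sum_reindex_bij_witness[of _ Suc "\<lambda>t. t - 1"]) (auto simp: add.commute)
    finally show ?thesis .
  qed
  have "(F has_sum (F 0 + ((S - F 0) + - S'))) UNIV"
    using a' b by (intro has_sum_int_split) (simp_all add: F_def)
  with K have "S - S' = qp p p ^ 3 * jt (x * y) p / (jt x p * jt y p)"
    unfolding F_def using has_sum_unique by fastforce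
  moreover have "((\<lambda>z. (case z of (n, m) \<Rightarrow> f n m) + - (case z of (n, m) \<Rightarrow> g n m)) has_sum (S + - S')) (UNIV \<times> UNIV)"
    by (intro has_sum_add hS) (use hS' in \<open>simp add: has_sum_uminus\<close>)
  ultimately show ?thesis by (simp add: f_def g_def case_prod_unfold)
qed

section \<open>The theta-weighted partial sums as Kronecker double series\<close>

lemma sum_step_two:
  fixes g :: "int \<Rightarrow> complex"
  shows "(\<Sum>a\<le>k + 2. g (int (k + 2) - 2 * int a)) = (\<Sum>a\<le>k. g (int k - 2 * int a)) + g (int k + 2) + g (- int k - 2)"
proof -
  have "(\<Sum>a\<le>k + 2. g (int (k + 2) - 2 * int a)) = (\<Sum>a\<le>Suc k. g (int (k + 2) - 2 * int a)) + g (- int k - 2)"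
    by (simp add: numeral_2_eq_2 algebra_simps)
  also have "(\<Sum>a\<le>Suc k. g (int (k + 2) - 2 * int a)) = g (int k + 2) + (\<Sum>a\<le>k. g (int k - 2 * int a))"
    unfolding sum.atMost_Suc_shift by (simp add: algebra_simps)
  finally show ?thesis by (simp add: algebra_simps)
qed

context nome begin

text \<open>As d = k - 2a runs through k, k - 2, ..., -k, the arguments 2d + 1 and 2d - 1, with
  negative x replaced by 1 - x, run once through 1, ..., 2k + 2. Passing from k to k + 2 adds only d
  = k + 2 and d = -k - 2.\<close>

lemma pp_as_double_sum:
  "(\<Sum>a\<le>k. q powi (- tri (2 * (int k - 2 * int a) + 1)) + q powi (- tri (2 * (int k - 2 * int a) - 1))) = pp (Suc k)"
proof (induction k rule: nat_less_induct)
  case (1 k)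
  consider "k = 0" | "k = 1" | m where "k = m + 2"
    by (metis One_nat_def add_2_eq_Suc' less_Suc0 not_less_eq numeral_2_eq_2 old.nat.exhaust)
  thus ?case
  proof cases
    case 1
    moreover have "(\<Sum>i<2. f i) = f 0 + f 1" for f :: "nat \<Rightarrow> complex" by (simp add: numeral_eq_Suc)
    ultimately show ?thesis by (simp add: pp_def)
  next
    case 2
    moreover have "(\<Sum>i<4. f i) = f 0 + f 1 + f 2 + f 3" for f :: "nat \<Rightarrow> complex" by (simp add: numeral_eq_Suc)
    moreover have "tri (-3) = tri 4" using tri_reflect[of 4] by simp
    ultimately show ?thesis by (simp add: pp_def)
  next
    case 3
    define g where "g = (\<lambda>d. q powi (- tri (2 * d + 1)) + q powi (- tri (2 * d - 1)))"
    have "(\<Sum>a\<le>k. g (int k - 2 * int a)) = pp (Suc m) + g (int m + 2) + g (- int m - 2)"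
      using sum_step_two[of g m] 1 3 by (simp add: g_def)
    moreover have "2 * (- int m - 2) + 1 = 1 - (2 * int m + 4)" "2 * (- int m - 2) - 1 = 1 - (2 * int m + 6)" by simp_all
    hence "tri (2 * (- int m - 2) + 1) = tri (2 * int m + 4)" "tri (2 * (- int m - 2) - 1) = tri (2 * int m + 6)"
      by (simp_all only: tri_reflect)
    hence "g (- int m - 2) = q powi (- tri (2 * int m + 4)) + q powi (- tri (2 * int m + 6))" by (simp add: g_def)
    moreover have "g (int m + 2) = q powi (- tri (2 * int m + 5)) + q powi (- tri (2 * int m + 3))"
      by (simp add: g_def algebra_simps)
    moreover have "pp (Suc k) = pp (Suc m) + (q powi (- tri (2 * int m + 3)) + q powi (- tri (2 * int m + 4))
        + q powi (- tri (2 * int m + 5)) + q powi (- tri (2 * int m + 6)))"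
      by (simp add: pp_def 3 algebra_simps numeral_eq_Suc)
    ultimately show ?thesis by (simp add: g_def)
  qed
qed

text \<open>With k = a + b and d = b - a, 2(a + b)^2 - 2(b - a)^2 = 8ab: the exponent takes the
  shape of Kronecker's double series with base q^8.\<close>

lemma pp_as_double_sum':
  "(\<Sum>a\<le>k. q ^ (8 * (a * (k - a)) + 5 * a + 3 * (k - a) + 2) + q ^ (8 * (a * (k - a)) + a + 7 * (k - a) + 1))
     = q powi (2 * (int k + 1)\<^sup>2) * pp (Suc k)"
  unfolding pp_as_double_sum[symmetric] sum_distrib_left
proof (rule sum.cong)
  fix a assume "a \<in> {..k}"
  then obtain b where k: "k = a + b" by (auto simp: le_iff_add)
  define d where "d = int b - int a"
  have d: "int k - 2 * int a = d" by (simp add: k d_def)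
  have t: "tri (2 * d + 1) = 2 * d\<^sup>2 + d" "tri (2 * d - 1) = 2 * d\<^sup>2 - 3 * d + 1"
    using two_tri[of "2 * d + 1"] two_tri[of "2 * d - 1"] by (simp_all add: algebra_simps power2_eq_square)
  have e: "2 * (int k + 1)\<^sup>2 + - tri (2 * d + 1) = int (8 * (a * b) + 5 * a + 3 * b + 2)"
          "2 * (int k + 1)\<^sup>2 + - tri (2 * d - 1) = int (8 * (a * b) + a + 7 * b + 1)"
    unfolding t by (simp_all add: k d_def power2_eq_square algebra_simps)
  have "q powi (2 * (int k + 1)\<^sup>2) * (q powi (- tri (2 * d + 1)) + q powi (- tri (2 * d - 1)))
     = q ^ (8 * (a * b) + 5 * a + 3 * b + 2) + q ^ (8 * (a * b) + a + 7 * b + 1)"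
    unfolding distrib_left power_int_add[OF disjI1[OF q0], symmetric] e power_int_of_nat ..
  thus "q ^ (8 * (a * (k - a)) + 5 * a + 3 * (k - a) + 2) + q ^ (8 * (a * (k - a)) + a + 7 * (k - a) + 1)
     = q powi (2 * (int k + 1)\<^sup>2) * (q powi (- tri (2 * (int k - 2 * int a) + 1)) + q powi (- tri (2 * (int k - 2 * int a) - 1)))"
    unfolding d by (simp add: k)
qed simp

text \<open>The two double series are Kronecker's at (w q^5, w q^3) and (w q, w q^7). Grouped by k =
  a + b, the positive half carries w^(k+1) and the subtracted half w^(-k-1), which produces the
  antisymmetric factor.\<close>

lemma theta_pp_sum:
  assumes w: "norm w = 1"
  shows "(\<Sum>\<^sub>\<infinity>k. q powi (2 * (int k + 1)\<^sup>2) * pp (Suc k) * (w ^ Suc k - 1 / w ^ Suc k)) =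
    w * qp (q ^ 8) (q ^ 8) ^ 3 * jt (w\<^sup>2 * q ^ 8) (q ^ 8) *
      (q\<^sup>2 / (jt (w * q ^ 5) (q ^ 8) * jt (w * q ^ 3) (q ^ 8)) + q / (jt (w * q) (q ^ 8) * jt (w * q ^ 7) (q ^ 8)))"
proof -
  have w0: "w \<noteq> 0" using w by auto
  define c where "c = (\<lambda>r s m. \<lambda>(a, b). w * q ^ m * ((w * q ^ r) ^ a * (w * q ^ s) ^ b * (q ^ 8) ^ (a * b)
      - (q ^ 8) ^ (Suc a * Suc b) / ((w * q ^ r) ^ Suc a * (w * q ^ s) ^ Suc b)))"
  have c: "(c r s m has_sum w * q ^ m * (qp (q ^ 8) (q ^ 8) ^ 3 * jt (w * q ^ r * (w * q ^ s)) (q ^ 8) / (jt (w * q ^ r) (q ^ 8) * jt (w * q ^ s) (q ^ 8)))) (UNIV \<times> UNIV)"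
    if "r > 0" "s > 0" "r < 8" "s < 8" for r s m
  proof -
    have l: "norm (q ^ 8) < norm (w * q ^ r)" "norm (w * q ^ r) < 1" if "0 < r" "r < 8" for r
      using w q1 q0 that by (auto simp: norm_mult norm_power power_less_one_iff intro: power_strict_decreasing)
    show ?thesis
      using has_sum_cmult_right[OF kronecker_double[OF _ l[OF that(1,3)] l[OF that(2,4)]], of "w * q ^ m"] q0
      by (simp add: c_def case_prod_unfold)
  qed
  \<comment> \<open>Because r + s = 8, the subtracted term is the positive one with w inverted and
    r, s exchanged; the reflection a -> k - a (\<open>rev\<close>) undoes the exchange.\<close>
  have ceq: "c r s m (a, b) = w ^ Suc (a + b) * q ^ (8 * (a * b) + r * a + s * b + m) - (1 / w ^ Suc (a + b)) * q ^ (8 * (a * b) + s * a + r * b + m)"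
    if rs: "r + s = 8" for r s m a b
  proof -
    have 1: "w * q ^ m * ((w * q ^ r) ^ a * (w * q ^ s) ^ b * (q ^ 8) ^ (a * b)) = w ^ Suc (a + b) * q ^ (8 * (a * b) + r * a + s * b + m)"
      by (simp add: power_mult_distrib power_add mult_ac flip: power_mult)
    have r: "r * x + s * x = 8 * x" for x using rs by (metis distrib_right)
    have "8 * (Suc a * Suc b) + m = (8 * (a * b) + s * a + r * b + m) + (r * Suc a + s * Suc b)"
      using r[of a] r[of b] rs by (simp add: algebra_simps)
    hence "(q ^ 8) ^ (Suc a * Suc b) * q ^ m = q ^ (8 * (a * b) + s * a + r * b + m) * q ^ (r * Suc a + s * Suc b)"
      by (simp only: power_mult[symmetric] power_add[symmetric])
    hence "w * q ^ m * ((q ^ 8) ^ (Suc a * Suc b) / ((w * q ^ r) ^ Suc a * (w * q ^ s) ^ Suc b))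
       = w * (q ^ (8 * (a * b) + s * a + r * b + m) * q ^ (r * Suc a + s * Suc b)) / ((w * q ^ r) ^ Suc a * (w * q ^ s) ^ Suc b)"
      by (simp only: times_divide_eq_right mult_ac)
    also have D: "(w * q ^ r) ^ Suc a * (w * q ^ s) ^ Suc b = w * w ^ Suc (a + b) * q ^ (r * Suc a + s * Suc b)"
    proof -
      have "(w * q ^ r) ^ Suc a * (w * q ^ s) ^ Suc b = (w ^ Suc a * w ^ Suc b) * (q ^ (r * Suc a) * q ^ (s * Suc b))"
        by (simp only: power_mult_distrib power_mult mult_ac)
      also have "w ^ Suc a * w ^ Suc b = w * w ^ Suc (a + b)" by (simp add: power_add mult_ac)
      finally show ?thesis by (simp only: power_add)
    qed
    also have "w * (q ^ (8 * (a * b) + s * a + r * b + m) * q ^ (r * Suc a + s * Suc b)) / (w * w ^ Suc (a + b) * q ^ (r * Suc a + s * Suc b))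
       = (1 / w ^ Suc (a + b)) * q ^ (8 * (a * b) + s * a + r * b + m)"
      using w0 q0 by (simp add: divide_simps)
    finally show ?thesis unfolding c_def prod.case right_diff_distrib 1 D by (simp only:)
  qed
  define S where "S = w * q\<^sup>2 * (qp (q ^ 8) (q ^ 8) ^ 3 * jt (w * q ^ 5 * (w * q ^ 3)) (q ^ 8) / (jt (w * q ^ 5) (q ^ 8) * jt (w * q ^ 3) (q ^ 8)))
     + w * q ^ 1 * (qp (q ^ 8) (q ^ 8) ^ 3 * jt (w * q ^ 1 * (w * q ^ 7)) (q ^ 8) / (jt (w * q ^ 1) (q ^ 8) * jt (w * q ^ 7) (q ^ 8)))"
  have "((\<lambda>x. c 5 3 2 x + c 1 7 1 x) has_sum S) (UNIV \<times> UNIV)"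
    unfolding S_def by (intro has_sum_add c) auto
  also have "?this \<longleftrightarrow> ((\<lambda>(k, a). c 5 3 2 (a, k - a) + c 1 7 1 (a, k - a)) has_sum S) (Sigma UNIV (\<lambda>k. {..k}))"
    by (rule has_sum_reindex_bij_witness[of _ "\<lambda>(k, a). (a, k - a)" "\<lambda>(a, b). (a + b, a)"]) auto
  finally have *: "((\<lambda>(k, a). c 5 3 2 (a, k - a) + c 1 7 1 (a, k - a)) has_sum S) (Sigma UNIV (\<lambda>k. {..k}))" .
  have "((\<lambda>k. q powi (2 * (int k + 1)\<^sup>2) * pp (Suc k) * (w ^ Suc k - 1 / w ^ Suc k)) has_sum S) UNIV"
  proof (rule has_sum_SigmaD[OF *])
    fix k
    define e where "e = (\<lambda>r s m a. q ^ (8 * (a * (k - a)) + r * a + s * (k - a) + m))"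
    have rev: "(\<Sum>a\<le>k. e s r m a) = (\<Sum>a\<le>k. e r s m a)" for r s m
      by (rule sum.reindex_bij_witness[of _ "\<lambda>a. k - a" "\<lambda>a. k - a"]) (auto simp: e_def mult.commute add_ac)
    have ce: "c r s m (a, k - a) = w ^ Suc k * e r s m a - (1 / w ^ Suc k) * e s r m a" if "a \<le> k" "r + s = 8" for r s m a
      using ceq[OF that(2), of m a "k - a"] that(1) by (simp add: e_def)
    have "(\<Sum>a\<le>k. c 5 3 2 (a, k - a) + c 1 7 1 (a, k - a)) =
        (\<Sum>a\<le>k. (w ^ Suc k * e 5 3 2 a - (1 / w ^ Suc k) * e 3 5 2 a) + (w ^ Suc k * e 1 7 1 a - (1 / w ^ Suc k) * e 7 1 1 a))"
      by (intro sum.cong[OF refl]) (subst ce, simp, simp, subst ce, simp, simp, rule refl)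
    also have "\<dots> = w ^ Suc k * (\<Sum>a\<le>k. e 5 3 2 a) - (1 / w ^ Suc k) * (\<Sum>a\<le>k. e 3 5 2 a)
        + (w ^ Suc k * (\<Sum>a\<le>k. e 1 7 1 a) - (1 / w ^ Suc k) * (\<Sum>a\<le>k. e 7 1 1 a))"
      by (simp only: sum.distrib sum_subtractf sum_distrib_left)
    also have "\<dots> = (w ^ Suc k - 1 / w ^ Suc k) * (\<Sum>a\<le>k. e 5 3 2 a + e 1 7 1 a)"
      unfolding rev[of 3 5] rev[of 7 1] sum.distrib by (simp only: left_diff_distrib distrib_left)
    also have "(\<Sum>a\<le>k. e 5 3 2 a + e 1 7 1 a) = q powi (2 * (int k + 1)\<^sup>2) * pp (Suc k)"
      using pp_as_double_sum'[of k] by (simp add: e_def)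
    finally have "(\<Sum>a\<le>k. c 5 3 2 (a, k - a) + c 1 7 1 (a, k - a)) = q powi (2 * (int k + 1)\<^sup>2) * pp (Suc k) * (w ^ Suc k - 1 / w ^ Suc k)"
      by (simp only: mult.commute)
    thus "((\<lambda>y. case (k, y) of (k, a) \<Rightarrow> c 5 3 2 (a, k - a) + c 1 7 1 (a, k - a)) has_sum
        (q powi (2 * (int k + 1)\<^sup>2) * pp (Suc k) * (w ^ Suc k - 1 / w ^ Suc k))) {..k}"
      by (intro has_sum_finiteI) auto
  qed
  hence "(\<Sum>\<^sub>\<infinity>k. q powi (2 * (int k + 1)\<^sup>2) * pp (Suc k) * (w ^ Suc k - 1 / w ^ Suc k)) = S" by (rule infsumI)
  also have "w * q ^ 5 * (w * q ^ 3) = w\<^sup>2 * q ^ 8" "w * q ^ 1 * (w * q ^ 7) = w\<^sup>2 * q ^ 8"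
    by (simp_all add: power2_eq_square mult_ac flip: power_add power_Suc)
  hence "S = w * qp (q ^ 8) (q ^ 8) ^ 3 * jt (w\<^sup>2 * q ^ 8) (q ^ 8) *
      (q\<^sup>2 / (jt (w * q ^ 5) (q ^ 8) * jt (w * q ^ 3) (q ^ 8)) + q / (jt (w * q) (q ^ 8) * jt (w * q ^ 7) (q ^ 8)))"
    unfolding S_def by (simp only: distrib_left times_divide_eq_right mult_ac power_one_right)
  finally show ?thesis .
qed


section \<open>Theta values as quotients of \<open>J\<close>\<close>

lemma norm_q_power: "k > 0 \<Longrightarrow> norm (q ^ k) < 1"
  using q1 by (simp add: norm_power power_less_one_iff)

lemma J_ne_0: "k > 0 \<Longrightarrow> J k q \<noteq> 0"
  by (rule J_nonzero[OF q1])

lemma qp_neg: "k > 0 \<Longrightarrow> qp (- (q ^ k)) (q ^ k) = J (2 * k) q / J k q"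
  using qp_square[OF norm_q_power[of k], of "q ^ k"] J_ne_0[of k]
  by (simp add: J_qp field_simps flip: power_mult)

lemma qp_odd: "k > 0 \<Longrightarrow> qp (q ^ k) (q ^ (2 * k)) = J k q / J (2 * k) q"
  using qp_split[OF norm_q_power[of k], of 2 "q ^ k"] J_ne_0[of "2 * k"]
  by (simp add: J_qp field_simps numeral_2_eq_2 flip: power_mult power_add)

lemma qp_neg_odd: "k > 0 \<Longrightarrow> qp (- (q ^ k)) (q ^ (2 * k)) = J (2 * k) q ^ 2 / (J k q * J (4 * k) q)"
proof -
  assume k: "k > 0"
  have e: "(q ^ k)\<^sup>2 = q ^ (2 * k)" "(q ^ (2 * k))\<^sup>2 = q ^ (2 * (2 * k))" by (simp_all add: mult.commute flip: power_mult)
  have "J k q / J (2 * k) q * qp (- (q ^ k)) (q ^ (2 * k)) = J (2 * k) q / J (2 * (2 * k)) q"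
    using qp_square[OF norm_q_power[of "2 * k"], of "q ^ k"] qp_odd[of "2 * k"] k unfolding e by (simp add: qp_odd)
  thus ?thesis using J_ne_0[of k] J_ne_0[of "2 * k"] J_ne_0[of "4 * k"] k
    by (simp add: field_simps power2_eq_square)
qed

lemma jt_minus_1: "k > 0 \<Longrightarrow> jt (- 1) (q ^ k) = 2 * J (2 * k) q ^ 2 / J k q"
  using qp_Suc[OF norm_q_power[of k], of "-1"] J_ne_0[of k]
  by (simp add: jt_def qp_neg J_qp[symmetric] power2_eq_square)

lemma Z_1_J: "Z 1 = J 4 q * J 6 q ^ 6 / (J 2 q ^ 2 * J 12 q ^ 3)"
proof -
  have qq: "q ^ 6 / q\<^sup>2 = q ^ 4" "q ^ 6 / - (q\<^sup>2) = - (q ^ 4)" using q0 by (simp_all add: divide_simps flip: power_add)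
  have s: "qp a (q\<^sup>2) = qp a (q ^ 6) * qp (a * q\<^sup>2) (q ^ 6) * qp (a * q ^ 4) (q ^ 6)" for a
    using qp_split[OF norm_q_power[of 2], of 3 a] by (simp add: numeral_3_eq_3 flip: power_mult power_add) (simp add: eval_nat_numeral mult_ac)
  have 1: "jt (q\<^sup>2) (q ^ 6) = J 2 q"
    using s[of "q\<^sup>2"] unfolding jt_def qq J_qp by (simp add: mult_ac flip: power_add)
  have "qp (- (q\<^sup>2)) (q\<^sup>2) = J 4 q / J 2 q" "qp (- (q ^ 6)) (q ^ 6) = J 12 q / J 6 q"
    using qp_neg[of 2] qp_neg[of 6] by simp_all
  hence "J 4 q / J 2 q = qp (- (q\<^sup>2)) (q ^ 6) * qp (- (q ^ 4)) (q ^ 6) * (J 12 q / J 6 q)"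
    using s[of "- (q\<^sup>2)"] by (simp flip: power_add)
  hence 2: "jt (- (q\<^sup>2)) (q ^ 6) = J 4 q * J 6 q ^ 2 / (J 2 q * J 12 q)"
    unfolding jt_def qq J_qp[symmetric] using J_ne_0[of 2] J_ne_0[of 6] J_ne_0[of 12]
    by (simp add: field_simps power2_eq_square)
  have 3: "jt (- 1) (q ^ 6) = 2 * J 12 q ^ 2 / J 6 q" using jt_minus_1[of 6] by simp
  show ?thesis unfolding Z_1 1 2 3 J_qp[symmetric] using J_ne_0[of 2] J_ne_0[of 6] J_ne_0[of 12]
    by (simp add: field_simps eval_nat_numeral)
qed

lemma tri_summable: "(\<lambda>k. q powi tri k) summable_on UNIV"
  using jacobi_triple_product[OF q1 q0, of "-1"] by (auto dest: has_sum_imp_summable)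

text \<open>The sum of q^(tri k) over all integers is twice Gauss's psi series. The reflection k ->
  1 - k exchanges the residue classes j and 3 - j modulo 4, so the two classes taken here carry half
  the total, whatever M is.\<close>

lemma psi_half: "((\<lambda>r. q powi tri (4 * r - 2 * M) + q powi tri (4 * r - 2 * M - 1)) has_sum (J 2 q ^ 2 / J 1 q)) UNIV"
proof -
  define f where "f = (\<lambda>j r. q powi tri (4 * r - 2 * M - j))"
  have sm: "f j summable_on UNIV" for j
  proof -
    have "(\<lambda>k. q powi tri k) summable_on range (\<lambda>r. 4 * r - 2 * M - j)" by (rule summable_on_subset[OF tri_summable]) auto
    also have "?this \<longleftrightarrow> ((\<lambda>k. q powi tri k) \<circ> (\<lambda>r. 4 * r - 2 * M - j)) summable_on UNIV"
      by (rule summable_on_reindex) (auto simp: inj_def)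
    finally show ?thesis by (simp add: f_def o_def)
  qed
  define X where "X = (\<lambda>j. infsum (f j) UNIV)"
  have hX: "(f j has_sum X j) UNIV" for j unfolding X_def by (rule has_sum_infsum[OF sm])
  have refl: "X (3 - j) = X j" for j
  proof -
    have "(f (3 - j) has_sum X j) UNIV \<longleftrightarrow> (f j has_sum X j) UNIV"
    proof (rule has_sum_reindex_bij_witness[of _ "\<lambda>r. 1 - r + M" "\<lambda>r. 1 - r + M"])
      fix r
      have "4 * (1 - r + M) - 2 * M - j = 1 - (4 * r - 2 * M - (3 - j))" by simp
      thus "f j (1 - r + M) = f (3 - j) r" unfolding f_def by (simp only: tri_reflect)
    qed auto
    thus ?thesis using hX has_sum_unique by blast
  qed
  have tot: "((\<lambda>k. q powi tri k) has_sum (2 * (J 2 q ^ 2 / J 1 q))) UNIV"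
    using jacobi_triple_product[OF q1 q0, of "-1"] jt_minus_1[of 1] by simp
  also have "?this \<longleftrightarrow> ((\<lambda>(r, j). f j r) has_sum (2 * (J 2 q ^ 2 / J 1 q))) (UNIV \<times> {0, 1, 2, 3})"
  proof (rule has_sum_reindex_bij_witness[of _ "\<lambda>(r, j). 4 * r - 2 * M - j" "\<lambda>k. ((k + 2 * M + 3) div 4, 4 * ((k + 2 * M + 3) div 4) - 2 * M - k)"])
    fix k :: int
    have "4 * ((k + 2 * M + 3) div 4) - 2 * M - k \<in> {0, 1, 2, 3}" by (simp, presburger)
    thus "((k + 2 * M + 3) div 4, 4 * ((k + 2 * M + 3) div 4) - 2 * M - k) \<in> UNIV \<times> {0, 1, 2, 3}" by simp
  next
    fix x :: "int \<times> int" assume "x \<in> UNIV \<times> {0, 1, 2, 3}"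
    then obtain r j where x: "x = (r, j)" "j \<in> {0, 1, 2, 3}" by auto
    have "(4 * r - 2 * M - j + 2 * M + 3) div 4 = r" using x(2) by (auto; presburger)
    thus "(((case x of (r, j) \<Rightarrow> 4 * r - 2 * M - j) + 2 * M + 3) div 4,
        4 * (((case x of (r, j) \<Rightarrow> 4 * r - 2 * M - j) + 2 * M + 3) div 4) - 2 * M - (case x of (r, j) \<Rightarrow> 4 * r - 2 * M - j)) = x"
      using x by simp
  qed (auto simp: f_def)
  finally have *: "((\<lambda>(r, j). f j r) has_sum (2 * (J 2 q ^ 2 / J 1 q))) (UNIV \<times> {0, 1, 2, 3})" .
  have "((\<lambda>r. f 0 r + f 1 r + f 2 r + f 3 r) has_sum (2 * (J 2 q ^ 2 / J 1 q))) UNIV"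
  proof (rule has_sum_SigmaD[OF *])
    fix r
    have "(\<Sum>j\<in>{0, 1, 2, 3}. f j r) = f 0 r + f 1 r + f 2 r + f 3 r" by simp
    thus "((\<lambda>j. case (r, j) of (r, j) \<Rightarrow> f j r) has_sum (f 0 r + f 1 r + f 2 r + f 3 r)) {0, 1, 2, 3}"
      by (intro has_sum_finiteI) simp_all
  qed
  moreover have "((\<lambda>r. f 0 r + f 1 r + f 2 r + f 3 r) has_sum (X 0 + X 1 + X 2 + X 3)) UNIV"
    by (intro has_sum_add hX)
  ultimately have "X 0 + X 1 + X 2 + X 3 = 2 * (J 2 q ^ 2 / J 1 q)" using has_sum_unique by blast
  moreover have "X 0 + X 1 + X 2 + X 3 = 2 * (X 0 + X 1)" using refl[of 0] refl[of 1] by simp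
  ultimately have "X 0 + X 1 = J 2 q ^ 2 / J 1 q" by (metis mult_cancel_left zero_neq_numeral)
  thus ?thesis using has_sum_add[OF hX[of 0] hX[of 1]] by (simp add: f_def)
qed

text \<open>Expand all four theta functions and group by M = r + s. The exponent separates into 2M^2
  and a triangular number, so the sum over r is \<open>psi_half\<close>, independent of M, and the
  sum over M is again a theta series.\<close>

lemma theta_addition:
  assumes w: "w \<noteq> 0"
  shows "q * (jt (w * q) (q ^ 8) * jt (w * q ^ 7) (q ^ 8)) + jt (w * q ^ 3) (q ^ 8) * jt (w * q ^ 5) (q ^ 8)
     = J 2 q ^ 2 / J 1 q * jt (w * q\<^sup>2) (q ^ 4)"
proof -
  define e where "e = (\<lambda>a b (r, s). ((q ^ 8) powi tri r * (- (w * q ^ a)) powi r) * ((q ^ 8) powi tri s * (- (w * q ^ b)) powi s))"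
  have e: "(e a b has_sum jt (w * q ^ a) (q ^ 8) * jt (w * q ^ b) (q ^ 8)) (UNIV \<times> UNIV)" for a b
    unfolding e_def by (intro has_sum_times jacobi_triple_product norm_q_power) (use q0 w in auto)
  have e': "e a b (r, s) = (- w) powi (r + s) * q powi (8 * tri r + 8 * tri s + int a * r + int b * s)" for a b r s
  proof -
    have "(- (w * q ^ a)) powi r = (- w) powi r * q powi (int a * r)" for a r
    proof -
      have "- (w * q ^ a) = (- w) * q ^ a" by simp
      thus ?thesis by (simp only: power_int_mult_distrib power_int_power)
    qed
    thus ?thesis unfolding e_def using q0 w by (simp add: power_int_power power_int_add mult_ac)
  qed
  have t2: "8 * tri x = 4 * x * (x - 1)" for x using two_tri[of x] by (simp add: algebra_simps)
  have t3: "tri (2 * d) = d * (2 * d - 1)" "tri (2 * d - 1) = (2 * d - 1) * (d - 1)" for d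
    using two_tri[of "2 * d"] two_tri[of "2 * d - 1"] by (simp_all add: algebra_simps)
  have "((\<lambda>x. e 3 5 x + q * e 1 7 x) has_sum (jt (w * q ^ 3) (q ^ 8) * jt (w * q ^ 5) (q ^ 8) + q * (jt (w * q ^ 1) (q ^ 8) * jt (w * q ^ 7) (q ^ 8)))) (UNIV \<times> UNIV)"
    by (intro has_sum_add has_sum_cmult_right e)
  also have "?this \<longleftrightarrow> ((\<lambda>(M, r). (- w) powi M * q powi (2 * M\<^sup>2) * (q powi tri (4 * r - 2 * M) + q powi tri (4 * r - 2 * M - 1))) has_sum
      (jt (w * q ^ 3) (q ^ 8) * jt (w * q ^ 5) (q ^ 8) + q * (jt (w * q ^ 1) (q ^ 8) * jt (w * q ^ 7) (q ^ 8)))) (UNIV \<times> UNIV)"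
  proof -
    have "(- w) powi (r + s) * q powi (2 * (r + s)\<^sup>2) * (q powi tri (4 * r - 2 * (r + s)) + q powi tri (4 * r - 2 * (r + s) - 1)) = e 3 5 (r, s) + q * e 1 7 (r, s)" for r s
    proof -
      have d: "4 * r - 2 * (r + s) = 2 * (r - s)" by simp
      have "2 * (r + s)\<^sup>2 + tri (2 * (r - s)) = 8 * tri r + 8 * tri s + int 3 * r + int 5 * s"
        unfolding t2 t3 by (simp add: power2_eq_square algebra_simps)
      moreover have "2 * (r + s)\<^sup>2 + tri (2 * (r - s) - 1) = (8 * tri r + 8 * tri s + int 1 * r + int 7 * s) + 1"
        unfolding t2 t3 by (simp add: power2_eq_square algebra_simps)
      ultimately have "q powi (2 * (r + s)\<^sup>2) * (q powi tri (4 * r - 2 * (r + s)) + q powi tri (4 * r - 2 * (r + s) - 1))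
          = q powi (8 * tri r + 8 * tri s + int 3 * r + int 5 * s) + q powi ((8 * tri r + 8 * tri s + int 1 * r + int 7 * s) + 1)"
        by (simp only: d distrib_left[of "q powi (2 * (r + s)\<^sup>2)"] power_int_add[OF disjI1[OF q0], symmetric])
      also have "q powi ((8 * tri r + 8 * tri s + int 1 * r + int 7 * s) + 1) = q * q powi (8 * tri r + 8 * tri s + int 1 * r + int 7 * s)"
        using q0 by (subst power_int_add) auto
      finally show ?thesis unfolding e' mult.assoc by (simp only: distrib_left mult_ac)
    qed
    thus ?thesis
      by (intro has_sum_reindex_bij_witness[of _ "\<lambda>(M, r). (r, M - r)" "\<lambda>(r, s). (r + s, r)"]) auto
  qed
  finally have *: "\<dots>" .
  have "((\<lambda>M. (- w) powi M * q powi (2 * M\<^sup>2) * (J 2 q ^ 2 / J 1 q)) has_sum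
      (jt (w * q ^ 3) (q ^ 8) * jt (w * q ^ 5) (q ^ 8) + q * (jt (w * q ^ 1) (q ^ 8) * jt (w * q ^ 7) (q ^ 8)))) UNIV"
  proof (rule has_sum_SigmaD[OF *])
    fix M
    have "((\<lambda>r. (- w) powi M * q powi (2 * M\<^sup>2) * (q powi tri (4 * r - 2 * M) + q powi tri (4 * r - 2 * M - 1))) has_sum
        ((- w) powi M * q powi (2 * M\<^sup>2) * (J 2 q ^ 2 / J 1 q))) UNIV"
      by (intro has_sum_cmult_right psi_half)
    thus "((\<lambda>y. case (M, y) of (M, r) \<Rightarrow> (- w) powi M * q powi (2 * M\<^sup>2) * (q powi tri (4 * r - 2 * M) + q powi tri (4 * r - 2 * M - 1))) has_sum
        ((- w) powi M * q powi (2 * M\<^sup>2) * (J 2 q ^ 2 / J 1 q))) UNIV"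
      by (simp only: prod.case)
  qed
  moreover have "((\<lambda>M. ((q ^ 4) powi tri M * (- (w * q\<^sup>2)) powi M) * (J 2 q ^ 2 / J 1 q)) has_sum (jt (w * q\<^sup>2) (q ^ 4) * (J 2 q ^ 2 / J 1 q))) UNIV"
    by (intro has_sum_cmult_left jacobi_triple_product norm_q_power) (use q0 w in auto)
  moreover have "(q ^ 4) powi tri M * (- (w * q\<^sup>2)) powi M = (- w) powi M * q powi (2 * M\<^sup>2)" for M
  proof -
    have "- (w * q\<^sup>2) = (- w) * q\<^sup>2" by simp
    hence "(- (w * q\<^sup>2)) powi M = (- w) powi M * q powi (2 * M)" by (simp only: power_int_mult_distrib power_int_power) simp
    moreover have "(q ^ 4) powi tri M = q powi (4 * tri M)" by (simp add: power_int_power)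
    moreover have "4 * tri M + 2 * M = 2 * M\<^sup>2" using two_tri[of M] by (simp add: power2_eq_square algebra_simps)
    ultimately show ?thesis using q0 by (simp add: mult.assoc mult.left_commute flip: power_int_add)
  qed
  ultimately have "jt (w * q ^ 3) (q ^ 8) * jt (w * q ^ 5) (q ^ 8) + q * (jt (w * q ^ 1) (q ^ 8) * jt (w * q ^ 7) (q ^ 8)) = jt (w * q\<^sup>2) (q ^ 4) * (J 2 q ^ 2 / J 1 q)"
    using has_sum_unique by fastforce
  thus ?thesis by (simp add: algebra_simps)
qed

end

section \<open>The class number identity as a sum over pairs\<close>

definition WW :: "(nat \<times> nat) set" where "WW = {(m, i). i < 6 * m}"

definition WN :: "nat \<times> nat \<Rightarrow> int" where "WN = (\<lambda>(m, i). 18 * (int m)\<^sup>2 - tri (int i + 1))"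

text \<open>The coefficients 4t - 2i - 1 of \<open>h_closed\<close> at t = 3m with the sign (-1)^m;
  the factor 1/2 there is used up by t = m and t = -m together.\<close>

definition wcoeff :: "nat \<times> nat \<Rightarrow> complex" where
  "wcoeff = (\<lambda>(m, i). (-1) ^ m * (12 * of_nat m - 2 * of_nat i - 1))"

context nome begin

text \<open>\<open>theta_addition\<close> merges the two fractions of \<open>theta_pp_sum\<close>.
  As -w is a primitive cube root of unity, the remaining theta values combine by
  \<open>qp_cube\<close> to quotients of \<open>J\<close>; that no denominator vanishes is read off
  from their product \<open>D\<close>.\<close>

lemma theta_pp_product:
  assumes w: "w\<^sup>2 - w + 1 = 0"
  shows "(\<Sum>\<^sub>\<infinity>k. q powi (2 * (int k + 1)\<^sup>2) * pp (Suc k) * (w ^ Suc k - 1 / w ^ Suc k)) =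
     (w - 1 / w) * (q * (J 2 q ^ 5 * J 3 q * J 12 q ^ 3 / (J 1 q ^ 2 * J 4 q ^ 2 * J 6 q ^ 3)))"
proof -
  have w0: "w \<noteq> 0" using w by auto
  have "w ^ 3 = -1" by (rule sixth_root_cube[OF w])
  hence "norm w ^ 3 = 1" by (metis norm_minus_cancel norm_one norm_power)
  hence nw: "norm w = 1" using power_eq_imp_eq_base[of "norm w" 3 1] by simp
  have w2: "w\<^sup>2 = w - 1" using w by (simp add: algebra_simps add_eq_0_iff)
  have iw: "1 / w = 1 - w" using w0 w2 by (simp add: field_simps power2_eq_square)
  have om: "(- w)\<^sup>2 + (- w) + 1 = 0" using w by simp
  have om2: "(- w)\<^sup>2 = - (1 / w)" using iw w2 by simp
  define \<theta> where "\<theta> = (\<lambda>a. jt (w * q ^ a) (q ^ 8))"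
  note nz = J_ne_0[of 1] J_ne_0[of 2] J_ne_0[of 3] J_ne_0[of 4] J_ne_0[of 6] J_ne_0[of 8] J_ne_0[of 12] J_ne_0[of 24]
  have A: "jt (w\<^sup>2 * q ^ 8) (q ^ 8) = (1 + w) * J 24 q"
  proof -
    have "q ^ 8 / (w\<^sup>2 * q ^ 8) = - w"
    proof -
      have "- w * w\<^sup>2 = - (w ^ 3)" by (simp add: power3_eq_cube power2_eq_square mult.assoc)
      hence "- w * w\<^sup>2 = 1" using \<open>w ^ 3 = -1\<close> by simp
      thus ?thesis using q0 w0 by (simp add: field_simps)
    qed
    moreover have "qp (- w) (q ^ 8) = (1 + w) * qp (- w * q ^ 8) (q ^ 8)"
      using qp_Suc[OF norm_q_power[of 8], of "- w"] by simp
    moreover have "qp (q ^ 8) (q ^ 8) * qp (- w * q ^ 8) (q ^ 8) * qp (w\<^sup>2 * q ^ 8) (q ^ 8) = J 24 q"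
      using qp_cube[OF norm_q_power[of 8] om, of "q ^ 8"] by (simp add: J_qp flip: power_mult)
    ultimately show ?thesis by (simp add: jt_def mult_ac)
  qed
  \<comment> \<open>The numbers -a, w a and a/w are the multiples of -a by the three cube roots of
    unity.\<close>
  have cube: "qp (w * a) p * qp (a / w) p = qp (- (a ^ 3)) (p ^ 3) / qp (- a) p" if "norm p < 1" "qp (- a) p \<noteq> 0" for a p
    using qp_cube[OF that(1) om, of "- a"] that(2) unfolding om2 by (simp add: field_simps)
  have odd: "qp (- q) (q\<^sup>2) = J 2 q ^ 2 / (J 1 q * J 4 q)" "qp (- (q ^ 3)) (q ^ 6) = J 6 q ^ 2 / (J 3 q * J 12 q)"
     "qp (- (q\<^sup>2)) (q ^ 4) = J 4 q ^ 2 / (J 2 q * J 8 q)" "qp (- (q ^ 6)) (q ^ 12) = J 12 q ^ 2 / (J 6 q * J 24 q)"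
    using qp_neg_odd[of 1] qp_neg_odd[of 3] qp_neg_odd[of 2] qp_neg_odd[of 6] by simp_all
  have B: "jt (w * q\<^sup>2) (q ^ 4) = J 12 q ^ 2 / (J 6 q * J 24 q) / (J 4 q ^ 2 / (J 2 q * J 8 q)) * J 4 q"
  proof -
    have "q ^ 4 / (w * q\<^sup>2) = (q\<^sup>2 * q\<^sup>2) / (w * q\<^sup>2)" by (simp flip: power_add)
    also have "\<dots> = q\<^sup>2 / w" by (rule nonzero_mult_divide_mult_cancel_right) (use q0 in simp)
    finally have "q ^ 4 / (w * q\<^sup>2) = q\<^sup>2 / w" .
    thus ?thesis using cube[OF norm_q_power[of 4], of "q\<^sup>2"] nz
      by (simp add: jt_def J_qp[symmetric] odd flip: power_mult)
  qed
  have D: "\<theta> 1 * \<theta> 3 * \<theta> 5 * \<theta> 7 = J 8 q ^ 4 * (J 6 q ^ 2 / (J 3 q * J 12 q) / (J 2 q ^ 2 / (J 1 q * J 4 q)))"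
  proof -
    have d: "q ^ 8 / (w * q ^ 1) = (q / w) * q ^ 6" "q ^ 8 / (w * q ^ 3) = (q / w) * q ^ 4"
      "q ^ 8 / (w * q ^ 5) = (q / w) * q\<^sup>2" "q ^ 8 / (w * q ^ 7) = q / w"
      using q0 w0 by (simp_all add: divide_simps) (simp_all add: eval_nat_numeral)
    have s: "qp a (q\<^sup>2) = qp a (q ^ 8) * qp (a * q\<^sup>2) (q ^ 8) * qp (a * q ^ 4) (q ^ 8) * qp (a * q ^ 6) (q ^ 8)" for a
    proof -
      have "(\<Prod>j<4. f j) = f 0 * f 1 * f 2 * f 3" for f :: "nat \<Rightarrow> complex" by (simp add: numeral_eq_Suc)
      thus ?thesis using qp_split[OF norm_q_power[of 2], of 4 a] by (simp flip: power_mult)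
    qed
    have "w * q ^ 3 = (w * q) * q\<^sup>2" "w * q ^ 5 = (w * q) * q ^ 4" "w * q ^ 7 = (w * q) * q ^ 6"
      by (simp_all add: mult.assoc flip: power_Suc)
    hence "\<theta> 1 * \<theta> 3 * \<theta> 5 * \<theta> 7 = J 8 q ^ 4 * (qp (w * q) (q\<^sup>2) * qp (q / w) (q\<^sup>2))"
      unfolding \<theta>_def jt_def d J_qp[symmetric] s[of "w * q"] s[of "q / w"] by (simp add: eval_nat_numeral mult_ac)
    thus ?thesis using cube[OF norm_q_power[of 2], of q] nz by (simp add: odd flip: power_mult)
  qed
  have Dnz: "\<theta> 1 \<noteq> 0" "\<theta> 3 \<noteq> 0" "\<theta> 5 \<noteq> 0" "\<theta> 7 \<noteq> 0" using D nz by (auto simp: field_simps)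
  have "(\<Sum>\<^sub>\<infinity>k. q powi (2 * (int k + 1)\<^sup>2) * pp (Suc k) * (w ^ Suc k - 1 / w ^ Suc k)) =
    w * J 8 q ^ 3 * jt (w\<^sup>2 * q ^ 8) (q ^ 8) * (q\<^sup>2 / (\<theta> 5 * \<theta> 3) + q / (\<theta> 1 * \<theta> 7))"
    unfolding theta_pp_sum[OF nw] J_qp[symmetric] \<theta>_def by simp
  also have "q\<^sup>2 / (\<theta> 5 * \<theta> 3) + q / (\<theta> 1 * \<theta> 7) = q * (q * (\<theta> 1 * \<theta> 7) + \<theta> 3 * \<theta> 5) / (\<theta> 1 * \<theta> 3 * \<theta> 5 * \<theta> 7)"
    using Dnz by (simp add: field_simps power2_eq_square)
  also have "q * (\<theta> 1 * \<theta> 7) + \<theta> 3 * \<theta> 5 = J 2 q ^ 2 / J 1 q * jt (w * q\<^sup>2) (q ^ 4)"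
    using theta_addition[OF w0] by (simp add: \<theta>_def)
  also have "w * J 8 q ^ 3 * jt (w\<^sup>2 * q ^ 8) (q ^ 8) * (q * (J 2 q ^ 2 / J 1 q * jt (w * q\<^sup>2) (q ^ 4)) / (\<theta> 1 * \<theta> 3 * \<theta> 5 * \<theta> 7))
     = (w * (1 + w)) * (q * (J 2 q ^ 5 * J 3 q * J 12 q ^ 3 / (J 1 q ^ 2 * J 4 q ^ 2 * J 6 q ^ 3)))"
    unfolding A B D using nz by (simp add: field_simps eval_nat_numeral)
  also have "w * (1 + w) = w - 1 / w" unfolding iw using w2 by (simp add: distrib_left power2_eq_square)
  finally show ?thesis .
qed

lemma sum_h_3_product:
  "((\<lambda>t. (-1) powi t * q powi (18 * t\<^sup>2) * h (nat \<bar>3 * t\<bar>)) has_sum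
     (q * (J 2 q ^ 3 * J 3 q * J 6 q ^ 3 / (J 1 q ^ 2 * J 4 q)))) UNIV"
proof -
  obtain w :: complex where w: "w\<^sup>2 - w + 1 = 0" using exists_sixth_root by blast
  have w0: "w \<noteq> 0" using w by auto
  have wne: "w - 1 / w \<noteq> 0"
  proof
    assume "w - 1 / w = 0"
    hence "w * w = 1" using w0 by (simp add: field_simps)
    hence "w = 2" using w by (simp add: power2_eq_square algebra_simps)
    thus False using \<open>w * w = 1\<close> by simp
  qed
  have "Z 1 / (w - 1 / w) * ((w - 1 / w) * (q * (J 2 q ^ 5 * J 3 q * J 12 q ^ 3 / (J 1 q ^ 2 * J 4 q ^ 2 * J 6 q ^ 3))))
      = Z 1 * (q * (J 2 q ^ 5 * J 3 q * J 12 q ^ 3 / (J 1 q ^ 2 * J 4 q ^ 2 * J 6 q ^ 3)))"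
    using wne by simp
  also have "\<dots> = q * (J 2 q ^ 3 * J 3 q * J 6 q ^ 3 / (J 1 q ^ 2 * J 4 q))"
    unfolding Z_1_J using J_ne_0[of 1] J_ne_0[of 2] J_ne_0[of 3] J_ne_0[of 4] J_ne_0[of 6] J_ne_0[of 12]
    by (simp add: field_simps eval_nat_numeral)
  finally show ?thesis using sum_h_3(1)[OF w] unfolding theta_pp_product[OF w] by simp
qed

text \<open>Gauss's theta series phi(-q^k): the triple product with base q^(2k) at x = q^k, where
  both theta factors coincide.\<close>

lemma phi_sum: "k > 0 \<Longrightarrow> ((\<lambda>t. (-1) powi t * q powi (int k * t\<^sup>2)) has_sum (J k q ^ 2 / J (2 * k) q)) UNIV"
proof -
  assume k: "k > 0"
  have "((\<lambda>t. (q ^ (2 * k)) powi tri t * (- (q ^ k)) powi t) has_sum jt (q ^ k) (q ^ (2 * k))) UNIV"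
    by (intro jacobi_triple_product norm_q_power) (use q0 k in auto)
  also have "jt (q ^ k) (q ^ (2 * k)) = J k q ^ 2 / J (2 * k) q"
  proof -
    have "q ^ (2 * k) / q ^ k = q ^ k" using q0 by (simp add: mult_2 power_add)
    thus ?thesis using qp_odd[OF k] J_ne_0[of "2 * k"] k by (simp add: jt_def J_qp[symmetric] power2_eq_square)
  qed
  also have "(\<lambda>t. (q ^ (2 * k)) powi tri t * (- (q ^ k)) powi t) = (\<lambda>t. (-1) powi t * q powi (int k * t\<^sup>2))"
  proof
    fix t
    have "- (q ^ k) = (- 1) * q ^ k" by simp
    hence a: "(- (q ^ k)) powi t = (-1) powi t * q powi (int k * t)" by (simp only: power_int_mult_distrib power_int_power)
    have b: "(q ^ (2 * k)) powi tri t = q powi (int (2 * k) * tri t)" by (rule power_int_power)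
    have "2 * tri t + t = t\<^sup>2" using two_tri[of t] by (simp add: power2_eq_square algebra_simps)
    hence "int k * (2 * tri t + t) = int k * t\<^sup>2" by (simp only:)
    hence "int (2 * k) * tri t + int k * t = int k * t\<^sup>2" by (simp only: distrib_left of_nat_mult of_nat_numeral mult_ac)
    hence c: "q powi (int (2 * k) * tri t) * q powi (int k * t) = q powi (int k * t\<^sup>2)"
      by (simp only: power_int_add[OF disjI1[OF q0], symmetric])
    show "(q ^ (2 * k)) powi tri t * (- (q ^ k)) powi t = (-1) powi t * q powi (int k * t\<^sup>2)"
      unfolding a b mult.left_commute[of _ "(-1) powi t"] c ..
  qed
  finally show ?thesis .
qed

lemma WN_lower: "(m, i) \<in> WW \<Longrightarrow> WN (m, i) \<ge> 3 * int m"
proof -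
  assume "(m, i) \<in> WW"
  hence "tri (int i + 1) \<le> tri (6 * int m)" by (intro tri_mono) (auto simp: WW_def)
  also have "tri (6 * int m) = 18 * (int m)\<^sup>2 - 3 * int m"
    using two_tri[of "6 * int m"] by (simp add: power2_eq_square algebra_simps)
  finally show ?thesis by (simp add: WN_def)
qed

lemma WW_summable: "(\<lambda>x. wcoeff x * q powi WN x) summable_on WW"
proof (rule abs_summable_summable, rule Infinite_Sum.abs_summable_on_comparison_test')
  \<comment> \<open>\<open>WN_lower\<close> leaves |q|^(2m): one |q|^m absorbs the linear
    coefficient, the other is rho^(6m) <= rho^i.\<close>
  define \<rho> where "\<rho> = root 6 (norm q)"
  have \<rho>: "0 < \<rho>" "\<rho> < 1" "\<rho> ^ 6 = norm q" using q0 q1 by (auto simp: \<rho>_def)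
  have "(\<lambda>m. real (Suc m) * norm q ^ Suc m) summable_on UNIV"
  proof -
    have e: "(1 / 2) * (2 * real (Suc m) * norm q ^ Suc m) = real (Suc m) * norm q ^ Suc m" for m by simp
    show ?thesis using summable_on_cmult_right[OF summable_arith_geometric, of "1/2"] unfolding e .
  qed
  hence "summable (\<lambda>m. real (Suc m) * norm q ^ Suc m)" by (rule summable_on_imp_summable)
  hence "summable (\<lambda>m. real m * norm q ^ m)" by (subst (asm) summable_Suc_iff)
  hence "(\<lambda>m. 12 * (real m * norm q ^ m)) summable_on UNIV"
    by (intro summable_on_cmult_right summable_nonneg_imp_summable_on) auto
  moreover have "(\<lambda>i. \<rho> ^ i) summable_on UNIV"
    using \<rho> by (intro summable_nonneg_imp_summable_on summable_geometric) auto
  ultimately have "(\<lambda>(m, i). 12 * (real m * norm q ^ m) * \<rho> ^ i) summable_on UNIV \<times> UNIV"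
    using \<rho> by (intro summable_on_times) auto
  thus "(\<lambda>(m, i). 12 * (real m * norm q ^ m) * \<rho> ^ i) summable_on WW" by (rule summable_on_subset) auto
  fix x assume x: "x \<in> WW"
  obtain m i where [simp]: "x = (m, i)" by (cases x)
  have i: "i < 6 * m" using x by (simp add: WW_def)
  have "norm (wcoeff x) = \<bar>12 * real m - 2 * real i - 1\<bar>"
  proof -
    have "12 * of_nat m - 2 * of_nat i - 1 = complex_of_real (12 * real m - 2 * real i - 1)" by simp
    thus ?thesis unfolding wcoeff_def by (simp only: \<open>x = (m, i)\<close> prod.case norm_mult norm_power norm_of_real) simp
  qed
  also have "\<dots> \<le> 12 * real m" using i by simp
  finally have 1: "norm (wcoeff x) \<le> 12 * real m" .
  have "norm q powi WN x \<le> norm q powi (int (m + m))"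
    using WN_lower x q0 q1 by (intro power_int_decreasing) (fastforce+)
  also have "\<dots> = norm q ^ m * \<rho> ^ (6 * m)" unfolding power_int_of_nat power_add by (simp add: \<rho>(3) power_mult)
  also have "\<dots> \<le> norm q ^ m * \<rho> ^ i" using i \<rho> by (intro mult_left_mono power_decreasing) auto
  finally have 2: "norm (q powi WN x) \<le> norm q ^ m * \<rho> ^ i" by (simp add: norm_power_int)
  have "norm (wcoeff x * q powi WN x) \<le> 12 * real m * (norm q ^ m * \<rho> ^ i)"
    unfolding norm_mult by (intro mult_mono 1 2) auto
  thus "norm (wcoeff x * q powi WN x) \<le> (case x of (m, i) \<Rightarrow> 12 * (real m * norm q ^ m) * \<rho> ^ i)" by (simp add: mult_ac)
qed

text \<open>The sum of h (3|t|) - h 0 with its weights is the difference of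
  \<open>sum_h_3_product\<close> and h 0 times \<open>phi_sum\<close>; by \<open>h_closed\<close> it
  is also the sum over pairs, with equal contributions from t and -t.\<close>

theorem hurwitz_theta_identity:
  "((\<lambda>x. wcoeff x * q powi WN x) has_sum (q * (J 2 q ^ 3 * J 3 q * J 6 q ^ 3 / (J 1 q ^ 2 * J 4 q))
      - J 18 q ^ 2 / J 36 q * h 0)) WW"
proof -
  define S where "S = infsum (\<lambda>x. wcoeff x * q powi WN x) WW"
  have WS: "WW = Sigma UNIV (\<lambda>m. {..<6 * m})" by (auto simp: WW_def)
  have hS: "((\<lambda>x. wcoeff x * q powi WN x) has_sum S) WW" unfolding S_def by (rule has_sum_infsum[OF WW_summable])
  define f where "f = (\<lambda>m. (-1) ^ m * q powi (18 * (int m)\<^sup>2) * (\<Sum>i<6 * m. (12 * of_nat m - 2 * of_nat i - 1) * q powi (- tri (int i + 1))))"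
  have "(f has_sum S) UNIV"
  proof (rule has_sum_SigmaD[OF hS[unfolded WS]])
    fix m
    have "wcoeff (m, i) * q powi WN (m, i) = (-1) ^ m * q powi (18 * (int m)\<^sup>2) * ((12 * of_nat m - 2 * of_nat i - 1) * q powi (- tri (int i + 1)))" for i
    proof -
      have "q powi WN (m, i) = q powi (18 * (int m)\<^sup>2) * q powi (- tri (int i + 1))"
        unfolding WN_def prod.case using q0 by (simp add: power_int_diff power_int_minus field_simps)
      thus ?thesis by (simp add: wcoeff_def)
    qed
    hence "(\<Sum>i<6 * m. wcoeff (m, i) * q powi WN (m, i)) = f m" by (simp add: f_def sum_distrib_left)
    thus "((\<lambda>i. wcoeff (m, i) * q powi WN (m, i)) has_sum f m) {..<6 * m}" by (intro has_sum_finiteI) auto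
  qed
  hence "(f has_sum (S - f 0)) (UNIV - {0})"
    by (intro has_sum_Diff) (auto simp: has_sum_finite_iff)
  moreover have "f 0 = 0" by (simp add: f_def)
  ultimately have "(f has_sum S) (UNIV - {0})" by simp
  also have "?this \<longleftrightarrow> ((\<lambda>n. f (Suc n)) has_sum S) UNIV"
    by (rule has_sum_reindex_bij_witness[of _ Suc "\<lambda>t. t - 1"]) auto
  finally have f: "((\<lambda>n. f (Suc n) * (1 / 2)) has_sum (S * (1 / 2))) UNIV" by (rule has_sum_cmult_left)
  define g where "g = (\<lambda>t. (-1) powi t * q powi (18 * t\<^sup>2) * (h (nat \<bar>3 * t\<bar>) - h 0))"
  have g: "g t = f (nat \<bar>t\<bar>) * (1 / 2)" for t
  proof -
    have "(-1 :: complex) powi t = (-1) ^ nat \<bar>t\<bar>" by (cases "t \<ge> 0") (auto simp: power_int_def)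
    moreover have "t\<^sup>2 = (int (nat \<bar>t\<bar>))\<^sup>2" by simp
    moreover have "nat \<bar>3 * t\<bar> = 3 * nat \<bar>t\<bar>" by (simp add: abs_mult nat_mult_distrib)
    ultimately show ?thesis unfolding g_def f_def by (simp only: h_closed[of "3 * nat \<bar>t\<bar>"]) simp
  qed
  have "((\<lambda>n. g (int n + 1)) has_sum (S * (1 / 2))) UNIV" "((\<lambda>n. g (- int n - 1)) has_sum (S * (1 / 2))) UNIV"
  proof -
    have "nat \<bar>int n + 1\<bar> = Suc n" "nat \<bar>- int n - 1\<bar> = Suc n" for n by auto
    thus "((\<lambda>n. g (int n + 1)) has_sum (S * (1 / 2))) UNIV" "((\<lambda>n. g (- int n - 1)) has_sum (S * (1 / 2))) UNIV"
      using f by (simp_all only: g)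
  qed
  hence "(g has_sum (g 0 + (S * (1 / 2) + S * (1 / 2)))) UNIV" by (rule has_sum_int_split)
  moreover have "g 0 = 0" by (simp add: g_def)
  moreover have "(g has_sum (q * (J 2 q ^ 3 * J 3 q * J 6 q ^ 3 / (J 1 q ^ 2 * J 4 q)) - J 18 q ^ 2 / J 36 q * h 0)) UNIV"
  proof -
    have "((\<lambda>t. (-1) powi t * q powi (18 * t\<^sup>2) * h 0) has_sum (J 18 q ^ 2 / J 36 q * h 0)) UNIV"
      using has_sum_cmult_left[OF phi_sum[of 18]] by simp
    from has_sum_add[OF sum_h_3_product has_sum_uminusI[OF this]] show ?thesis
      by (simp add: g_def algebra_simps)
  qed
  ultimately have "S = q * (J 2 q ^ 3 * J 3 q * J 6 q ^ 3 / (J 1 q ^ 2 * J 4 q)) - J 18 q ^ 2 / J 36 q * h 0"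
    using has_sum_unique by fastforce
  thus ?thesis using hS by simp
qed

end

section \<open>Trisection of the exponents\<close>

lemma J_power: "J k (q ^ m) = J (m * k) q"
  by (simp add: J_qp flip: power_mult)

context nome begin

lemma nome_power: "k > 0 \<Longrightarrow> nome (q ^ k)"
  using norm_q_power q0 by (simp add: nome_def)

text \<open>Split each J 1 by exponents modulo 3. Multiples of 3 are unchanged by the rotation and
  give J_3^3; the other two classes combine by \<open>qp_cube\<close> to J_3 / J_9.\<close>

lemma J_cube_product:
  assumes z: "z\<^sup>2 + z + 1 = 0"
  shows "J 1 q * J 1 (z * q) * J 1 (z\<^sup>2 * q) = J 3 q ^ 4 / J 9 q"
proof -
  have z3: "z ^ 3 = 1" by (rule cube_root_of_unity(1)[OF z])
  have z6: "(z\<^sup>2) ^ 3 = 1" 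
  proof -
    have "(z\<^sup>2) ^ 3 = (z ^ 3)\<^sup>2" by (simp flip: power_mult)
    thus ?thesis using z3 by simp
  qed
  have nz: "norm z = 1" using z3 power_eq_imp_eq_base[of "norm z" 3 1] by (simp flip: norm_power)
  have s: "J 1 a = qp a (q ^ 3) * qp (a\<^sup>2) (q ^ 3) * J 3 q" if "a ^ 3 = q ^ 3" "norm a < 1" for a
  proof -
    have "(\<Prod>j<3. f j) = f 0 * f 1 * f 2" for f :: "nat \<Rightarrow> complex" by (simp add: numeral_eq_Suc)
    moreover have "a * a\<^sup>2 = q ^ 3" using that by (simp add: power3_eq_cube power2_eq_square mult.assoc)
    ultimately show ?thesis
      using qp_split[OF that(2), of 3 a] that(1) by (simp add: J_qp power2_eq_square)
  qed
  have c1: "qp q (q ^ 3) * qp (z * q) (q ^ 3) * qp (z\<^sup>2 * q) (q ^ 3) = qp (q ^ 3) (q ^ 9)"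
    using qp_cube[OF norm_q_power[of 3] z, of q] by (simp flip: power_mult)
  have c2: "qp (q\<^sup>2) (q ^ 3) * qp ((z\<^sup>2 * q)\<^sup>2) (q ^ 3) * qp ((z * q)\<^sup>2) (q ^ 3) = qp (q ^ 6) (q ^ 9)"
  proof -
    have "(z\<^sup>2 * q)\<^sup>2 = z * q\<^sup>2"
    proof -
      have "(z\<^sup>2)\<^sup>2 = z ^ 3 * z" by (simp flip: power_mult power_Suc2)
      thus ?thesis using z3 by (simp add: power_mult_distrib)
    qed
    note e = this
    show ?thesis using qp_cube[OF norm_q_power[of 3] z, of "q\<^sup>2"]
      unfolding e by (simp add: power_mult_distrib mult_ac flip: power_mult)
  qed
  have "(\<Prod>j<3. f j) = f 0 * f 1 * f 2" for f :: "nat \<Rightarrow> complex" by (simp add: numeral_eq_Suc)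
  hence c3: "J 3 q = qp (q ^ 3) (q ^ 9) * qp (q ^ 6) (q ^ 9) * J 9 q"
    using qp_split[OF norm_q_power[of 3], of 3 "q ^ 3"] by (simp add: J_qp flip: power_mult power_add)
  have "J 1 q * J 1 (z * q) * J 1 (z\<^sup>2 * q) =
      (qp q (q ^ 3) * qp (z * q) (q ^ 3) * qp (z\<^sup>2 * q) (q ^ 3)) *
      (qp (q\<^sup>2) (q ^ 3) * qp ((z\<^sup>2 * q)\<^sup>2) (q ^ 3) * qp ((z * q)\<^sup>2) (q ^ 3)) * J 3 q ^ 3"
    using q1 nz z3 z6 by (subst (1 2 3) s) (simp_all add: norm_mult norm_power power_mult_distrib power3_eq_cube mult_ac)
  also have "\<dots> = J 3 q ^ 4 / J 9 q" unfolding c1 c2 using c3 J_ne_0[of 9]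
    by (simp add: field_simps eval_nat_numeral)
  finally show ?thesis .
qed

text \<open>In the sum of (-1)^t q^(t^2), t = 3u reproduces the series at q^9, while t = 3u + 1 and
  t = 3u - 1 contribute equally by t -> -t.\<close>

lemma phi_trisection: "J 1 q ^ 2 / J 2 q = J 9 q ^ 2 / J 18 q - 2 * q * jt (q ^ 3) (q ^ 18)"
proof -
  define f where "f = (\<lambda>t. (-1) powi t * q powi (t\<^sup>2))"
  define B where "B = jt (q ^ 3) (q ^ 18)"
  have f: "(f has_sum (J 1 q ^ 2 / J 2 q)) UNIV"
    using phi_sum[of 1] by (simp add: f_def)
  have m1: "(-1 :: complex) powi (3 * u) = (-1) powi u" for u by (simp add: power_int_mult)
  have "((\<lambda>u. (-1) powi u * q powi (int 9 * u\<^sup>2)) has_sum (J 9 q ^ 2 / J (2 * 9) q)) UNIV"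
    by (rule phi_sum) simp
  moreover have "(-1) powi u * q powi (int 9 * u\<^sup>2) = f (3 * u)" for u
    by (simp add: f_def m1 power_mult_distrib)
  ultimately have f0: "((\<lambda>u. f (3 * u)) has_sum (J 9 q ^ 2 / J 18 q)) UNIV" by simp
  have "((\<lambda>u. - q * ((q ^ 18) powi tri u * (- (q ^ 3)) powi u)) has_sum (- q * B)) UNIV"
    unfolding B_def by (intro has_sum_cmult_right jacobi_triple_product norm_q_power) (use q0 in auto)
  moreover have "- q * ((q ^ 18) powi tri u * (- (q ^ 3)) powi u) = f (3 * u - 1)" for u
  proof -
    have "- (q ^ 3) = (- 1) * q ^ 3" by simp
    hence "(- (q ^ 3)) powi u = (-1) powi u * q powi (int 3 * u)" by (simp only: power_int_mult_distrib power_int_power)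
    moreover have "(q ^ 18) powi tri u = q powi (int 18 * tri u)" by (rule power_int_power)
    moreover have e: "(3 * u - 1)\<^sup>2 = int 18 * tri u + (int 3 * u + 1)" using two_tri[of u] by (simp add: power2_eq_square algebra_simps)
    have "q powi ((3 * u - 1)\<^sup>2) = q powi (int 18 * tri u) * (q powi (int 3 * u) * q)"
      unfolding e using q0 by (simp add: power_int_add)
    moreover have "(-1 :: complex) powi (3 * u - 1) = - ((-1) powi u)"
      using m1[of u] by (simp add: power_int_diff)
    ultimately show ?thesis by (simp add: f_def mult_ac)
  qed
  ultimately have f2: "((\<lambda>u. f (3 * u - 1)) has_sum (- q * B)) UNIV" by simp
  have "f (- t) = f t" for t by (simp add: f_def power_int_minus flip: power_int_inverse)
  moreover have "- (3 * u - 1) = 3 * (- u) + 1" for u :: int by simp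
  ultimately have fe: "f (3 * u - 1) = f (3 * (- u) + 1)" for u by metis
  have "((\<lambda>u. f (3 * u - 1)) has_sum (- q * B)) UNIV \<longleftrightarrow> ((\<lambda>u. f (3 * u + 1)) has_sum (- q * B)) UNIV"
    by (rule has_sum_reindex_bij_witness[of _ uminus uminus]) (auto simp: fe)
  with f2 have f1: "((\<lambda>u. f (3 * u + 1)) has_sum (- q * B)) UNIV" by simp
  from f have "((\<lambda>(u, j). f (3 * u + j)) has_sum (J 1 q ^ 2 / J 2 q)) (UNIV \<times> {-1, 0, 1})"
  proof (rule iffD1[OF has_sum_reindex_bij_witness[of _ "\<lambda>(u, j). 3 * u + j" "\<lambda>t. ((t + 1) div 3, t - 3 * ((t + 1) div 3))"], rotated -1])
    fix t :: int
    have "t - 3 * ((t + 1) div 3) \<in> {-1, 0, 1}" by (simp, presburger)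
    thus "((t + 1) div 3, t - 3 * ((t + 1) div 3)) \<in> UNIV \<times> {-1, 0, 1}" by simp
  next
    fix x :: "int \<times> int" assume "x \<in> UNIV \<times> {-1, 0, 1}"
    then obtain u j where x: "x = (u, j)" "j \<in> {-1, 0, 1}" by auto
    have "(3 * u + j + 1) div 3 = u" using x(2) by (auto; presburger)
    thus "(((case x of (u, j) \<Rightarrow> 3 * u + j) + 1) div 3, (case x of (u, j) \<Rightarrow> 3 * u + j) - 3 * (((case x of (u, j) \<Rightarrow> 3 * u + j) + 1) div 3)) = x"
      using x by simp
  qed auto
  hence "((\<lambda>u. f (3 * u - 1) + f (3 * u) + f (3 * u + 1)) has_sum (J 1 q ^ 2 / J 2 q)) UNIV"
  proof (rule has_sum_SigmaD)
    fix u
    have "(\<Sum>j\<in>{-1, 0, 1}. f (3 * u + j)) = f (3 * u - 1) + f (3 * u) + f (3 * u + 1)" by simp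
    thus "((\<lambda>j. case (u, j) of (u, j) \<Rightarrow> f (3 * u + j)) has_sum (f (3 * u - 1) + f (3 * u) + f (3 * u + 1))) {-1, 0, 1}"
      by (intro has_sum_finiteI) simp_all
  qed
  moreover have "((\<lambda>u. f (3 * u - 1) + f (3 * u) + f (3 * u + 1)) has_sum (- q * B + J 9 q ^ 2 / J 18 q + - q * B)) UNIV"
    by (intro has_sum_add f0 f1 f2)
  ultimately have "J 1 q ^ 2 / J 2 q = - q * B + J 9 q ^ 2 / J 18 q + - q * B" by (rule has_sum_unique)
  thus ?thesis by (simp add: B_def)
qed

lemma qp_split_3: "qp a (q\<^sup>2) = qp a (q ^ 6) * qp (a * q\<^sup>2) (q ^ 6) * qp (a * q ^ 4) (q ^ 6)"
proof -
  have "(\<Prod>j<3. f j) = f 0 * f 1 * f 2" for f :: "nat \<Rightarrow> complex" by (simp add: numeral_eq_Suc)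
  thus ?thesis using qp_split[OF norm_q_power[of 2], of 3 a] by (simp flip: power_mult)
qed

lemma jt_1_6:
  "jt q (q ^ 6) = J 1 q * J 6 q ^ 2 / (J 2 q * J 3 q)"
  "jt (- q) (q ^ 6) = J 2 q ^ 2 * J 3 q * J 12 q / (J 1 q * J 4 q * J 6 q)"
proof -
  note nz = J_ne_0[of 1] J_ne_0[of 2] J_ne_0[of 3] J_ne_0[of 4] J_ne_0[of 6] J_ne_0[of 12]
  have e: "q * q\<^sup>2 = q ^ 3" "q * q ^ 4 = q ^ 5" "q ^ 6 / q = q ^ 5" "q ^ 6 / - q = - (q ^ 5)"
    using q0 by (simp_all add: divide_simps flip: power_Suc power_Suc2)
  have "qp q (q ^ 6) * qp (q ^ 5) (q ^ 6) = (J 1 q / J 2 q) / (J 3 q / J 6 q)"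
  proof -
    have "qp q (q\<^sup>2) = J 1 q / J 2 q" "qp (q ^ 3) (q ^ 6) = J 3 q / J 6 q" using qp_odd[of 1] qp_odd[of 3] by simp_all
    from qp_split_3[of q, unfolded e this] show ?thesis using nz by (simp add: mult_ac)
  qed
  thus "jt q (q ^ 6) = J 1 q * J 6 q ^ 2 / (J 2 q * J 3 q)"
    unfolding jt_def e J_qp[symmetric] using nz by (simp add: power2_eq_square mult_ac)
  have "qp (- q) (q ^ 6) * qp (- (q ^ 5)) (q ^ 6) = (J 2 q ^ 2 / (J 1 q * J 4 q)) / (J 6 q ^ 2 / (J 3 q * J 12 q))"
  proof -
    have "qp (- q) (q\<^sup>2) = J 2 q ^ 2 / (J 1 q * J 4 q)" "qp (- (q ^ 3)) (q ^ 6) = J 6 q ^ 2 / (J 3 q * J 12 q)"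
      using qp_neg_odd[of 1] qp_neg_odd[of 3] by simp_all
    from qp_split_3[of "- q", unfolded mult_minus_left e this] show ?thesis using nz by (simp add: mult_ac)
  qed
  thus "jt (- q) (q ^ 6) = J 2 q ^ 2 * J 3 q * J 12 q / (J 1 q * J 4 q * J 6 q)"
    unfolding jt_def e J_qp[symmetric] using nz by (simp add: power2_eq_square mult_ac)
qed

text \<open>Kronecker's identity at x = -q^k, y = -1 with base q^(2k): half of Jacobi's Lambert
  series for the square of phi(-q^k).\<close>

lemma phi_squared:
  assumes k: "k > 0"
  shows "((\<lambda>n. (- (q ^ k)) powi n / (1 + (q ^ (2 * k)) powi n)) has_sum (J k q ^ 4 / (2 * J (2 * k) q ^ 2))) UNIV"
proof -
  have "norm (q ^ (2 * k)) < norm (- (q ^ k))"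
    using q0 q1 k by (simp add: norm_power power_strict_decreasing)
  moreover have "- 1 * (q ^ (2 * k)) powi m \<noteq> 1" for m
    using powi_ne_minus_1[of "int (2 * k) * m"] by (simp only: power_int_power) (simp add: minus_equation_iff[of _ 1])
  ultimately have "((\<lambda>n. (- (q ^ k)) powi n / (1 - (- 1) * (q ^ (2 * k)) powi n)) has_sum
      (qp (q ^ (2 * k)) (q ^ (2 * k)) ^ 3 * jt (- (q ^ k) * - 1) (q ^ (2 * k)) / (jt (- (q ^ k)) (q ^ (2 * k)) * jt (- 1) (q ^ (2 * k))))) UNIV"
    using q0 norm_q_power[OF k] by (intro kronecker) auto
  also have "qp (q ^ (2 * k)) (q ^ (2 * k)) ^ 3 * jt (- (q ^ k) * - 1) (q ^ (2 * k)) / (jt (- (q ^ k)) (q ^ (2 * k)) * jt (- 1) (q ^ (2 * k)))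
      = J k q ^ 4 / (2 * J (2 * k) q ^ 2)"
  proof -
    have "q ^ (2 * k) / q ^ k = q ^ k" using q0 by (simp add: mult_2 power_add)
    hence 1: "jt (- (q ^ k) * - 1) (q ^ (2 * k)) = (J k q / J (2 * k) q) * (J k q / J (2 * k) q) * J (2 * k) q"
      "jt (- (q ^ k)) (q ^ (2 * k)) = (J (2 * k) q ^ 2 / (J k q * J (4 * k) q)) * (J (2 * k) q ^ 2 / (J k q * J (4 * k) q)) * J (2 * k) q"
      unfolding jt_def J_qp[symmetric] by (simp_all add: qp_odd[OF k] qp_neg_odd[OF k])
    have 2: "jt (- 1) (q ^ (2 * k)) = 2 * J (4 * k) q ^ 2 / J (2 * k) q"
      using jt_minus_1[of "2 * k"] k by simp
    show ?thesis unfolding 1 2 J_qp[symmetric] using J_ne_0[of k] J_ne_0[of "2 * k"] J_ne_0[of "4 * k"] k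
      by (simp add: divide_simps) (simp add: eval_nat_numeral)
  qed
  finally show ?thesis by simp
qed

text \<open>With y = (-q)^n, the factorisation 1 + y^6 = (1 + y^2)(1 - y^2 + y^4) gives y/(1 + y^2)
  + y^3/(1 + y^6) = (y + y^5)/(1 + y^6). The two series on the right are exchanged by n -> -n, so
  the sum of squares is a multiple of one Kronecker sum with base q^6, hence a product.\<close>

lemma phi_squares_1_3:
  "J 1 q ^ 4 / J 2 q ^ 2 + J 3 q ^ 4 / J 6 q ^ 2 = 2 * J 1 q ^ 2 * J 4 q * J 6 q ^ 7 / (J 2 q ^ 3 * J 3 q ^ 2 * J 12 q ^ 3)"
proof -
  define K where "K = qp (q ^ 6) (q ^ 6) ^ 3 * jt (- q * - 1) (q ^ 6) / (jt (- q) (q ^ 6) * jt (- 1) (q ^ 6))"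
  have ne: "1 + (q ^ 6) powi m \<noteq> 0" for m
    using powi_ne_minus_1[of "6 * m"] power_int_power[of q 6 m] by (simp add: add_eq_0_iff)
  have "norm (q ^ 6) < norm (- q)"
    using q0 q1 power_strict_decreasing[of 1 6 "norm q"] by (simp add: norm_power)
  moreover have "- 1 * (q ^ 6) powi m \<noteq> 1" for m using ne[of m] by (simp add: minus_equation_iff[of _ 1] add_eq_0_iff)
  ultimately have "((\<lambda>n. (- q) powi n / (1 - (- 1) * (q ^ 6) powi n)) has_sum K) UNIV"
    unfolding K_def using q0 q1 by (intro kronecker) auto
  hence K: "((\<lambda>n. (- q) powi n / (1 + (q ^ 6) powi n)) has_sum K) UNIV" by simp
  have flip: "((- q) ^ 5) powi n / (1 + (q ^ 6) powi n) = (- q) powi (- n) / (1 + (q ^ 6) powi (- n))" for n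
  proof -
    define y where "y = (- q) powi n"
    have y: "y \<noteq> 0" using q0 by (simp add: y_def)
    have "(q ^ 6) = (- q) ^ 6" by simp
    hence "(q ^ 6) powi n = y ^ 6" unfolding y_def by (simp only: power_int_power power_int_power') (simp add: mult.commute)
    moreover have "((- q) ^ 5) powi n = y ^ 5" unfolding y_def by (simp only: power_int_power power_int_power') (simp add: mult.commute)
    moreover have "1 + y ^ 6 \<noteq> 0" using ne[of n] calculation by simp
    ultimately show ?thesis unfolding power_int_minus y_def[symmetric] using y
      by (simp add: divide_simps add.commute) (simp add: eval_nat_numeral)
  qed
  have "((\<lambda>n. ((- q) ^ 5) powi n / (1 + (q ^ 6) powi n)) has_sum K) UNIV \<longleftrightarrow> ((\<lambda>n. (- q) powi n / (1 + (q ^ 6) powi n)) has_sum K) UNIV"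
    by (rule has_sum_reindex_bij_witness[of _ uminus uminus]) (simp_all only: minus_minus UNIV_I flip)
  hence h1: "((\<lambda>n. (- q) powi n / (1 + (q ^ 6) powi n) + ((- q) ^ 5) powi n / (1 + (q ^ 6) powi n)) has_sum (K + K)) UNIV"
    using K by (intro has_sum_add) auto
  have h2: "((\<lambda>n. (- (q ^ 1)) powi n / (1 + (q ^ (2 * 1)) powi n) + (- (q ^ 3)) powi n / (1 + (q ^ (2 * 3)) powi n)) has_sum
      (J 1 q ^ 4 / (2 * J (2 * 1) q ^ 2) + J 3 q ^ 4 / (2 * J (2 * 3) q ^ 2))) UNIV"
    by (intro has_sum_add phi_squared) auto
  have eq: "(- (q ^ 1)) powi n / (1 + (q ^ (2 * 1)) powi n) + (- (q ^ 3)) powi n / (1 + (q ^ (2 * 3)) powi n)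
      = (- q) powi n / (1 + (q ^ 6) powi n) + ((- q) ^ 5) powi n / (1 + (q ^ 6) powi n)" for n
  proof -
    define y where "y = (- q) powi n"
    have "q ^ 6 = (- q) ^ 6" "q ^ (2 * 3) = (- q) ^ 6" "q ^ (2 * 1) = (- q) ^ 2" "- (q ^ 3) = (- q) ^ 3" by simp_all
    hence p: "(q ^ 6) powi n = y ^ 6" "(q ^ (2 * 3)) powi n = y ^ 6" "(q ^ (2 * 1)) powi n = y ^ 2" "(- (q ^ 3)) powi n = y ^ 3" "((- q) ^ 5) powi n = y ^ 5"
      unfolding y_def by (simp_all only: power_int_power power_int_power') (simp_all add: mult.commute)
    have "1 + y ^ 6 \<noteq> 0" using ne[of n] p by simp
    moreover have f: "1 + y ^ 6 = (1 + y\<^sup>2) * (1 - y\<^sup>2 + y ^ 4)" by (simp add: eval_nat_numeral algebra_simps)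
    ultimately have "1 + y\<^sup>2 \<noteq> 0" by auto
    have "y / (1 + y\<^sup>2) = y * (1 - y\<^sup>2 + y ^ 4) / (1 + y ^ 6)" unfolding f using \<open>1 + y ^ 6 \<noteq> 0\<close> f by simp
    thus ?thesis unfolding p by (simp add: y_def[symmetric] flip: add_divide_distrib) (simp add: eval_nat_numeral algebra_simps)
  qed
  define S where "S = J 1 q ^ 4 / J 2 q ^ 2 + J 3 q ^ 4 / J 6 q ^ 2"
  have "K + K = J 1 q ^ 4 / (2 * J (2 * 1) q ^ 2) + J 3 q ^ 4 / (2 * J (2 * 3) q ^ 2)"
    by (rule has_sum_unique[OF h1]) (use h2 in \<open>simp only: eq\<close>)
  hence "K + K = S / 2" by (simp add: S_def add_divide_distrib mult.commute)
  hence "S = 4 * K" by simp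
  also have "K = J 6 q ^ 3 * (J 1 q * J 6 q ^ 2 / (J 2 q * J 3 q)) / (J 2 q ^ 2 * J 3 q * J 12 q / (J 1 q * J 4 q * J 6 q) * (2 * J 12 q ^ 2 / J 6 q))"
    unfolding K_def using jt_1_6 jt_minus_1[of 6] by (simp add: J_qp[symmetric])
  finally have "J 1 q ^ 4 / J 2 q ^ 2 + J 3 q ^ 4 / J 6 q ^ 2 = 4 * (J 6 q ^ 3 * (J 1 q * J 6 q ^ 2 / (J 2 q * J 3 q)) / (J 2 q ^ 2 * J 3 q * J 12 q / (J 1 q * J 4 q * J 6 q) * (2 * J 12 q ^ 2 / J 6 q)))"
    unfolding S_def .
  also have "\<dots> = 2 * J 1 q ^ 2 * J 4 q * J 6 q ^ 7 / (J 2 q ^ 3 * J 3 q ^ 2 * J 12 q ^ 3)"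
    using J_ne_0[of 1] J_ne_0[of 2] J_ne_0[of 3] J_ne_0[of 4] J_ne_0[of 6] J_ne_0[of 12]
    by (simp add: field_simps eval_nat_numeral)
  finally show ?thesis .
qed

end

text \<open>Over the common denominator A^3 - 8q^3B^3 the first term has numerator q(A2 - 2q^2
  B2)(A^2 + 2qAB + 4q^2B^2); the sum over the cube roots retains three times its q^3 part.\<close>

lemma trisection_algebra:
  fixes A B A2 B2 q z :: complex
  assumes z: "z\<^sup>2 + z + 1 = 0" and nz: "A - 2 * q * B \<noteq> 0" "A - 2 * (z * q) * B \<noteq> 0" "A - 2 * (z\<^sup>2 * q) * B \<noteq> 0"
  shows "q * ((A2 - 2 * q\<^sup>2 * B2) / (A - 2 * q * B)) + z * q * ((A2 - 2 * (z * q)\<^sup>2 * B2) / (A - 2 * (z * q) * B))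
      + z\<^sup>2 * q * ((A2 - 2 * (z\<^sup>2 * q)\<^sup>2 * B2) / (A - 2 * (z\<^sup>2 * q) * B))
    = 3 * q ^ 3 * (4 * A2 * B\<^sup>2 - 2 * B2 * A\<^sup>2) / ((A - 2 * q * B) * (A - 2 * (z * q) * B) * (A - 2 * (z\<^sup>2 * q) * B))"
proof -
  have N: "q * (A2 - 2 * q\<^sup>2 * B2) * ((A - 2 * (z * q) * B) * (A - 2 * (z\<^sup>2 * q) * B))
      + z * q * (A2 - 2 * (z * q)\<^sup>2 * B2) * ((A - 2 * q * B) * (A - 2 * (z\<^sup>2 * q) * B))
      + z\<^sup>2 * q * (A2 - 2 * (z\<^sup>2 * q)\<^sup>2 * B2) * ((A - 2 * q * B) * (A - 2 * (z * q) * B))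
    = 3 * q ^ 3 * (4 * A2 * B\<^sup>2 - 2 * B2 * A\<^sup>2)"
    using z by algebra
  have c: "a / x + b / y + c / w = (a * (y * w) + b * (x * w) + c * (x * y)) / (x * y * w)"
    if "x \<noteq> 0" "y \<noteq> 0" "w \<noteq> 0" for a b c x y w :: complex
    using that by (simp add: field_simps)
  show ?thesis unfolding times_divide_eq_right c[OF nz] N ..
qed

context nome begin

text \<open>J 3 and J 6 are unchanged when q is rotated by z, and the rest of \<open>E\<close> is
  the quotient phi(-a^2)/phi(-a) of two series trisected by \<open>phi_trisection\<close>. The
  common denominator is evaluated by \<open>J_cube_product\<close>, the numerator by
  \<open>phi_squares_1_3\<close> at q^3.\<close>

lemma product_trisection:
  assumes z: "z\<^sup>2 + z + 1 = 0"
  defines "E \<equiv> \<lambda>a. J 2 a ^ 3 * J 3 a * J 6 a ^ 3 / (J 1 a ^ 2 * J 4 a)"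
  shows "q * E q + z * q * E (z * q) + z\<^sup>2 * q * E (z\<^sup>2 * q) =
     3 * (2 * q ^ 3 * J 36 q ^ 2 * J 9 q ^ 2 * J 6 q ^ 6 / (J 18 q ^ 2 * J 12 q * J 3 q ^ 3))"
proof -
  define A B A2 B2 where "A = J 9 q ^ 2 / J 18 q" "B = jt (q ^ 3) (q ^ 18)"
    "A2 = J 18 q ^ 2 / J 36 q" "B2 = jt (q ^ 6) (q ^ 36)"
  note nz = J_ne_0[of 3] J_ne_0[of 6] J_ne_0[of 9] J_ne_0[of 12] J_ne_0[of 18] J_ne_0[of 36]
  have z3: "z ^ 3 = 1" by (rule cube_root_of_unity(1)[OF z])
  have z6: "(z\<^sup>2) ^ 3 = 1"
  proof -
    have "(z\<^sup>2) ^ 3 = (z ^ 3)\<^sup>2" by (simp flip: power_mult)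
    thus ?thesis using z3 by simp
  qed
  have nzm: "norm z = 1" using z3 power_eq_imp_eq_base[of "norm z" 3 1] by (simp flip: norm_power)
  have phi: "J 1 a ^ 2 / J 2 a = A - 2 * a * B \<and> J 2 a ^ 2 / J 4 a = A2 - 2 * a\<^sup>2 * B2
      \<and> E a = J 3 q * J 6 q ^ 3 * ((A2 - 2 * a\<^sup>2 * B2) / (A - 2 * a * B)) \<and> A - 2 * a * B \<noteq> 0"
    if a: "a ^ 3 = q ^ 3" "norm a < 1" for a
  proof -
    have "a \<noteq> 0" using a(1) q0 by auto
    then interpret a: nome a using a(2) by unfold_locales
    have Ja: "J (3 * k) a = J (3 * k) q" for k
      using J_power[of k a 3] J_power[of k q 3] a(1) by simp
    have pa: "a ^ (3 * k) = q ^ (3 * k)" for k unfolding power_mult a(1) ..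
    have J: "J 3 a = J 3 q" "J 6 a = J 6 q" "J 9 a = J 9 q" "J 18 a = J 18 q" "J 36 a = J 36 q"
      using Ja[of 1] Ja[of 2] Ja[of 3] Ja[of 6] Ja[of 12] by simp_all
    have p: "a ^ 3 = q ^ 3" "a ^ 18 = q ^ 18" "a ^ 6 = q ^ 6" "a ^ 36 = q ^ 36"
      using pa[of 1] pa[of 6] pa[of 2] pa[of 12] by simp_all
    have 1: "J 1 a ^ 2 / J 2 a = A - 2 * a * B"
      unfolding a.phi_trisection A_B_A2_B2_def J p ..
    have "(a\<^sup>2) ^ 3 = a ^ 6" "(a\<^sup>2) ^ 18 = a ^ 36" by (simp_all flip: power_mult)
    hence 2: "J 2 a ^ 2 / J 4 a = A2 - 2 * a\<^sup>2 * B2"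
      using nome.phi_trisection[OF a.nome_power[of 2]] by (simp add: J_power A_B_A2_B2_def J p)
    have "J 1 a ^ 2 / J 2 a \<noteq> 0" using a.J_ne_0[of 1] a.J_ne_0[of 2] by simp
    moreover have "E a = J 3 a * J 6 a ^ 3 * ((J 2 a ^ 2 / J 4 a) / (J 1 a ^ 2 / J 2 a))"
      using a.J_ne_0[of 1] a.J_ne_0[of 2] a.J_ne_0[of 4] by (simp add: E_def field_simps eval_nat_numeral)
    ultimately show ?thesis unfolding 1 2 J using 1 by simp
  qed
  have q: "q ^ 3 = q ^ 3" "norm q < 1" "(z * q) ^ 3 = q ^ 3" "norm (z * q) < 1" "(z\<^sup>2 * q) ^ 3 = q ^ 3" "norm (z\<^sup>2 * q) < 1"
    using q1 z3 z6 nzm by (auto simp: power_mult_distrib norm_mult norm_power)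
  note phi0 = phi[OF q(1,2)] and phi1 = phi[OF q(3,4)] and phi2 = phi[OF q(5,6)]
  have ne: "A - 2 * q * B \<noteq> 0" "A - 2 * (z * q) * B \<noteq> 0" "A - 2 * (z\<^sup>2 * q) * B \<noteq> 0"
    using phi0 phi1 phi2 by blast+
  have P: "(A - 2 * q * B) * (A - 2 * (z * q) * B) * (A - 2 * (z\<^sup>2 * q) * B) = J 3 q ^ 8 * J 18 q / (J 9 q ^ 2 * J 6 q ^ 4)"
  proof -
    have zq: "(z\<^sup>2 * q)\<^sup>2 = z * q\<^sup>2"
    proof -
      have "(z\<^sup>2)\<^sup>2 = z ^ 3 * z" by (simp flip: power_mult power_Suc2)
      thus ?thesis using z3 by (simp add: power_mult_distrib)
    qed
    have J2: "J 2 a = J 1 (a\<^sup>2)" for a using J_power[of 1 a 2] by simp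
    have "J 2 q * J 2 (z * q) * J 2 (z\<^sup>2 * q) = J 1 (q\<^sup>2) * J 1 (z * q\<^sup>2) * J 1 (z\<^sup>2 * q\<^sup>2)"
      unfolding J2[of q] J2[of "z * q"] J2[of "z\<^sup>2 * q"] zq by (simp only: power_mult_distrib mult_ac)
    also have "\<dots> = J 6 q ^ 4 / J 18 q"
      using nome.J_cube_product[OF nome_power[of 2] z] by (simp add: J_power)
    finally have c2: "J 2 q * J 2 (z * q) * J 2 (z\<^sup>2 * q) = J 6 q ^ 4 / J 18 q" .
    have "(A - 2 * q * B) * (A - 2 * (z * q) * B) * (A - 2 * (z\<^sup>2 * q) * B)
       = (J 1 q ^ 2 / J 2 q) * (J 1 (z * q) ^ 2 / J 2 (z * q)) * (J 1 (z\<^sup>2 * q) ^ 2 / J 2 (z\<^sup>2 * q))"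
      using phi0 phi1 phi2 by simp
    also have "\<dots> = (J 1 q * J 1 (z * q) * J 1 (z\<^sup>2 * q)) ^ 2 / (J 2 q * J 2 (z * q) * J 2 (z\<^sup>2 * q))"
      by (simp add: power_mult_distrib)
    also have "\<dots> = J 3 q ^ 8 * J 18 q / (J 9 q ^ 2 * J 6 q ^ 4)"
      unfolding c2 J_cube_product[OF z] using nz by (simp add: power_divide flip: power_mult)
    finally show ?thesis .
  qed
  have B: "B = J 3 q * J 18 q ^ 2 / (J 6 q * J 9 q)" "B2 = J 6 q * J 36 q ^ 2 / (J 12 q * J 18 q)"
    using nome.jt_1_6(1)[OF nome_power[of 3]] nome.jt_1_6(1)[OF nome_power[of 6]]
    by (simp_all add: A_B_A2_B2_def J_power flip: power_mult)
  have sq: "J 3 q ^ 4 / J 6 q ^ 2 + J 9 q ^ 4 / J 18 q ^ 2 = 2 * J 3 q ^ 2 * J 12 q * J 18 q ^ 7 / (J 6 q ^ 3 * J 9 q ^ 2 * J 36 q ^ 3)"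
    using nome.phi_squares_1_3[OF nome_power[of 3]] by (simp add: J_power)
  \<comment> \<open>4 A2 B^2 is a multiple of the right side of \<open>sq\<close>, and the second
    square on the left of \<open>sq\<close> yields exactly the 2 B2 A^2 to be subtracted.\<close>
  have "4 * A2 * B\<^sup>2 = 2 * J 6 q * J 36 q ^ 2 / (J 12 q * J 18 q) *
     (2 * J 3 q ^ 2 * J 12 q * J 18 q ^ 7 / (J 6 q ^ 3 * J 9 q ^ 2 * J 36 q ^ 3))"
    unfolding B A_B_A2_B2_def(3) using nz by (simp add: field_simps eval_nat_numeral)
  also have "\<dots> = 2 * J 36 q ^ 2 * J 3 q ^ 4 / (J 6 q * J 12 q * J 18 q) + 2 * B2 * A\<^sup>2"
    unfolding sq[symmetric] B A_B_A2_B2_def(1) using nz by (simp add: field_simps eval_nat_numeral)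
  finally have N: "4 * A2 * B\<^sup>2 - 2 * B2 * A\<^sup>2 = 2 * J 36 q ^ 2 * J 3 q ^ 4 / (J 6 q * J 12 q * J 18 q)" by simp
  have "q * E q + z * q * E (z * q) + z\<^sup>2 * q * E (z\<^sup>2 * q) = J 3 q * J 6 q ^ 3 *
     (q * ((A2 - 2 * q\<^sup>2 * B2) / (A - 2 * q * B)) + z * q * ((A2 - 2 * (z * q)\<^sup>2 * B2) / (A - 2 * (z * q) * B))
      + z\<^sup>2 * q * ((A2 - 2 * (z\<^sup>2 * q)\<^sup>2 * B2) / (A - 2 * (z\<^sup>2 * q) * B)))"
    using phi0 phi1 phi2 by (simp only: distrib_left mult_ac)
  also have "\<dots> = J 3 q * J 6 q ^ 3 * (3 * q ^ 3 * (2 * J 36 q ^ 2 * J 3 q ^ 4 / (J 6 q * J 12 q * J 18 q)) / (J 3 q ^ 8 * J 18 q / (J 9 q ^ 2 * J 6 q ^ 4)))"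
    unfolding trisection_algebra[OF z ne] N P ..
  also have "\<dots> = 3 * (2 * q ^ 3 * J 36 q ^ 2 * J 9 q ^ 2 * J 6 q ^ 6 / (J 18 q ^ 2 * J 12 q * J 3 q ^ 3))"
    using nz by (simp add: field_simps eval_nat_numeral)
  finally show ?thesis .
qed

text \<open>1 + z^n + z^(2n) is 3 if 3 divides n and 0 otherwise.\<close>

lemma has_sum_trisection:
  assumes z: "z\<^sup>2 + z + 1 = 0"
    and "((\<lambda>i. f i * q powi N i) has_sum S0) A" "((\<lambda>i. f i * (z * q) powi N i) has_sum S1) A"
      "((\<lambda>i. f i * (z\<^sup>2 * q) powi N i) has_sum S2) A"
  shows "((\<lambda>i. f i * (q ^ 3) powi (N i div 3)) has_sum ((S0 + S1 + S2) / 3)) {i \<in> A. 3 dvd N i}"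
proof -
  have z3: "z ^ 3 = 1" and z0: "z \<noteq> 0" using cube_root_of_unity[OF z] by auto
  have zp: "z powi n = z powi (n mod 3)" for n
  proof -
    have "z powi n = z powi (3 * (n div 3) + n mod 3)" by simp
    also have "\<dots> = z powi (n mod 3)" unfolding power_int_add[OF disjI1[OF z0]] power_int_mult by (simp add: z3)
    finally show ?thesis .
  qed
  have f: "(1 / 3) * (f i * q powi N i + f i * (z * q) powi N i + f i * (z\<^sup>2 * q) powi N i)
      = (if 3 dvd N i then f i * (q ^ 3) powi (N i div 3) else 0)" for i
  proof -
    define n where "n = N i"
    have "(z\<^sup>2) powi n = (z powi n)\<^sup>2" by (simp add: power_int_power power_int_power' mult.commute)
    hence e: "f i * q powi n + f i * (z * q) powi n + f i * (z\<^sup>2 * q) powi n = f i * q powi n * (1 + z powi n + (z powi n)\<^sup>2)"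
      by (simp add: power_int_mult_distrib algebra_simps)
    have "n mod 3 = 0 \<or> n mod 3 = 1 \<or> n mod 3 = 2" by presburger
    then consider "n mod 3 = 0" | "n mod 3 = 1" | "n mod 3 = 2" by blast
    thus ?thesis
    proof cases
      case 1
      hence "q powi n = (q ^ 3) powi (n div 3)" by (simp add: power_int_power mod_0_imp_dvd)
      thus ?thesis using e 1 zp[of n] unfolding n_def by (simp add: dvd_eq_mod_eq_0)
    next
      case 2
      thus ?thesis using e zp[of n] z unfolding n_def by (simp add: dvd_eq_mod_eq_0 add_ac)
    next
      case 3
      have "(z\<^sup>2)\<^sup>2 = z ^ 3 * z" by (simp flip: power_mult power_Suc2)
      hence "1 + z\<^sup>2 + (z\<^sup>2)\<^sup>2 = 0" using z z3 by (simp add: algebra_simps)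
      thus ?thesis using e zp[of n] 3 unfolding n_def by (simp add: dvd_eq_mod_eq_0)
    qed
  qed
  have "((\<lambda>i. (1 / 3) * (f i * q powi N i + f i * (z * q) powi N i + f i * (z\<^sup>2 * q) powi N i)) has_sum ((1 / 3) * (S0 + S1 + S2))) A"
    by (intro has_sum_cmult_right has_sum_add assms)
  also have "?this \<longleftrightarrow> ((\<lambda>i. f i * (q ^ 3) powi (N i div 3)) has_sum ((1 / 3) * (S0 + S1 + S2))) {i \<in> A. 3 dvd N i}"
    unfolding f by (rule has_sum_cong_neutral) auto
  finally show ?thesis by simp
qed

end

section \<open>Both sides of the identity restricted to exponents divisible by 3\<close>

lemma red_triples_eq: "red_triples n = {t \<in> TT. TN t = int n}"
proof -
  have "tri (int i + 1) = int (i * (i + 1) div 2)" for i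
    unfolding tri_def by (simp add: zdiv_int algebra_simps)
  hence "2 * A * C = n + i * (i + 1) div 2 \<longleftrightarrow> TN (A, C, i) = int n" for A C i
    unfolding of_nat_eq_iff[symmetric, where 'a = int] TN_def by (auto simp del: of_nat_eq_iff of_nat_div)
  thus ?thesis unfolding red_triples_def TT_def by auto
qed

lemma TN_pos: "t \<in> TT \<Longrightarrow> TN t \<ge> 1"
  using TN_lower[of "fst t" "fst (snd t)" "snd (snd t)"] by (auto simp: TT_def)

lemma finite_red_triples: "finite (red_triples n)"
proof (rule finite_subset)
  show "red_triples n \<subseteq> {..n} \<times> {..n} \<times> {..<2 * n + 1}"
    unfolding red_triples_eq using TN_lower by (fastforce simp: TT_def)
qed simp

context nome begin

text \<open>24n - 1 = 8(3n) - 1, so the coefficient of index n counts the triples with TN = 3n,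
  which are those kept by the trisection.\<close>

lemma F_term_has_sum:
  assumes z: "z\<^sup>2 + z + 1 = 0"
  shows "(F_term (q ^ 3) has_sum ((h 0 + nome.h (z * q) 0 + nome.h (z\<^sup>2 * q) 0) / 3)) {1..}"
    (is "(_ has_sum ?S) _")
proof -
  have z3: "z ^ 3 = 1" and z0: "z \<noteq> 0" using cube_root_of_unity[OF z] by auto
  have nz: "norm z = 1" using z3 power_eq_imp_eq_base[of "norm z" 3 1] by (simp flip: norm_power)
  interpret q1: nome "z * q" using q0 q1 z0 nz by unfold_locales (auto simp: norm_mult)
  interpret q2: nome "z\<^sup>2 * q" using q0 q1 z0 nz by unfold_locales (auto simp: norm_mult norm_power)
  have "((\<lambda>t. 1 * (q ^ 3) powi (TN t div 3)) has_sum ?S) {t \<in> TT. 3 dvd TN t}"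
    by (rule has_sum_trisection[OF z]) (use TT_has_sum q1.TT_has_sum q2.TT_has_sum in simp_all)
  also have "?this \<longleftrightarrow> ((\<lambda>(n, t). (q ^ 3) ^ n) has_sum ?S) (Sigma {1..} (\<lambda>n. red_triples (3 * n)))"
  proof (rule has_sum_reindex_bij_witness[of _ snd "\<lambda>t. (nat (TN t div 3), t)"])
    fix t assume t: "t \<in> {t \<in> TT. 3 dvd TN t}"
    hence "TN t div 3 \<ge> 1" "3 * (TN t div 3) = TN t" using TN_pos[of t] by (auto elim!: dvdE)
    with t show "(nat (TN t div 3), t) \<in> Sigma {1..} (\<lambda>n. red_triples (3 * n))"
      "(case (nat (TN t div 3), t) of (n, t) \<Rightarrow> (q ^ 3) ^ n) = 1 * (q ^ 3) powi (TN t div 3)"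
      by (auto simp: red_triples_eq power_int_def)
  qed (auto simp: red_triples_eq)
  finally have "((\<lambda>(n, t). (q ^ 3) ^ n) has_sum ?S) (Sigma {1..} (\<lambda>n. red_triples (3 * n)))" .
  thus ?thesis
  proof (rule has_sum_SigmaD)
    fix n :: nat assume n: "n \<in> {1..}"
    have "F_term (q ^ 3) n = (\<Sum>t\<in>red_triples (3 * n). (q ^ 3) ^ n)"
      using hurwitz_class_number_eq_card[of "3 * n"] n by (simp add: F_term_def)
    thus "((\<lambda>t. case (n, t) of (n, t) \<Rightarrow> (q ^ 3) ^ n) has_sum F_term (q ^ 3) n) (red_triples (3 * n))"
      using finite_red_triples by (auto intro: has_sum_finiteI)
  qed
qed

text \<open>J 18 and J 36 depend on q^3 only, so they come out of the average over the three
  rotations of q.\<close>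

lemma WW_trisection_has_sum:
  assumes z: "z\<^sup>2 + z + 1 = 0"
  shows "((\<lambda>w. wcoeff w * (q ^ 3) powi (WN w div 3)) has_sum
      (2 * q ^ 3 * J 36 q ^ 2 * J 9 q ^ 2 * J 6 q ^ 6 / (J 18 q ^ 2 * J 12 q * J 3 q ^ 3)
        - J 18 q ^ 2 / J 36 q * ((h 0 + nome.h (z * q) 0 + nome.h (z\<^sup>2 * q) 0) / 3))) {w \<in> WW. 3 dvd WN w}"
proof -
  have z3: "z ^ 3 = 1" and z0: "z \<noteq> 0" using cube_root_of_unity[OF z] by auto
  have nz: "norm z = 1" using z3 power_eq_imp_eq_base[of "norm z" 3 1] by (simp flip: norm_power)
  interpret q1: nome "z * q" using q0 q1 z0 nz by unfold_locales (auto simp: norm_mult)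
  interpret q2: nome "z\<^sup>2 * q" using q0 q1 z0 nz by unfold_locales (auto simp: norm_mult norm_power)
  have "(z\<^sup>2) ^ 3 = (z ^ 3)\<^sup>2" by (simp flip: power_mult)
  hence "(z * q) ^ 3 = q ^ 3" "(z\<^sup>2 * q) ^ 3 = q ^ 3" by (simp_all add: power_mult_distrib z3)
  hence J: "J (3 * k) (z * q) = J (3 * k) q" "J (3 * k) (z\<^sup>2 * q) = J (3 * k) q" for k
    using J_power[of k "z * q" 3] J_power[of k "z\<^sup>2 * q" 3] J_power[of k q 3] by simp_all
  note J' = J(1)[of 6, simplified] J(1)[of 12, simplified] J(2)[of 6, simplified] J(2)[of 12, simplified]
  define E where "E = (\<lambda>a. J 2 a ^ 3 * J 3 a * J 6 a ^ 3 / (J 1 a ^ 2 * J 4 a))"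
  define \<phi> where "\<phi> = J 18 q ^ 2 / J 36 q"
  have "((\<lambda>w. wcoeff w * (q ^ 3) powi (WN w div 3)) has_sum
      ((q * E q - \<phi> * h 0 + (z * q * E (z * q) - \<phi> * nome.h (z * q) 0) + (z\<^sup>2 * q * E (z\<^sup>2 * q) - \<phi> * nome.h (z\<^sup>2 * q) 0)) / 3)) {w \<in> WW. 3 dvd WN w}"
    by (rule has_sum_trisection[OF z]) (use hurwitz_theta_identity q1.hurwitz_theta_identity q2.hurwitz_theta_identity in \<open>simp_all only: J' E_def \<phi>_def\<close>)
  also have "(q * E q - \<phi> * h 0 + (z * q * E (z * q) - \<phi> * nome.h (z * q) 0) + (z\<^sup>2 * q * E (z\<^sup>2 * q) - \<phi> * nome.h (z\<^sup>2 * q) 0)) / 3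
     = (q * E q + z * q * E (z * q) + z\<^sup>2 * q * E (z\<^sup>2 * q)) / 3 - \<phi> * ((h 0 + nome.h (z * q) 0 + nome.h (z\<^sup>2 * q) 0) / 3)"
    by (simp add: field_simps)
  also have "q * E q + z * q * E (z * q) + z\<^sup>2 * q * E (z\<^sup>2 * q) =
     3 * (2 * q ^ 3 * J 36 q ^ 2 * J 9 q ^ 2 * J 6 q ^ 6 / (J 18 q ^ 2 * J 12 q * J 3 q ^ 3))"
    unfolding E_def by (rule product_trisection[OF z])
  also have "3 * c / 3 = c" for c :: complex by simp
  finally show ?thesis unfolding \<phi>_def .
qed

end

section \<open>Lambert series\<close>

text \<open>The \<open>l\<close>-th term in the geometric expansion of the \<open>k\<close>-th Lambert quotient is the term of the
  sum over \<open>WW\<close> at this index.\<close>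

definition lambert_index1 :: "int \<times> nat \<Rightarrow> nat \<times> nat" where
  "lambert_index1 = (\<lambda>(k, l). if k \<ge> 1 then (nat k + l, 6 * l) else (nat (- k) + l + 1, 6 * l + 5))"

definition lambert_index2 :: "int \<times> nat \<Rightarrow> nat \<times> nat" where
  "lambert_index2 = (\<lambda>(k, l). if k \<ge> 1 then (nat k + l, 6 * l + 3) else (nat (- k) + l + 1, 6 * l + 2))"

lemma inj_lambert_index: "inj lambert_index1" "inj lambert_index2"
proof -
  have [simp]: "6 * (a::nat) \<noteq> 6 * b + 5" "6 * a + 5 \<noteq> 6 * b" "6 * a + 3 \<noteq> 6 * b + 2" "6 * b + 2 \<noteq> 6 * a + 3"
    "Suc (6 * a) \<noteq> 6 * b" "6 * a \<noteq> Suc (6 * b)" for a b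
    by presburger+
  show "inj lambert_index1" "inj lambert_index2"
    unfolding inj_on_def lambert_index1_def lambert_index2_def by (auto split: if_splits)
qed

text \<open>Modulo 3 only 2 tri (i + 1) = i(i + 1) matters, and it is a multiple of 3 unless i = 1
  mod 3. The residues left modulo 6 are 0, 5 and 2, 3, one pair for each Lambert series.\<close>

lemma three_dvd_WN: "3 dvd WN (m, i) \<longleftrightarrow> i mod 3 \<noteq> 1"
proof -
  have "prime (3 :: int)" by simp
  have "18 * (int m)\<^sup>2 = 3 * (6 * (int m)\<^sup>2)" by simp
  hence "3 dvd 18 * (int m)\<^sup>2" by (metis dvd_triv_left)
  hence "3 dvd WN (m, i) \<longleftrightarrow> 3 dvd tri (int i + 1)" unfolding WN_def prod.case
    by (metis dvd_diff diff_diff_eq2 add_diff_cancel_left')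
  also have "\<dots> \<longleftrightarrow> 3 dvd 2 * tri (int i + 1)" by presburger
  also have "\<dots> \<longleftrightarrow> 3 dvd int i + 1 \<or> 3 dvd int i"
    unfolding two_tri prime_dvd_mult_iff[OF \<open>prime (3 :: int)\<close>] by simp
  also have "\<dots> \<longleftrightarrow> i mod 3 \<noteq> 1" by presburger
  finally show ?thesis .
qed

lemma range_lambert_index1: "range lambert_index1 = {(m, i). i < 6 * m \<and> (i mod 6 = 0 \<or> i mod 6 = 5)}"
proof (intro equalityI subsetI)
  fix w assume "w \<in> range lambert_index1"
  then obtain k l where "w = lambert_index1 (k, l)" by auto
  thus "w \<in> {(m, i). i < 6 * m \<and> (i mod 6 = 0 \<or> i mod 6 = 5)}" unfolding lambert_index1_def by auto
next
  fix w :: "nat \<times> nat" assume w: "w \<in> {(m, i). i < 6 * m \<and> (i mod 6 = 0 \<or> i mod 6 = 5)}"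
  obtain m i where mi: "w = (m, i)" by (cases w)
  define l where "l = i div 6"
  show "w \<in> range lambert_index1"
  proof (cases "i mod 6 = 0")
    case True
    hence "i = 6 * l" "l < m" using w mi by (auto simp: l_def)
    hence "w = lambert_index1 (int m - int l, l)" by (simp add: mi lambert_index1_def nat_diff_distrib)
    thus ?thesis by blast
  next
    case False
    hence "i = 6 * l + 5" using w mi unfolding l_def by auto presburger
    moreover from this have "l < m" using w mi by auto
    ultimately have "w = lambert_index1 (int l + 1 - int m, l)" by (simp add: mi lambert_index1_def)
    thus ?thesis by blast
  qed
qed

lemma range_lambert_index2: "range lambert_index2 = {(m, i). i < 6 * m \<and> (i mod 6 = 2 \<or> i mod 6 = 3)}"
proof (intro equalityI subsetI)
  fix w assume "w \<in> range lambert_index2"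
  then obtain k l where "w = lambert_index2 (k, l)" by auto
  thus "w \<in> {(m, i). i < 6 * m \<and> (i mod 6 = 2 \<or> i mod 6 = 3)}" unfolding lambert_index2_def by auto presburger+
next
  fix w :: "nat \<times> nat" assume w: "w \<in> {(m, i). i < 6 * m \<and> (i mod 6 = 2 \<or> i mod 6 = 3)}"
  obtain m i where mi: "w = (m, i)" by (cases w)
  define l where "l = i div 6"
  show "w \<in> range lambert_index2"
  proof (cases "i mod 6 = 3")
    case True
    hence "i = 6 * l + 3" unfolding l_def by presburger
    moreover from this have "l < m" using w mi by auto
    ultimately have "w = lambert_index2 (int m - int l, l)" by (simp add: mi lambert_index2_def nat_diff_distrib)
    thus ?thesis by blast
  next
    case False
    hence "i = 6 * l + 2" using w mi unfolding l_def by auto presburger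
    moreover from this have "l < m" using w mi by auto
    ultimately have "w = lambert_index2 (int l + 1 - int m, l)" by (simp add: mi lambert_index2_def)
    thus ?thesis by blast
  qed
qed

text \<open>When l grows by 1, m grows by 1 and i by 6, so the l^2 parts of 18m^2 and of tri (i + 1)
  cancel and the exponent is linear in l, as in a geometric series.\<close>

lemma WN_lambert_index1:
  "WN (lambert_index1 (k, l)) div 3 = 6 * k\<^sup>2 + (if k \<ge> 1 then (12 * k - 1) * int l else (1 - 12 * k) * (int l + 1))"
proof -
  have "WN (lambert_index1 (k, l)) = 3 * (6 * k\<^sup>2 + (if k \<ge> 1 then (12 * k - 1) * int l else (1 - 12 * k) * (int l + 1)))"
  proof (cases "k \<ge> 1")
    case True
    thus ?thesis using two_tri[of "6 * int l + 1"]
      by (simp add: WN_def lambert_index1_def power2_eq_square algebra_simps)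
  next
    case False
    thus ?thesis using two_tri[of "6 * int l + 6"]
      by (simp add: WN_def lambert_index1_def power2_eq_square algebra_simps)
  qed
  thus ?thesis by simp
qed

lemma WN_lambert_index2:
  "WN (lambert_index2 (k, l)) div 3 = 6 * k\<^sup>2 - 2 + (if k \<ge> 1 then (12 * k - 7) * int l else (7 - 12 * k) * (int l + 1))"
proof -
  have "WN (lambert_index2 (k, l)) = 3 * (6 * k\<^sup>2 - 2 + (if k \<ge> 1 then (12 * k - 7) * int l else (7 - 12 * k) * (int l + 1)))"
  proof (cases "k \<ge> 1")
    case True
    thus ?thesis using two_tri[of "6 * int l + 4"]
      by (simp add: WN_def lambert_index2_def power2_eq_square algebra_simps)
  next
    case False
    thus ?thesis using two_tri[of "6 * int l + 3"]
      by (simp add: WN_def lambert_index2_def power2_eq_square algebra_simps)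
  qed
  thus ?thesis by simp
qed

text \<open>12m - 2i - 1 does not depend on l. For k <= 0 it is the negative of 12k - 1 or 12k - 7,
  which is offset by the extra sign from m = l + 1 - k.\<close>

lemma wcoeff_lambert_index:
  "- wcoeff (lambert_index1 (k, l)) = (-1) powi (k - 1) * of_int (12 * k - 1) * (-1) ^ l"
  "- wcoeff (lambert_index2 (k, l)) = (-1) powi (k - 1) * of_int (12 * k - 7) * (-1) ^ l"
proof -
  have m: "(-1 :: complex) powi (k - 1) = - ((-1) ^ nat \<bar>k\<bar>)"
  proof -
    have "(-1 :: complex) powi (k - 1) = - ((-1) powi k)" by (simp add: power_int_diff)
    thus ?thesis by (auto simp: power_int_def abs_if power_inverse)
  qed
  show "- wcoeff (lambert_index1 (k, l)) = (-1) powi (k - 1) * of_int (12 * k - 1) * (-1) ^ l"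
    unfolding m by (cases "k \<ge> 1") (simp_all add: wcoeff_def lambert_index1_def power_add algebra_simps)
  show "- wcoeff (lambert_index2 (k, l)) = (-1) powi (k - 1) * of_int (12 * k - 7) * (-1) ^ l"
    unfolding m by (cases "k \<ge> 1") (simp_all add: wcoeff_def lambert_index2_def power_add algebra_simps)
qed

context nome begin

text \<open>For m < 0 the convergent expansion comes from 1 / (1 + q^m) = q^(-m) / (1 + q^(-m)),
  whence l + 1 in the exponent.\<close>

lemma inverse_one_plus_powi:
  assumes "m \<noteq> 0"
  shows "((\<lambda>l. (-1) ^ l * q powi (if m > 0 then m * int l else - m * (int l + 1))) has_sum (1 / (1 + q powi m))) UNIV"
proof -
  define y where "y = q powi \<bar>m\<bar>"
  have "norm y < 1" unfolding y_def using assms q1 by (simp add: power_int_def norm_power power_less_one_iff)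
  hence g: "((\<lambda>l. (- y) ^ l) has_sum (1 / (1 + y))) UNIV" using has_sum_geometric[of "- y"] by simp
  have y: "(- y) ^ l = (-1) ^ l * q powi (\<bar>m\<bar> * int l)" for l
    by (simp add: y_def power_minus[of "q powi _"] power_int_mult)
  show ?thesis
  proof (cases "m > 0")
    case True
    thus ?thesis using g unfolding y by (simp add: y_def)
  next
    case False
    have "y \<noteq> 0" using q0 by (simp add: y_def)
    have "q powi m = 1 / y" using False by (simp add: y_def power_int_minus field_simps)
    hence "1 + q powi m = (1 + y) / y" using \<open>y \<noteq> 0\<close> by (simp add: add_divide_distrib)
    hence "y * (1 / (1 + y)) = 1 / (1 + q powi m)" by simp
    moreover have "y * (- y) ^ l = (-1) ^ l * q powi (- m * (int l + 1))" for l
    proof -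
      have "- m * (int l + 1) = \<bar>m\<bar> + \<bar>m\<bar> * int l" using False by (simp add: algebra_simps)
      thus ?thesis using q0 unfolding y by (simp add: y_def power_int_add)
    qed
    ultimately show ?thesis using has_sum_cmult_right[OF g, of y] False by simp
  qed
qed

lemma lambert_term1_has_sum:
  "((\<lambda>l. - wcoeff (lambert_index1 (k, l)) * q powi (WN (lambert_index1 (k, l)) div 3)) has_sum lambert_term1 q k) UNIV"
proof -
  have k: "12 * k - 1 \<noteq> 0" "12 * k - 1 > 0 \<longleftrightarrow> k \<ge> 1" by presburger+
  have "- wcoeff (lambert_index1 (k, l)) * q powi (WN (lambert_index1 (k, l)) div 3) =
      (-1) powi (k - 1) * of_int (12 * k - 1) * q powi (6 * k\<^sup>2) *
      ((-1) ^ l * q powi (if 12 * k - 1 > 0 then (12 * k - 1) * int l else - (12 * k - 1) * (int l + 1)))" for l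
    unfolding wcoeff_lambert_index WN_lambert_index1 k(2) power_int_add[OF disjI1[OF q0]] by simp
  thus ?thesis
    using has_sum_cmult_right[OF inverse_one_plus_powi[OF k(1)], of "(-1) powi (k - 1) * of_int (12 * k - 1) * q powi (6 * k\<^sup>2)"]
    by (simp add: lambert_term1_eq[OF q1 q0])
qed

lemma lambert_term2_has_sum:
  "((\<lambda>l. - wcoeff (lambert_index2 (k, l)) * q powi (WN (lambert_index2 (k, l)) div 3)) has_sum lambert_term2 q k) UNIV"
proof -
  have k: "12 * k - 7 \<noteq> 0" "12 * k - 7 > 0 \<longleftrightarrow> k \<ge> 1" by presburger+
  have "- wcoeff (lambert_index2 (k, l)) * q powi (WN (lambert_index2 (k, l)) div 3) =
      (-1) powi (k - 1) * of_int (12 * k - 7) * q powi (6 * k\<^sup>2 - 2) *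
      ((-1) ^ l * q powi (if 12 * k - 7 > 0 then (12 * k - 7) * int l else - (12 * k - 7) * (int l + 1)))" for l
    unfolding wcoeff_lambert_index WN_lambert_index2 k(2) power_int_add[OF disjI1[OF q0]] by simp
  thus ?thesis
    using has_sum_cmult_right[OF inverse_one_plus_powi[OF k(1)], of "(-1) powi (k - 1) * of_int (12 * k - 7) * q powi (6 * k\<^sup>2 - 2)"]
    by (simp add: lambert_term2_eq[OF q1 q0])
qed

text \<open>The ranges of the two index maps partition the pairs with exponent divisible by 3, and
  unconditional convergence allows summing over l first. Convergence of both Lambert series is thus
  inherited from the sum over \<open>WW\<close>.\<close>

lemma lambert_sums:
  assumes "((\<lambda>w. wcoeff w * q powi (WN w div 3)) has_sum S) {w \<in> WW. 3 dvd WN w}"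
  shows "\<exists>L1 L2. (lambert_term1 q has_sum L1) UNIV \<and> (lambert_term2 q has_sum L2) UNIV \<and> L1 + L2 = - S"
proof -
  define g where "g = (\<lambda>w. - wcoeff w * q powi (WN w div 3))"
  have un: "{w \<in> WW. 3 dvd WN w} = range lambert_index1 \<union> range lambert_index2"
    and disj: "range lambert_index1 \<inter> range lambert_index2 = {}"
  proof -
    have mod: "i mod 3 \<noteq> 1 \<longleftrightarrow> (i mod 6 = 0 \<or> i mod 6 = 5) \<or> (i mod 6 = 2 \<or> i mod 6 = 3)" for i :: nat by presburger
    have "(m, i) \<in> {w \<in> WW. 3 dvd WN w} \<longleftrightarrow> (m, i) \<in> range lambert_index1 \<union> range lambert_index2" for m i
      unfolding range_lambert_index1 range_lambert_index2 Un_iff mem_Collect_eq WW_def prod.case three_dvd_WN mod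
      by (simp only: conj_disj_distribL)
    thus "{w \<in> WW. 3 dvd WN w} = range lambert_index1 \<union> range lambert_index2" by (intro set_eqI) (simp only: split_paired_all)
  qed (auto simp: range_lambert_index1 range_lambert_index2)
  have "((\<lambda>w. - (wcoeff w * q powi (WN w div 3))) has_sum (- S)) (range lambert_index1 \<union> range lambert_index2)"
    unfolding un[symmetric] by (rule has_sum_uminusI[OF assms])
  hence g: "(g has_sum (- S)) (range lambert_index1 \<union> range lambert_index2)"
    unfolding g_def mult_minus_left .
  hence "g summable_on range lambert_index1" "g summable_on range lambert_index2"
    by (rule summable_on_subset_banach[OF has_sum_imp_summable], simp)+
  then obtain L1 L2 where L: "(g has_sum L1) (range lambert_index1)" "(g has_sum L2) (range lambert_index2)"
    by (auto simp: summable_on_def)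
  have "L1 + L2 = - S" by (rule has_sum_unique[OF has_sum_Un_disjoint[OF L disj] g])
  moreover have "(lambert_term1 q has_sum L1) UNIV"
  proof (rule has_sum_SigmaD)
    show "((g \<circ> lambert_index1) has_sum L1) (Sigma UNIV (\<lambda>_. UNIV))"
      using L(1) unfolding has_sum_reindex[OF inj_lambert_index(1)] by simp
  qed (use lambert_term1_has_sum in \<open>simp add: g_def\<close>)
  moreover have "(lambert_term2 q has_sum L2) UNIV"
  proof (rule has_sum_SigmaD)
    show "((g \<circ> lambert_index2) has_sum L2) (Sigma UNIV (\<lambda>_. UNIV))"
      using L(2) unfolding has_sum_reindex[OF inj_lambert_index(2)] by simp
  qed (use lambert_term2_has_sum in \<open>simp add: g_def\<close>)
  ultimately show ?thesis by blast
qed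

end

theorem theorem3p15:
  fixes q :: complex
  assumes "norm q < 1"
  shows "F_term q summable_on {1..}
    \<and> lambert_term1 q summable_on UNIV
    \<and> lambert_term2 q summable_on UNIV
    \<and> (J 6 q)\<^sup>2 / J 12 q * F_24_m1 q =
        (\<Sum>\<^sub>\<infinity>k\<in>UNIV. lambert_term1 q k) + (\<Sum>\<^sub>\<infinity>k\<in>UNIV. lambert_term2 q k)
        + 2 * q * (J 12 q)\<^sup>2 * (J 3 q)\<^sup>2 * (J 2 q) ^ 6
            / ((J 6 q)\<^sup>2 * J 4 q * (J 1 q) ^ 3)"
proof (cases "q = 0")
  \<comment> \<open>At q = 0 every Lambert term takes its removable value 0, and
    \<open>F_term\<close> vanishes because n >= 1.\<close>
  case True
  have "F_term q n = 0" if "n \<in> {1..}" for n using that True by (simp add: F_term_def)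
  hence "(F_term q has_sum 0) {1..}" by (rule has_sum_0)
  moreover have "lambert_term1 q = (\<lambda>_. 0)" "lambert_term2 q = (\<lambda>_. 0)"
    using True by (auto simp: lambert_term1_0 lambert_term2_0)
  ultimately show ?thesis using True
    by (auto simp: F_24_m1_def has_sum_imp_summable infsumI)
next
  case False
  \<comment> \<open>The trisected identity at r has q = r^3 as its variable, and J (3k) r = J k
    q.\<close>
  define r where "r = exp (Ln q / 3)"
  have r3: "r ^ 3 = q" using False by (simp add: r_def flip: exp_of_nat_mult)
  have "norm r ^ 3 < 1" using assms r3 by (simp flip: norm_power)
  hence "norm r < 1" by (simp add: power_less_one_iff)
  then interpret r: nome r by unfold_locales (auto simp: r_def)
  interpret nome q using assms False by unfold_locales
  obtain w :: complex where "w\<^sup>2 - w + 1 = 0" using exists_sixth_root by blast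
  hence z: "(- w)\<^sup>2 + - w + 1 = 0" by simp
  have J: "J (3 * k) r = J k q" for k using J_power[of k r 3] r3 by simp
  note J' = J[of 1, simplified] J[of 2, simplified] J[of 3, simplified] J[of 4, simplified] J[of 6, simplified] J[of 12, simplified]
  define FF where "FF = (r.h 0 + nome.h (- w * r) 0 + nome.h ((- w)\<^sup>2 * r) 0) / 3"
  define C where "C = 2 * q * (J 12 q)\<^sup>2 * (J 3 q)\<^sup>2 * (J 2 q) ^ 6 / ((J 6 q)\<^sup>2 * J 4 q * (J 1 q) ^ 3)"
  have F: "(F_term q has_sum FF) {1..}" using r.F_term_has_sum[OF z] unfolding r3 FF_def .
  have "((\<lambda>w. wcoeff w * q powi (WN w div 3)) has_sum (C - (J 6 q)\<^sup>2 / J 12 q * FF)) {w \<in> WW. 3 dvd WN w}"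
    using r.WW_trisection_has_sum[OF z] unfolding r3 J' FF_def C_def by simp
  then obtain L1 L2 where L: "(lambert_term1 q has_sum L1) UNIV" "(lambert_term2 q has_sum L2) UNIV"
    and L12: "L1 + L2 = - (C - (J 6 q)\<^sup>2 / J 12 q * FF)" using lambert_sums by blast
  have "(J 6 q)\<^sup>2 / J 12 q * FF = L1 + L2 + C" unfolding L12 by simp
  thus ?thesis using F L by (auto simp: F_24_m1_def C_def infsumI has_sum_imp_summable)
qed

end
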